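(* Let $\rho\in\mathcal{X}^{\mathbb{R}}_\kappa$ be a real character with $\kappa\neq 2$. Then exactly one of the following holds: (a) $\mathcal{E}(\rho)=\emptyset$, and $\rho$ satisfies the extended BQ-conditions; (b) $\mathcal{E}(\rho)=\{\hat X\}$ with $\hat X\in\mathscr{C}$, $\rho$ is an $\mathrm{SL}(2,\mathbb{R})$ representation, $\mathrm{tr}\,\rho(\hat X)\in(-2,2)$, and $\mathrm{tr}\,\rho(X)\notin(-2,2)$ for all $X\in\mathscr{C}\setminus\{\hat X\}$; (c) $\mathcal{E}(\rho)$ is a Cantor subset of $\mathscr{PL}$, $\rho$ is an $\mathrm{SL}(2,\mathbb{R})$ representation, $\mathrm{tr}\,\rho(X)\in(-2,2)$ for at least two distinct $X\in\mathscr{C}$, and $\mathrm{tr}\,\rho(Y)\notin(-2,2)\cup\{\pm\sqrt{\kappa+2}\}$ for some $Y\in\mathscr{C}$; (d) $\mathcal{E}(\rho)=\mathscr{PL}$, and $\rho$ is dihedral or corresponds to an $\mathrm{SU}(2)$ representation. Furthermore, case (a) occurs only when $\kappa\in(-\infty,2)\cup[18,\infty)$; case (b) only when $\kappa\in[6,\infty)$; case (c) only when $\kappa\in(2,\infty)$; and case (d) only when $\kappa\in[-2,2)\cup(2,\infty)$.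
   Context: $T$ is the one-holed torus; $\pi=\pi_1(T)$ is free on generators $X,Y$. The character variety $\mathcal{X}=\mathrm{Hom}(\pi,\mathrm{SL}(2,\mathbb{C}))/\!/\mathrm{SL}(2,\mathbb{C})$ is identified with $\mathbb{C}^3$ via $\rho\mapsto(x,y,z)=(\mathrm{tr}\,\rho(X),\mathrm{tr}\,\rho(Y),\mathrm{tr}\,\rho(XY))$. $\mathcal{X}_\kappa=\{\rho:\mathrm{tr}\,\rho(XYX^{-1}Y^{-1})=\kappa\}$, the set of $(x,y,z)$ with $x^2+y^2+z^2-xyz-2=\kappa$. A character is real if $(x,y,z)\in\mathbb{R}^3$ (real characters are characters of $\mathrm{SL}(2,\mathbb R)$ or $\mathrm{SU}(2)$ representations); $\mathcal{X}^{\mathbb R}_\kappa$ is the set of real characters in $\mathcal{X}_\kappa$. A character is dihedral if two entries of $(x,y,z)$ are zero. $\mathscr{C}$ is the set of free homotopy classes of essential (non-trivial, non-boundary-parallel) simple closed curves on $T$; $\mathrm{tr}\,\rho(W)$ is well defined for $W\in\mathscr C$. $\mathscr{PL}$ is the projective lamination space of $T$, identified with $\hat{\mathbb R}$ so that $\mathscr{C}$ corresponds to $\hat{\mathbb Q}$. $\Lambda\in\mathscr{PL}$ is an end invariant of $\rho$ if there exist $K>0$ and distinct $X_n\in\mathscr{C}$ with $X_n\to\Lambda$ and $|\mathrm{tr}\,\rho(X_n)|<K$; $\mathcal{E}(\rho)$ is the set of end invariants. $\rho$ satisfies the extended BQ-conditions if (i) $\mathrm{tr}\,\rho(X)\notin(-2,2)$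 for all $X\in\mathscr{C}$, and (ii) $|\mathrm{tr}\,\rho(X)|\le 2$ for only finitely many (possibly no) $X\in\mathscr{C}$. *)

theory Defs
  imports "HOL-Analysis.Analysis"
begin

text \<open>M2 a b c d is the matrix with rows (a, b) and (c, d).\<close>
datatype m2 = M2 complex complex complex complex

fun mmul :: "m2 \<Rightarrow> m2 \<Rightarrow> m2" where
  "mmul (M2 a b c d) (M2 e f g h) = M2 (a*e + b*g) (a*f + b*h) (c*e + d*g) (c*f + d*h)"

fun mtr :: "m2 \<Rightarrow> complex" where
  "mtr (M2 a b c d) = a + d"

fun mdet :: "m2 \<Rightarrow> complex" where
  "mdet (M2 a b c d) = a*d - b*c"

text \<open>Adjugate; equals the inverse for matrices of determinant 1.\<close>
fun madj :: "m2 \<Rightarrow> m2" where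
  "madj (M2 a b c d) = M2 d (-b) (-c) a"

fun mstar :: "m2 \<Rightarrow> m2" where
  "mstar (M2 a b c d) = M2 (cnj a) (cnj c) (cnj b) (cnj d)"

definition mid :: m2 where "mid = M2 1 0 0 1"

definition SL2C :: "m2 set" where
  "SL2C = {M. mdet M = 1}"

fun real_mat :: "m2 \<Rightarrow> bool" where
  "real_mat (M2 a b c d) = (a \<in> \<real> \<and> b \<in> \<real> \<and> c \<in> \<real> \<and> d \<in> \<real>)"

definition SL2R :: "m2 set" where
  "SL2R = {M. mdet M = 1 \<and> real_mat M}"

definition SU2 :: "m2 set" where
  "SU2 = {M. mdet M = 1 \<and> mmul (mstar M) M = mid}"

text \<open>A representation rho is given by the pair (A, B) = (rho X, rho Y) in SL(2,C).
  Its character is (x, y, z) = (tr A, tr B, tr AB).\<close>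
definition char_of :: "m2 \<Rightarrow> m2 \<Rightarrow> complex \<times> complex \<times> complex" where
  "char_of A B = (mtr A, mtr B, mtr (mmul A B))"

definition real_char :: "m2 \<Rightarrow> m2 \<Rightarrow> bool" where
  "real_char A B \<longleftrightarrow> mtr A \<in> \<real> \<and> mtr B \<in> \<real> \<and> mtr (mmul A B) \<in> \<real>"

definition comm_tr :: "m2 \<Rightarrow> m2 \<Rightarrow> complex" where
  "comm_tr A B = mtr (mmul (mmul A B) (mmul (madj A) (madj B)))"

definition SL2R_char :: "m2 \<Rightarrow> m2 \<Rightarrow> bool" where
  "SL2R_char A B \<longleftrightarrow> (\<exists>A' B'. A' \<in> SL2R \<and> B' \<in> SL2R \<and> char_of A' B' = char_of A B)"

definition SU2_char :: "m2 \<Rightarrow> m2 \<Rightarrow> bool" where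
  "SU2_char A B \<longleftrightarrow> (\<exists>A' B'. A' \<in> SU2 \<and> B' \<in> SU2 \<and> char_of A' B' = char_of A B)"

definition dihedral :: "m2 \<Rightarrow> m2 \<Rightarrow> bool" where
  "dihedral A B \<longleftrightarrow>
     (mtr A = 0 \<and> mtr B = 0) \<or> (mtr A = 0 \<and> mtr (mmul A B) = 0) \<or> (mtr B = 0 \<and> mtr (mmul A B) = 0)"

text \<open>Essential simple closed curves on the one-holed torus (free homotopy classes, unoriented)
  are in bijection with primitive homology classes (p,q) (p copies of X, q copies of Y)
  modulo sign.  We use the normalised representatives p > 0, or (p,q) = (0,1).\<close>
definition ess_curves :: "(int \<times> int) set" where
  "ess_curves = {(p, q). coprime p q \<and> (p > 0 \<or> (p = 0 \<and> q = 1))}"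

text \<open>The image under rho of a primitive word of homology class (p,q), p,q >= 0, built by the
  Euclidean recursion through the automorphisms (X,Y) -> (X,XY) and (X,Y) -> (XY,Y).\<close>
function cw :: "m2 \<Rightarrow> m2 \<Rightarrow> nat \<Rightarrow> nat \<Rightarrow> m2" where
  "cw A B p q =
     (if q = 0 then A
      else if p = 0 then B
      else if p = q then mmul A B
      else if q < p then cw A (mmul A B) (p - q) q
      else cw (mmul A B) B p (q - p))"
  by pat_completeness auto
termination by (relation "Wellfounded.measure (\<lambda>(A, B, p, q). p + q)") auto

definition curve_mat :: "m2 \<Rightarrow> m2 \<Rightarrow> int \<times> int \<Rightarrow> m2" where
  "curve_mat A B W =
     (case W of (p, q) \<Rightarrow>
        if q \<ge> 0 then cw A B (nat p) (nat q) else cw A (madj B) (nat p) (nat (- q)))"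

definition trc :: "m2 \<Rightarrow> m2 \<Rightarrow> int \<times> int \<Rightarrow> complex" where
  "trc A B W = mtr (curve_mat A B W)"

text \<open>PL(T) = projective classes of (p,q) in R^2 - {0}, i.e. the real projective line
  (= the extended real line).  We model it by the unit circle in C via the homeomorphism
  [p:q] |-> ((p + i q)/|p + i q|)^2.\<close>
definition PL :: "complex set" where
  "PL = sphere 0 1"

definition pl_pt :: "int \<times> int \<Rightarrow> complex" where
  "pl_pt W = (case W of (p, q) \<Rightarrow>
     (of_int p + \<i> * of_int q) ^ 2 / complex_of_real ((cmod (of_int p + \<i> * of_int q)) ^ 2))"

definition end_invariant :: "m2 \<Rightarrow> m2 \<Rightarrow> complex \<Rightarrow> bool" where
  "end_invariant A B L \<longleftrightarrow> L \<in> PL \<and>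
     (\<exists>K > 0. \<exists>Xs :: nat \<Rightarrow> int \<times> int.
        inj Xs \<and> range Xs \<subseteq> ess_curves \<and>
        (\<lambda>n. pl_pt (Xs n)) \<longlonglongrightarrow> L \<and> (\<forall>n. cmod (trc A B (Xs n)) < K))"

definition ends :: "m2 \<Rightarrow> m2 \<Rightarrow> complex set" where
  "ends A B = {L. end_invariant A B L}"

definition middle_third_cantor :: "real set" where
  "middle_third_cantor =
     {x. \<exists>d :: nat \<Rightarrow> nat. (\<forall>n. d n \<in> {0, 2}) \<and> x = (\<Sum>n. real (d n) / 3 ^ Suc n)}"

definition cantor_set :: "'a::topological_space set \<Rightarrow> bool" where
  "cantor_set S \<longleftrightarrow> S homeomorphic middle_third_cantor"

definition in_m2_2 :: "complex \<Rightarrow> bool" where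
  "in_m2_2 t \<longleftrightarrow> t \<in> complex_of_real ` {-2<..<2}"

definition ext_BQ :: "m2 \<Rightarrow> m2 \<Rightarrow> bool" where
  "ext_BQ A B \<longleftrightarrow>
     (\<forall>W \<in> ess_curves. \<not> in_m2_2 (trc A B W)) \<and>
     finite {W \<in> ess_curves. cmod (trc A B W) \<le> 2}"

definition case_a :: "m2 \<Rightarrow> m2 \<Rightarrow> bool" where
  "case_a A B \<longleftrightarrow> ends A B = {} \<and> ext_BQ A B"

definition case_b :: "m2 \<Rightarrow> m2 \<Rightarrow> bool" where
  "case_b A B \<longleftrightarrow> (\<exists>Xh \<in> ess_curves.
     ends A B = {pl_pt Xh} \<and> SL2R_char A B \<and> in_m2_2 (trc A B Xh) \<and>
     (\<forall>W \<in> ess_curves - {Xh}. \<not> in_m2_2 (trc A B W)))"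

text \<open>The condition tr rho(Y) not in {+sqrt(k+2), -sqrt(k+2)} is written as
  (tr rho(Y))^2 \<noteq> k + 2.\<close>
definition case_c :: "m2 \<Rightarrow> m2 \<Rightarrow> real \<Rightarrow> bool" where
  "case_c A B \<kappa> \<longleftrightarrow> cantor_set (ends A B) \<and> SL2R_char A B \<and>
     (\<exists>X1 \<in> ess_curves. \<exists>X2 \<in> ess_curves. X1 \<noteq> X2 \<and>
        in_m2_2 (trc A B X1) \<and> in_m2_2 (trc A B X2)) \<and>
     (\<exists>Y \<in> ess_curves. \<not> in_m2_2 (trc A B Y) \<and> (trc A B Y) ^ 2 \<noteq> complex_of_real (\<kappa> + 2))"

definition case_d :: "m2 \<Rightarrow> m2 \<Rightarrow> bool" where
  "case_d A B \<longleftrightarrow> ends A B = PL \<and> (dihedral A B \<or> SU2_char A B)"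

definition exactly_one :: "bool list \<Rightarrow> bool" where
  "exactly_one bs \<longleftrightarrow> length (filter id bs) = 1"

end

(*
Traces of simple closed curves form a function g on primitive integer vectors with
g(u+v) + g(u-v) = g(u) g(v) and x^2 + y^2 + z^2 - x y z = mu = kappa + 2 on every Farey triangle.
If two Farey neighbours have |g| at least 2 and the values increase across their edge, |g| grows
linearly on the cone they span.  For real characters a cone free of elliptic values (|g| < 2) which
does not grow in this way leads, by descent with a uniform gap, to a triangle from which g grows in
all three directions, so that no value at all is elliptic.  For mu < 4 all values are elliptic or
none is; for mu > 4 the set of end invariants is therefore empty or the closure of the set of
elliptic curves.  An elliptic curve u that is not the only one has an elliptic neighbour, and since
the values on the neighbours v + n u come from a rotation, infinitely many neighbours are elliptic:
the closure is perfect.  A hyperbolic curve whose squared trace is not mu is isolated from the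
elliptic ones, and a cone without such curves forces the character to be dihedral, so otherwise the
closure is nowhere dense.
*)
theory Submission
  imports Defs
begin

text \<open>Two identities carry the argument. Over a Farey edge with values x, y the two opposite
  vertices carry the roots of \<open>t^2 - x y t + x^2 + y^2 - \<mu>\<close>, with discriminant
  \<open>(x^2 - 4)(y^2 - 4) + 4(\<mu> - 4)\<close>; the sign of \<open>\<mu> - 4\<close> separates
  the two regimes, and \<open>\<mu> = 4\<close> is the degenerate value excluded by
  \<open>\<kappa> \<noteq> 2\<close>. Along the neighbours \<open>v + n u\<close> of a curve u the
  values obey a linear recurrence whose quadratic invariant equals \<open>\<mu> - g(u)^2\<close>.
  The form is definite for elliptic u and indefinite for hyperbolic u; when the invariant vanishes,
  the values near a hyperbolic u may decay, and this is the origin of the exceptional traces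
  \<open>\<plusminus>sqrt(\<kappa> + 2)\<close> in case (c). The thresholds are sums of squares: 18
  = 4 + 4 + 4 + 8 - 2 for three values of size at least 2 with negative product, and 6 = 4 + 4 - 2
  for two consecutive neighbours of a lone elliptic curve. Matrices enter only through the trace
  function and the final realizations. All estimates are made at the edge (1,0), (0,1) and
  transported by a change of basis of the integer lattice.\<close>

text \<open>The trace identities for two curves meeting once,
    indexed by homology classes; \<open>\<mu>\<close> is \<open>\<kappa> + 2\<close>.\<close>
definition markov_at :: "real \<Rightarrow> (int \<Rightarrow> int \<Rightarrow> real) \<Rightarrow> int \<Rightarrow> int \<Rightarrow> int \<Rightarrow> int \<Rightarrow> bool" where
  "markov_at \<mu> g p q r s \<longleftrightarrow>
     g (p+r) (q+s) + g (p-r) (q-s) = g p q * g r s \<and>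
     (g p q)\<^sup>2 + (g r s)\<^sup>2 + (g (p+r) (q+s))\<^sup>2 - g p q * g r s * g (p+r) (q+s) = \<mu>"

definition markov :: "real \<Rightarrow> (int \<Rightarrow> int \<Rightarrow> real) \<Rightarrow> bool" where
  "markov \<mu> g \<longleftrightarrow> (\<forall>a b. g (-a) (-b) = g a b) \<and>
     (\<forall>p q r s. \<bar>p * s - q * r\<bar> = 1 \<longrightarrow> markov_at \<mu> g p q r s)"

lemma coprime_of_det:
  fixes p q r s :: int
  assumes "\<bar>p * s - q * r\<bar> = 1"
  shows "coprime p q"
proof (rule coprimeI)
  fix c assume "c dvd p" "c dvd q"
  then have "c dvd p * s - q * r" by simp
  then show "is_unit c" using assms by (metis abs_1 dvd_abs_iff)
qed

section \<open>Traces of simple closed curves\<close>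

declare cw.simps [simp del]

lemma cw_right_0: "cw A B p 0 = A"
  by (simp add: cw.simps)

lemma cw_left_0: "q > 0 \<Longrightarrow> cw A B 0 q = B"
  by (simp add: cw.simps)

text \<open>For a coprime pair the diagonal case can only be (1,1), where both sides are the product
  \<open>A B\<close>. So the Euclidean step extends to the boundary \<open>q = p\<close>, and later
  inductions need no special case there.\<close>

lemma cw_step_X:
  assumes "coprime p q" "q \<le> p" "p > 0"
  shows "cw A B p q = cw A (mmul A B) (p - q) q"
proof (cases "p = q")
  case True
  with assms have "p = 1" "q = 1" by auto
  then show ?thesis by (simp add: cw.simps)
next
  case False
  then show ?thesis
    using assms by (cases "q = 0") (simp_all add: cw_right_0 cw.simps[of A B p q])
qed

lemma cw_step_Y:
  assumes "coprime p q" "p \<le> q" "q > 0"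
  shows "cw A B p q = cw (mmul A B) B p (q - p)"
proof (cases "p = q")
  case True
  with assms have "p = 1" "q = 1" by auto
  then show ?thesis by (simp add: cw.simps)
next
  case False
  then show ?thesis
    using assms by (cases "p = 0") (simp_all add: cw_left_0 cw.simps[of A B p q])
qed

lemma mdet_mmul: "mdet (mmul M N) = mdet M * mdet N"
  by (cases M; cases N) (simp add: algebra_simps)

lemma mdet_madj: "mdet (madj M) = mdet M"
  by (cases M) (simp add: algebra_simps)

lemma mmul_assoc: "mmul (mmul L M) N = mmul L (mmul M N)"
  by (cases L; cases M; cases N) (simp add: algebra_simps)

lemma madj_madj: "madj (madj M) = M"
  by (cases M) simp

lemma mtr_madj: "mtr (madj M) = mtr M"
  by (cases M) simp

lemma mtr_mmul_commute: "mtr (mmul M N) = mtr (mmul N M)"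
  by (cases M; cases N) (simp add: algebra_simps)

lemma mtr_mmul_madj: "mtr (mmul M N) + mtr (mmul M (madj N)) = mtr M * mtr N"
  by (cases M; cases N) (simp add: algebra_simps)

text \<open>Cayley-Hamilton, \<open>M^2 - tr(M) M + 1 = 0\<close>, multiplied by
  \<open>N\<close>.\<close>

lemma mtr_mmul_left_square:
  assumes "mdet M = 1"
  shows "mtr (mmul M (mmul M N)) + mtr N = mtr M * mtr (mmul M N)"
proof (cases M; cases N)
  fix a b c d e f g h
  assume *: "M = M2 a b c d" "N = M2 e f g h"
  have "mtr (mmul M (mmul M N)) + mdet M * mtr N = mtr M * mtr (mmul M N)"
    by (simp add: * algebra_simps)
  then show ?thesis using assms by simp
qed

lemma mtr_mmul_right_square:
  assumes "mdet N = 1"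
  shows "mtr (mmul (mmul M N) N) + mtr M = mtr (mmul M N) * mtr N"
  using mtr_mmul_left_square[OF assms, of "M"]
  by (metis mtr_mmul_commute mmul_assoc mult.commute)

text \<open>Fricke's commutator identity.\<close>

lemma comm_tr_eq:
  assumes "mdet M = 1" "mdet N = 1"
  shows "comm_tr M N = (mtr M)\<^sup>2 + (mtr N)\<^sup>2 + (mtr (mmul M N))\<^sup>2
    - mtr M * mtr N * mtr (mmul M N) - 2"
proof (cases M; cases N)
  fix a b c d e f g h
  assume *: "M = M2 a b c d" "N = M2 e f g h"
  have d: "a * d = 1 + b * c" "e * h = 1 + f * g" using assms by (simp_all add: * algebra_simps)
  \<comment> \<open>Homogenised by determinants, the identity is polynomial in the eight entries and
    holds for all matrices.\<close>
  have "comm_tr M N = (mtr M)\<^sup>2 * mdet N + (mtr N)\<^sup>2 * mdet M + (mtr (mmul M N))\<^sup>2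
    - mtr M * mtr N * mtr (mmul M N) - 2 * mdet M * mdet N"
    by (simp add: * comm_tr_def algebra_simps power2_eq_square)
  then show ?thesis using assms by simp
qed

text \<open>The Fricke polynomial is a monic quadratic in each trace, and the new trace is its other
  root. The same reason gives the two variants below, so the commutator trace is unchanged by a
  change of marking.\<close>

lemma comm_tr_mmul_right:
  assumes "mdet M = 1" "mdet N = 1"
  shows "comm_tr M (mmul M N) = comm_tr M N"
proof -
  have eq: "mtr (mmul M (mmul M N)) = mtr M * mtr (mmul M N) - mtr N"
    using mtr_mmul_left_square[OF assms(1), of N] by (simp add: eq_diff_eq)
  show ?thesis
    by (simp only: comm_tr_eq assms mdet_mmul mdet_madj mtr_madj eq mult_1)
      (simp add: algebra_simps power2_eq_square)
qed

lemma comm_tr_mmul_left: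
  assumes "mdet M = 1" "mdet N = 1"
  shows "comm_tr (mmul M N) N = comm_tr M N"
proof -
  have eq: "mtr (mmul (mmul M N) N) = mtr (mmul M N) * mtr N - mtr M"
    using mtr_mmul_right_square[OF assms(2), of M] by (simp add: eq_diff_eq)
  show ?thesis
    by (simp only: comm_tr_eq assms mdet_mmul mdet_madj mtr_madj eq mult_1)
      (simp add: algebra_simps power2_eq_square)
qed

lemma comm_tr_madj:
  assumes "mdet M = 1" "mdet N = 1"
  shows "comm_tr M (madj N) = comm_tr M N"
proof -
  have eq: "mtr (mmul M (madj N)) = mtr M * mtr N - mtr (mmul M N)"
    using mtr_mmul_madj[of M N] by (simp add: eq_diff_eq add.commute)
  show ?thesis
    by (simp only: comm_tr_eq assms mdet_mmul mdet_madj mtr_madj eq mult_1)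
      (simp add: algebra_simps power2_eq_square)
qed

lemma mdet_cw: "mdet A = 1 \<Longrightarrow> mdet B = 1 \<Longrightarrow> mdet (cw A B p q) = 1"
proof (induction A B p q rule: cw.induct)
  case (1 A B p q)
  then show ?case
    by (subst cw.simps) (auto simp: mdet_mmul)
qed

lemma mtr_cw_real:
  assumes "mdet A = 1" "mdet B = 1" "mtr A \<in> \<real>" "mtr B \<in> \<real>" "mtr (mmul A B) \<in> \<real>"
  shows "mtr (cw A B p q) \<in> \<real>"
  using assms
proof (induction A B p q rule: cw.induct)
  case (1 A B p q)
  have "mtr (mmul A (mmul A B)) = mtr A * mtr (mmul A B) - mtr B"
    using mtr_mmul_left_square[of A B] 1 by (simp add: eq_diff_eq)
  moreover have "mtr (mmul (mmul A B) B) = mtr (mmul A B) * mtr B - mtr A"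
    using mtr_mmul_right_square[of B A] 1 by (simp add: eq_diff_eq)
  ultimately show ?case
    using 1 by (subst cw.simps) (auto simp: mdet_mmul)
qed

text \<open>The standard factorisation of Christoffel words: the word of smaller slope stands on the
  left. Apart from the initial pair (1,0), (0,1), two neighbours lie weakly on the same side of the
  diagonal, so one Euclidean step applies to both at once and the induction descends with a new
  marking.\<close>

lemma cw_add:
  assumes "mdet A = 1" "mdet B = 1" "p * s = q * r + 1"
  shows "cw A B (p + r) (q + s) = mmul (cw A B p q) (cw A B r s) \<and>
    comm_tr (cw A B p q) (cw A B r s) = comm_tr A B"
  using assms
proof (induction "p + q + r + s" arbitrary: A B p q r s rule: less_induct)
  case less
  have ps: "p > 0" "s > 0" using less.prems by (auto intro: Nat.gr0I)
  have det: "\<bar>int p * int s - int q * int r\<bar> = 1"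
  proof -
    have "int (p * s) = int (q * r + 1)" using less.prems(3) by presburger
    then show ?thesis by simp
  qed
  then have "\<bar>int (p + r) * int s - int (q + s) * int r\<bar> = 1"
    by (simp add: algebra_simps)
  then have cop: "coprime p q" "coprime r s" "coprime (p + r) (q + s)"
    using det coprime_of_det[of "int p" "int s" "int q" "int r"] coprime_of_det[of "int s" "int p"
        "int r" "int q"]
      coprime_of_det[of "int (p + r)" "int s" "int (q + s)" "int r"]
    by (simp_all add: coprime_commute mult.commute del: of_nat_add)
  consider "q = 0" "r = 0" | "q < p" "s \<le> r" "r > 0" | "p \<le> q" "r < s" "q > 0"
  proof -
    have "r < s" if "p \<le> q"
    proof (rule ccontr)
      assume "\<not> r < s"
      then have "p * s \<le> q * r" using that by (intro mult_mono) auto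
      then show False using less.prems by simp
    qed
    moreover have "q = 0 \<and> r = 0" if "q < p" "r < s"
    proof -
      have "(q + 1) * (r + 1) \<le> p * s" using that by (intro mult_mono) auto
      then show ?thesis using less.prems by (simp add: algebra_simps)
    qed
    ultimately show ?thesis using that ps by (metis gr_zeroI not_less less_le_trans)
  qed
  then show ?case
  proof cases
    case 1
    then have "p = 1" "s = 1" using less.prems by auto
    then show ?thesis using 1 less.prems by (simp add: cw.simps[of A B])
  next
    case 2
    have "cw A (mmul A B) ((p - q) + (r - s)) (q + s)
        = mmul (cw A (mmul A B) (p - q) q) (cw A (mmul A B) (r - s) s) \<and>
      comm_tr (cw A (mmul A B) (p - q) q) (cw A (mmul A B) (r - s) s) = comm_tr A (mmul A B)"
    proof (rule less.hyps)
      show "p - q + q + (r - s) + s < p + q + r + s" using 2 ps by auto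
      show "(p - q) * s = q * (r - s) + 1"
        using 2 less.prems(3) mult_le_mono2[of s r q] by (simp add: diff_mult_distrib
            diff_mult_distrib2 Suc_diff_le)
    qed (use less.prems in \<open>auto simp: mdet_mmul\<close>)
    moreover have "(p - q) + (r - s) = (p + r) - (q + s)" using 2 by auto
    ultimately show ?thesis
      using cop ps 2 less.prems by (simp add: cw_step_X[of _ _ A B] comm_tr_mmul_right)
  next
    case 3
    have "cw (mmul A B) B (p + r) ((q - p) + (s - r))
        = mmul (cw (mmul A B) B p (q - p)) (cw (mmul A B) B r (s - r)) \<and>
      comm_tr (cw (mmul A B) B p (q - p)) (cw (mmul A B) B r (s - r)) = comm_tr (mmul A B) B"
    proof (rule less.hyps)
      show "p + (q - p) + r + (s - r) < p + q + r + s" using 3 ps by auto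
      show "p * (s - r) = (q - p) * r + 1"
        using 3 less.prems(3) mult_le_mono1[of p q r] by (simp add: diff_mult_distrib
            diff_mult_distrib2 Suc_diff_le)
    qed (use less.prems in \<open>auto simp: mdet_mmul\<close>)
    moreover have "(q - p) + (s - r) = (q + s) - (p + r)" using 3 by auto
    ultimately show ?thesis
      using cop ps 3 less.prems by (simp add: cw_step_Y[of _ _ A B] comm_tr_mmul_left)
  qed
qed

text \<open>Absolute values make the function even, so it may be evaluated at any integer vector and
  not only at the normalised ones; the adjugate is the inverse of \<open>B\<close> and serves the
  mixed-sign quadrants. Only values at primitive vectors have a meaning. \<open>Re\<close> loses
  nothing for real characters.\<close>

definition trace_fn :: "m2 \<Rightarrow> m2 \<Rightarrow> int \<Rightarrow> int \<Rightarrow> real" where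
  "trace_fn A B p q =
     Re (mtr (if p * q \<ge> 0 then cw A B (nat \<bar>p\<bar>) (nat \<bar>q\<bar>) else cw A (madj B) (nat \<bar>p\<bar>) (nat \<bar>q\<bar>)))"

lemma real_char_madj:
  assumes "real_char A B"
  shows "real_char A (madj B)"
proof -
  have "mtr (mmul A (madj B)) = mtr A * mtr B - mtr (mmul A B)"
    using mtr_mmul_madj[of A B] by (simp add: algebra_simps)
  then show ?thesis using assms by (simp add: real_char_def mtr_madj)
qed

lemma trc_eq_trace_fn:
  assumes "A \<in> SL2C" "B \<in> SL2C" "real_char A B" "(p, q) \<in> ess_curves"
  shows "trc A B (p, q) = of_real (trace_fn A B p q)"
proof -
  have 1: "mtr (cw A B m n) \<in> \<real>" for m n
    using assms by (intro mtr_cw_real) (auto simp: SL2C_def real_char_def)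
  have 2: "mtr (cw A (madj B) m n) \<in> \<real>" for m n
    using assms real_char_madj[OF assms(3)]
    by (intro mtr_cw_real) (auto simp: SL2C_def real_char_def mdet_madj)
  have "p \<ge> 0" "q < 0 \<Longrightarrow> p > 0" using assms(4) by (auto simp: ess_curves_def)
  then show ?thesis
    using 1 2 by (auto simp: trc_def curve_mat_def trace_fn_def mult_less_0_iff zero_le_mult_iff)
qed

lemma trace_fn_minus: "trace_fn A B (-p) (-q) = trace_fn A B p q"
  by (simp add: trace_fn_def)

text \<open>Replacing Y by its inverse reflects the plane. This transfers the relations from the
  positive quadrants to the mixed-sign ones.\<close>

lemma trace_fn_madj: "trace_fn A (madj B) p q = trace_fn A B p (-q)"
proof (cases "p * q = 0")
  case True
  then show ?thesis
    by (cases "q = 0") (auto simp: trace_fn_def cw_right_0 cw_left_0 mtr_madj)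
next
  case False
  then have "p * q \<ge> 0 \<longleftrightarrow> \<not> p * (-q) \<ge> 0" by auto
  then show ?thesis using False by (auto simp: trace_fn_def madj_madj)
qed

lemma trace_fn_basis:
  assumes "A \<in> SL2C" "B \<in> SL2C" "real_char A B"
  shows "trace_fn A B 1 0 = Re (mtr A)" "trace_fn A B 0 1 = Re (mtr B)"
    "trace_fn A B 1 1 = Re (mtr (mmul A B))" "trace_fn A B 1 (-1) = Re (mtr (mmul A (madj B)))"
  by (simp_all add: trace_fn_def cw.simps)

section \<open>The trace function satisfies the Markov relations at every Farey edge\<close>

lemma markov_at_swap:
  assumes "\<And>a b. g (-a) (-b) = g a b"
  shows "markov_at \<mu> g p q r s \<Longrightarrow> markov_at \<mu> g r s p q"
  using assms[of "p - r" "q - s"] by (simp add: markov_at_def algebra_simps)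

text \<open>The sign change exchanges the two vertices opposite to the edge; the vertex relation
  holds at one exactly when it holds at the other, since they are the two roots of one
  quadratic.\<close>

lemma markov_at_minus:
  assumes "\<And>a b. g (-a) (-b) = g a b" "markov_at \<mu> g p q (-r) (-s)"
  shows "markov_at \<mu> g p q r s"
proof -
  have 1: "g (p-r) (q-s) + g (p+r) (q+s) = g p q * g r s"
    and 2: "(g p q)\<^sup>2 + (g r s)\<^sup>2 + (g (p-r) (q-s))\<^sup>2 - g p q * g r s * g (p-r) (q-s) = \<mu>"
    using assms by (simp_all add: markov_at_def)
  have 3: "g (p-r) (q-s) = g p q * g r s - g (p+r) (q+s)" using 1 by simp
  show ?thesis using 1 2 unfolding 3 markov_at_def
    by (simp add: algebra_simps power2_eq_square)
qed

lemma markov_at_trace_fn_nat: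
  fixes p q r s :: nat
  assumes AB: "A \<in> SL2C" "B \<in> SL2C" "real_char A B" "comm_tr A B = of_real \<kappa>"
    and det: "p * s = q * r + 1"
  shows "markov_at (\<kappa> + 2) (trace_fn A B) (int p) (int q) (int r) (int s)"
proof -
  have d: "mdet A = 1" "mdet B = 1" using AB by (auto simp: SL2C_def)
  have real: "mtr (cw A B m n) = of_real (trace_fn A B (int m) (int n))" for m n
  proof -
    have "mtr (cw A B m n) \<in> \<real>"
      using AB d by (intro mtr_cw_real) (auto simp: real_char_def)
    then show ?thesis by (simp add: trace_fn_def)
  qed
  define U where "U = cw A B p q"
  define V where "V = cw A B r s"
  have UV: "cw A B (p + r) (q + s) = mmul U V" "comm_tr U V = comm_tr A B"
    using cw_add[OF d det] by (simp_all add: U_def V_def)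
  have dUV: "mdet U = 1" "mdet V = 1" using d by (simp_all add: U_def V_def mdet_cw)
  let ?g = "trace_fn A B"
  have tr: "mtr U = of_real (?g p q)" "mtr V = of_real (?g r s)"
    "mtr (mmul U V) = of_real (?g (int p + int r) (int q + int s))"
    using real[of p q] real[of r s] real[of "p + r" "q + s"] by (simp_all add: U_def V_def UV)
  have "complex_of_real ((?g p q)\<^sup>2 + (?g r s)\<^sup>2 + (?g (int p + int r) (int q + int s))\<^sup>2
      - ?g p q * ?g r s * ?g (int p + int r) (int q + int s)) = of_real (\<kappa> + 2)"
    using comm_tr_eq[OF dUV] UV(2) AB(4) unfolding tr by (simp add: algebra_simps)
  then have vert: "(?g p q)\<^sup>2 + (?g r s)\<^sup>2 + (?g (int p + int r) (int q + int s))\<^sup>2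
      - ?g p q * ?g r s * ?g (int p + int r) (int q + int s) = \<kappa> + 2"
    by (simp only: of_real_eq_iff)
  have "of_real (?g (int p + int r) (int q + int s)) + of_real (?g (int p - int r) (int q - int s))
      = (of_real (?g p q * ?g r s) :: complex)"
  proof -
    \<comment> \<open>The difference of two neighbours stays in the quadrant up to sign, where
      \<open>cw_add\<close> splits one word off the other. The initial pair is the exception: its
      difference (1,-1) belongs to the word of X and the inverse of Y.\<close>
    consider "p = 1" "q = 0" "r = 0" "s = 1" | "r \<le> p" "s \<le> q" | "p \<le> r" "q \<le> s"
    proof -
      have "p = 1 \<and> q = 0 \<and> r = 0 \<and> s = 1" if "r < p" "q < s"
      proof -
        have "(r + 1) * (q + 1) \<le> p * s" using that by (intro mult_mono) auto
        then have "q = 0" "r = 0" using det by (auto simp: algebra_simps)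
        then show ?thesis using det by auto
      qed
      moreover have "\<not> (p < r \<and> s < q)"
      proof
        assume "p < r \<and> s < q"
        then have "p * s \<le> r * q" by (intro mult_mono) auto
        then show False using det by (simp add: mult.commute)
      qed
      ultimately show ?thesis using that by linarith
    qed
    then show ?thesis
    proof cases
      case 1
      have "mtr (mmul A (madj B)) \<in> \<real>" "mtr A \<in> \<real>" "mtr B \<in> \<real>" "mtr (mmul A B) \<in> \<real>"
        using AB(3) real_char_madj[OF AB(3)] by (simp_all add: real_char_def)
      then show ?thesis
        using 1 mtr_mmul_madj[of A B] AB by (simp add: trace_fn_basis)
    next
      case 2
      have "p * s - r * s = q * r + 1 - s * r" using det by (simp add: mult.commute)
      also have "\<dots> = (q * r - s * r) + 1" using 2 by (simp add: Suc_diff_le)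
      finally have "(p - r) * s = (q - s) * r + 1" by (simp add: diff_mult_distrib)
      from cw_add[OF d this] 2 have U: "U = mmul (cw A B (p - r) (q - s)) V"
        by (simp add: U_def V_def)
      have "mtr (mmul U V) + mtr (cw A B (p - r) (q - s)) = mtr U * mtr V"
        unfolding U by (rule mtr_mmul_right_square[OF dUV(2)])
      then show ?thesis using 2 by (simp add: tr real of_nat_diff)
    next
      case 3
      have "p * s - p * q = q * r + 1 - q * p" using det by (simp add: mult.commute)
      also have "\<dots> = (q * r - q * p) + 1" using 3 by (simp add: Suc_diff_le)
      finally have "p * (s - q) = q * (r - p) + 1" by (simp add: diff_mult_distrib2)
      from cw_add[OF d this] 3 have V: "V = mmul U (cw A B (r - p) (s - q))"
        by (simp add: U_def V_def)
      have "mtr (mmul U V) + mtr (cw A B (r - p) (s - q)) = mtr U * mtr V"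
        unfolding V by (rule mtr_mmul_left_square[OF dUV(1)])
      moreover have "?g (int p - int r) (int q - int s) = ?g (int r - int p) (int s - int q)"
        using trace_fn_minus[of A B "int p - int r" "int q - int s"] by simp
      ultimately show ?thesis using 3 by (simp add: tr real of_nat_diff)
    qed
  qed
  then have "?g (int p + int r) (int q + int s) + ?g (int p - int r) (int q - int s) =
      ?g p q * ?g r s"
    unfolding of_real_add[symmetric] of_real_eq_iff .
  with vert show ?thesis by (simp add: markov_at_def)
qed

lemma markov_at_trace_fn_nonneg:
  assumes AB: "A \<in> SL2C" "B \<in> SL2C" "real_char A B" "comm_tr A B = of_real \<kappa>"
    and det: "\<bar>p * s - q * r\<bar> = 1" and nonneg: "p \<ge> 0" "q \<ge> 0" "r \<ge> 0" "s \<ge> 0"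
  shows "markov_at (\<kappa> + 2) (trace_fn A B) p q r s"
proof -
  have *: "markov_at (\<kappa> + 2) (trace_fn A B) p q r s"
    if "p * s - q * r = 1" "p \<ge> 0" "q \<ge> 0" "r \<ge> 0" "s \<ge> 0" for p q r s
  proof -
    have "nat p * nat s = nat q * nat r + 1"
    proof -
      have "int (nat p * nat s) = int (nat q * nat r + 1)" using that by simp
      then show ?thesis by linarith
    qed
    from markov_at_trace_fn_nat[OF AB this] that show ?thesis by simp
  qed
  consider "p * s - q * r = 1" | "r * q - s * p = 1" using det by (auto simp: mult.commute abs_if
      split: if_splits)
  then show ?thesis
  proof cases
    case 1
    then show ?thesis using * nonneg by simp
  next
    case 2
    then have "markov_at (\<kappa> + 2) (trace_fn A B) r s p q"
      using * nonneg by (simp add: mult.commute)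
    then show ?thesis by (rule markov_at_swap[where g = "trace_fn A B", OF trace_fn_minus])
  qed
qed

lemma markov_at_trace_fn_quadrant:
  assumes AB: "A \<in> SL2C" "B \<in> SL2C" "real_char A B" "comm_tr A B = of_real \<kappa>"
    and det: "\<bar>p * s - q * r\<bar> = 1" and sgn: "p * q \<ge> 0" "r * s \<ge> 0"
  shows "markov_at (\<kappa> + 2) (trace_fn A B) p q r s"
proof -
  note minus = trace_fn_minus
  have v: "markov_at (\<kappa> + 2) (trace_fn A B) p q r s"
    if "\<bar>p * s - q * r\<bar> = 1" "p \<ge> 0" "q \<ge> 0" "r * s \<ge> 0" for p q r s
  proof (cases "r \<ge> 0 \<and> s \<ge> 0")
    case True
    then show ?thesis using markov_at_trace_fn_nonneg[OF AB] that by blast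
  next
    case False
    then have "-r \<ge> 0" "-s \<ge> 0" using that(4) by (auto simp: zero_le_mult_iff)
    moreover have "\<bar>p * (-s) - q * (-r)\<bar> = 1" using that(1) by (simp add: abs_minus_commute)
    ultimately have "markov_at (\<kappa> + 2) (trace_fn A B) p q (-r) (-s)"
      using markov_at_trace_fn_nonneg[OF AB] that(2,3) by blast
    then show ?thesis by (rule markov_at_minus[where g = "trace_fn A B", OF minus])
  qed
  show ?thesis
  proof (cases "p \<ge> 0 \<and> q \<ge> 0")
    case True
    then show ?thesis using v det sgn by blast
  next
    case False
    then have "-p \<ge> 0" "-q \<ge> 0" using sgn(1) by (auto simp: zero_le_mult_iff)
    moreover have "\<bar>(-p) * s - (-q) * r\<bar> = 1" using det by (simp add: abs_minus_commute)
    ultimately have "markov_at (\<kappa> + 2) (trace_fn A B) (-p) (-q) r s" using v sgn by blast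
    from markov_at_minus[where g = "trace_fn A B", OF minus markov_at_swap[where g = "trace_fn A B",
        OF minus this]]
    show ?thesis by (rule markov_at_swap[where g = "trace_fn A B", OF minus])
  qed
qed

text \<open>For vectors in different open quadrants \<open>p s\<close> and \<open>q r\<close> would
  be nonzero of opposite signs, so the determinant would have absolute value at least 2.\<close>

lemma same_quadrant_of_det:
  fixes p q r s :: int
  assumes "\<bar>p * s - q * r\<bar> = 1"
  shows "(p * q \<ge> 0 \<and> r * s \<ge> 0) \<or> (p * q \<le> 0 \<and> r * s \<le> 0)"
proof (rule ccontr)
  assume "\<not> ?thesis"
  then have "(p * q < 0 \<and> r * s > 0) \<or> (p * q > 0 \<and> r * s < 0)" by linarith
  then have "p * q * (r * s) < 0" and nz: "p \<noteq> 0" "q \<noteq> 0" "r \<noteq> 0" "s \<noteq> 0"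
    using mult_neg_pos[of "p * q" "r * s"] mult_pos_neg[of "p * q" "r * s"] by auto
  then have "(p * s) * (q * r) < 0" by (simp add: mult_ac)
  then have "(p * s > 0 \<and> q * r < 0) \<or> (p * s < 0 \<and> q * r > 0)"
    unfolding mult_less_0_iff .
  then show False using assms by linarith
qed

lemma markov_trace_fn:
  assumes AB: "A \<in> SL2C" "B \<in> SL2C" "real_char A B" "comm_tr A B = of_real \<kappa>"
  shows "markov (\<kappa> + 2) (trace_fn A B)"
proof -
  have "markov_at (\<kappa> + 2) (trace_fn A B) p q r s" if det: "\<bar>p * s - q * r\<bar> = 1" for p q r s
  proof (cases "p * q \<ge> 0 \<and> r * s \<ge> 0")
    case True
    then show ?thesis using markov_at_trace_fn_quadrant[OF AB det] by blast
  next
    case False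
    then have neg: "p * q \<le> 0" "r * s \<le> 0" using same_quadrant_of_det[OF det] by auto
    have AB': "A \<in> SL2C" "madj B \<in> SL2C" "real_char A (madj B)" "comm_tr A (madj B) = of_real \<kappa>"
      using AB real_char_madj[OF AB(3)] by (auto simp: SL2C_def mdet_madj comm_tr_madj)
    have "markov_at (\<kappa> + 2) (trace_fn A (madj B)) p (-q) r (-s)"
      using det neg by (intro markov_at_trace_fn_quadrant[OF AB']) (auto simp: abs_minus_commute)
    then show ?thesis by (simp add: markov_at_def trace_fn_madj add.commute[of s q])
  qed
  then show ?thesis by (simp add: markov_def trace_fn_minus)
qed

section \<open>Growth on Farey cones\<close>

lemma markov_minus: "markov \<mu> g \<Longrightarrow> g (-a) (-b) = g a b"
  by (simp add: markov_def)

lemma markov_sum: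
  assumes "markov \<mu> g" "\<bar>p * s - q * r\<bar> = 1"
  shows "g (p+r) (q+s) + g (p-r) (q-s) = g p q * g r s"
  using assms by (simp add: markov_def markov_at_def)

lemma markov_vertex:
  assumes "markov \<mu> g" "\<bar>p * s - q * r\<bar> = 1"
  shows "(g p q)\<^sup>2 + (g r s)\<^sup>2 + (g (p+r) (q+s))\<^sup>2 - g p q * g r s * g (p+r) (q+s) = \<mu>"
  using assms by (simp add: markov_def markov_at_def)

definition rebase :: "(int \<Rightarrow> int \<Rightarrow> real) \<Rightarrow> int \<Rightarrow> int \<Rightarrow> int \<Rightarrow> int \<Rightarrow> int \<Rightarrow> int \<Rightarrow> real" where
  "rebase g p q r s a b = g (a * p + b * r) (a * q + b * s)"

lemma markov_rebase:
  assumes g: "markov \<mu> g" and det: "\<bar>p * s - q * r\<bar> = 1"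
  shows "markov \<mu> (rebase g p q r s)"
  unfolding markov_def
proof (intro conjI allI impI)
  fix a b
  show "rebase g p q r s (-a) (-b) = rebase g p q r s a b"
    using markov_minus[OF g, of "a * p + b * r" "a * q + b * s"] by (simp add: rebase_def)
next
  fix a b c d :: int assume "\<bar>a * d - b * c\<bar> = 1"
  then have "\<bar>(a * d - b * c) * (p * s - q * r)\<bar> = 1" using det by (simp add: abs_mult)
  moreover have "(a * p + b * r) * (c * q + d * s) - (a * q + b * s) * (c * p + d * r)
    = (a * d - b * c) * (p * s - q * r)" by (simp add: algebra_simps)
  ultimately have "\<bar>(a * p + b * r) * (c * q + d * s) - (a * q + b * s) * (c * p + d * r)\<bar> = 1"
    by simp
  then have "markov_at \<mu> g (a * p + b * r) (a * q + b * s) (c * p + d * r) (c * q + d * s)"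
    using g by (simp add: markov_def)
  then show "markov_at \<mu> (rebase g p q r s) a b c d"
    by (simp add: markov_at_def rebase_def algebra_simps)
qed

lemma coprime_diff_left: "coprime (a - b) b \<longleftrightarrow> coprime a b" for a b :: int
  by (simp add: coprime_iff_gcd_eq_1 gcd_diff1)

lemma coprime_diff_right: "coprime a (b - a) \<longleftrightarrow> coprime a b" for a b :: int
  using coprime_diff_left[of b a] by (simp only: coprime_commute[of a])

lemma coprime_rebase:
  fixes p q r s a b :: int
  assumes det: "\<bar>p * s - q * r\<bar> = 1" and "coprime a b"
  shows "coprime (a * p + b * r) (a * q + b * s)"
proof (rule coprimeI)
  fix c assume "c dvd a * p + b * r" "c dvd a * q + b * s"
  then have "c dvd (a * p + b * r) * s - (a * q + b * s) * r"
    "c dvd (a * q + b * s) * p - (a * p + b * r) * q" by simp_all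
  then have "c dvd a * (p * s - q * r)" "c dvd b * (p * s - q * r)"
    by (simp_all add: algebra_simps)
  moreover have "p * s - q * r = 1 \<or> p * s - q * r = -1" using det by linarith
  ultimately have "c dvd a" "c dvd b" by (auto simp del: right_diff_distrib')
  then show "is_unit c" using \<open>coprime a b\<close> by (simp add: coprime_def)
qed

lemma rebase_coordinates:
  fixes p q r s a b :: int
  assumes det: "\<bar>p * s - q * r\<bar> = 1" and cop: "coprime a b"
  obtains c d where "coprime c d" "a = c * p + d * r" "b = c * q + d * s"
proof -
  define e where "e = p * s - q * r"
  have e2: "e * e = 1" using det unfolding e_def[symmetric] by (metis abs_mult_self_eq mult_1)
  \<comment> \<open>Cramer's rule; the determinant \<open>e\<close> is a sign and hence its own
    inverse.\<close>
  define c where "c = e * (a * s - b * r)"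
  define d where "d = e * (b * p - a * q)"
  have "c * p + d * r = e * (a * e)" "c * q + d * s = e * (b * e)"
    by (simp_all add: c_def d_def e_def algebra_simps)
  then have ab: "a = c * p + d * r" "b = c * q + d * s"
    using e2 by (simp_all add: mult.left_commute)
  have "coprime c d"
  proof (rule coprimeI)
    fix k assume "k dvd c" "k dvd d"
    then have "k dvd a" "k dvd b" using ab by simp_all
    then show "is_unit k" using cop by (simp add: coprime_def)
  qed
  with ab show ?thesis using that by blast
qed

text \<open>A vertex of the Farey tree determines the values on the whole cone spanned by its two
  outer vectors, so a property of triples inherited by the two children holds throughout.\<close>
lemma sector_induct:
  assumes "markov \<mu> g" "T (g 1 0) (g 0 1) (g 1 1)"
    and step: "\<And>x y z. T x y z \<Longrightarrow> x\<^sup>2 + y\<^sup>2 + z\<^sup>2 - x * y * z = \<mu> \<Longrightarrow>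
        T x z (x * z - y) \<and> T z y (y * z - x)"
    and "a \<ge> 1" "b \<ge> 1" "coprime a b"
  shows "\<exists>x y. T x y (g a b)"
  using assms(1,2,4-6)
proof (induction "nat (a + b)" arbitrary: a b g rule: less_induct)
  case (less a b g)
  note g = \<open>markov \<mu> g\<close>
  have v: "(g 1 0)\<^sup>2 + (g 0 1)\<^sup>2 + (g 1 1)\<^sup>2 - g 1 0 * g 0 1 * g 1 1 = \<mu>"
    using markov_vertex[OF g, of 1 1 0 0] by simp
  have 21: "g 2 1 = g 1 0 * g 1 1 - g 0 1" "g 1 2 = g 0 1 * g 1 1 - g 1 0"
    using markov_sum[OF g, of 1 0 1 1] markov_sum[OF g, of 1 1 1 0] by (simp_all add: algebra_simps)
  consider "a = b" | "b < a" | "a < b" by linarith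
  then show ?case
  proof cases
    case 1
    then have "a = 1" "b = 1" using less.prems by auto
    then show ?thesis using less.prems by auto
  next
    case 2
    have "\<exists>x y. T x y (rebase g 1 0 1 1 (a - b) b)"
    proof (rule less.hyps)
      show "markov \<mu> (rebase g 1 0 1 1)" by (rule markov_rebase[OF g]) simp
      show "T (rebase g 1 0 1 1 1 0) (rebase g 1 0 1 1 0 1) (rebase g 1 0 1 1 1 1)"
        using step[OF less.prems(2) v] by (simp add: rebase_def 21)
      show "coprime (a - b) b" using less.prems coprime_diff_left by blast
    qed (use 2 less.prems in auto)
    then show ?thesis by (simp add: rebase_def)
  next
    case 3
    have "\<exists>x y. T x y (rebase g 1 1 0 1 a (b - a))"
    proof (rule less.hyps)
      show "markov \<mu> (rebase g 1 1 0 1)" by (rule markov_rebase[OF g]) simp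
      show "T (rebase g 1 1 0 1 1 0) (rebase g 1 1 0 1 0 1) (rebase g 1 1 0 1 1 1)"
        using step[OF less.prems(2) v] by (simp add: rebase_def 21)
      show "coprime a (b - a)" using less.prems coprime_diff_right by blast
    qed (use 3 less.prems in auto)
    then show ?thesis by (simp add: rebase_def)
  qed
qed

text \<open>A test at one edge that forces linear growth on the whole cone \<open>a,
    b \<ge> 0\<close>; the test for any other
  Farey interval is obtained by applying it to a rebased function.\<close>
definition grows :: "(int \<Rightarrow> int \<Rightarrow> real) \<Rightarrow> bool" where
  "grows g \<longleftrightarrow> 2 \<le> \<bar>g 1 0\<bar> \<and> 2 \<le> \<bar>g 0 1\<bar> \<and> \<bar>g 1 0\<bar> < \<bar>g 1 1\<bar> \<and> \<bar>g 0 1\<bar> < \<bar>g 1 1\<bar>"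

text \<open>The linear form with values \<open>d\<close>, \<open>e\<close> at the outer vectors
  takes the value \<open>d + e\<close> at their sum. Since \<open>\<bar>g 2 1\<bar> \<ge> 2 \<bar>g
  1 1\<bar> - \<bar>g 0 1\<bar>\<close>, the increments along the edges of a child cone are at least
  those required for the pair \<open>d\<close>, \<open>d + e\<close>; symmetrically for the other
  child.\<close>

lemma growth_bound:
  assumes "markov \<mu> g" "2 \<le> \<bar>g 1 0\<bar>" "2 \<le> \<bar>g 0 1\<bar>" "d \<le> \<bar>g 1 0\<bar>" "e \<le> \<bar>g 0 1\<bar>"
    "\<bar>g 1 0\<bar> + e \<le> \<bar>g 1 1\<bar>" "\<bar>g 0 1\<bar> + d \<le> \<bar>g 1 1\<bar>" "0 \<le> d" "0 \<le> e"
    "0 \<le> a" "0 \<le> b" "coprime a b"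
  shows "2 \<le> \<bar>g a b\<bar> \<and> d * a + e * b \<le> \<bar>g a b\<bar>"
  using assms
proof (induction "nat (a + b)" arbitrary: a b g d e rule: less_induct)
  case (less a b g d e)
  note g = \<open>markov \<mu> g\<close>
  have 21: "g 2 1 = g 1 0 * g 1 1 - g 0 1" "g 1 2 = g 0 1 * g 1 1 - g 1 0"
    using markov_sum[OF g, of 1 0 1 1] markov_sum[OF g, of 1 1 1 0] by (simp_all add: algebra_simps)
  have "2 * \<bar>g 1 1\<bar> \<le> \<bar>g 1 0 * g 1 1\<bar>" "2 * \<bar>g 1 1\<bar> \<le> \<bar>g 0 1 * g 1 1\<bar>"
    using less.prems by (auto simp: abs_mult intro!: mult_right_mono)
  then have 3: "2 * \<bar>g 1 1\<bar> - \<bar>g 0 1\<bar> \<le> \<bar>g 2 1\<bar>" "2 * \<bar>g 1 1\<bar> - \<bar>g 1 0\<bar> \<le> \<bar>g 1 2\<bar>"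
    unfolding 21 by linarith+
  consider "a = 0" | "b = 0" | "a = b" "b \<noteq> 0" | "b < a" "b > 0" | "a < b" "a > 0"
    using less.prems by linarith
  then show ?case
  proof cases
    case 1
    then have "b = 1" using less.prems by auto
    then show ?thesis using 1 less.prems by auto
  next
    case 2
    then have "a = 1" using less.prems by auto
    then show ?thesis using 2 less.prems by auto
  next
    case 3
    then have "a = 1" "b = 1" using less.prems by auto
    then show ?thesis using less.prems by auto
  next
    case 4
    have r: "rebase g 1 0 1 1 1 0 = g 1 0" "rebase g 1 0 1 1 0 1 = g 1 1" "rebase g 1 0 1 1 1 1 =
        g 2 1"
      by (simp_all add: rebase_def)
    have "2 \<le> \<bar>rebase g 1 0 1 1 (a - b) b\<bar> \<and>
      d * of_int (a - b) + (d + e) * of_int b \<le> \<bar>rebase g 1 0 1 1 (a - b) b\<bar>"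
    proof (rule less.hyps)
      show "markov \<mu> (rebase g 1 0 1 1)" by (rule markov_rebase[OF g]) simp
      show "coprime (a - b) b" using less.prems coprime_diff_left by blast
    qed (unfold r, (use 3 4 less.prems(2-11) in linarith)+)
    then show ?thesis by (simp add: rebase_def algebra_simps)
  next
    case 5
    have r: "rebase g 1 1 0 1 1 0 = g 1 1" "rebase g 1 1 0 1 0 1 = g 0 1" "rebase g 1 1 0 1 1 1 =
        g 1 2"
      by (simp_all add: rebase_def)
    have "2 \<le> \<bar>rebase g 1 1 0 1 a (b - a)\<bar> \<and>
      (d + e) * of_int a + e * of_int (b - a) \<le> \<bar>rebase g 1 1 0 1 a (b - a)\<bar>"
    proof (rule less.hyps)
      show "markov \<mu> (rebase g 1 1 0 1)" by (rule markov_rebase[OF g]) simp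
      show "coprime a (b - a)" using less.prems coprime_diff_right by blast
    qed (unfold r, (use 3 5 less.prems(2-11) in linarith)+)
    then show ?thesis by (simp add: rebase_def algebra_simps)
  qed
qed

lemma grows_bound:
  assumes "markov \<mu> g" "grows g"
  shows "\<exists>d>0. \<forall>a b. 0 \<le> a \<longrightarrow> 0 \<le> b \<longrightarrow> coprime a b \<longrightarrow>
    2 \<le> \<bar>g a b\<bar> \<and> d * (of_int a + of_int b) \<le> \<bar>g a b\<bar>"
proof -
  \<comment> \<open>The slope has to stay below both increments at the first triangle and below both
    edge values, which are at least 2.\<close>
  define d where "d = min 2 (\<bar>g 1 1\<bar> - max \<bar>g 1 0\<bar> \<bar>g 0 1\<bar>)"
  note G = assms(2)[unfolded grows_def]
  have "d > 0" using G by (simp add: d_def)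
  have d: "d \<le> 2" "\<bar>g 1 0\<bar> + d \<le> \<bar>g 1 1\<bar>" "\<bar>g 0 1\<bar> + d \<le> \<bar>g 1 1\<bar>"
    unfolding d_def by linarith+
  have "2 \<le> \<bar>g a b\<bar> \<and> d * (of_int a + of_int b) \<le> \<bar>g a b\<bar>"
    if "0 \<le> a" "0 \<le> b" "coprime a b" for a b
  proof -
    have "d \<le> \<bar>g 1 0\<bar>" "d \<le> \<bar>g 0 1\<bar>" "0 \<le> d" using d(1) G \<open>d > 0\<close> by linarith+
    then have "2 \<le> \<bar>g a b\<bar> \<and> d * a + d * b \<le> \<bar>g a b\<bar>"
      using growth_bound[OF assms(1), of d d a b] G d that by blast
    then show ?thesis by (simp add: algebra_simps)
  qed
  with \<open>d > 0\<close> show ?thesis by (intro exI[of _ d] conjI allI impI) simp_all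
qed

lemma grows_ge_2:
  assumes "markov \<mu> g" "grows g" "0 \<le> a" "0 \<le> b" "coprime a b"
  shows "2 \<le> \<bar>g a b\<bar>"
  using grows_bound[OF assms(1,2)] assms(3-5) by blast

lemma grows_finite:
  assumes "markov \<mu> g" "grows g"
  shows "finite {(a, b). 0 \<le> a \<and> 0 \<le> b \<and> coprime a b \<and> \<bar>g a b\<bar> < K}"
proof -
  obtain d where d: "d > 0" "\<forall>a b. 0 \<le> a \<longrightarrow> 0 \<le> b \<longrightarrow> coprime a b \<longrightarrow>
    2 \<le> \<bar>g a b\<bar> \<and> d * (of_int a + of_int b) \<le> \<bar>g a b\<bar>"
    using grows_bound[OF assms] by blast
  have "{(a, b). 0 \<le> a \<and> 0 \<le> b \<and> coprime a b \<and> \<bar>g a b\<bar> < K} \<subseteq> {0..\<lceil>K / d\<rceil>} \<times> {0..\<lceil>K / d\<rceil>}"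
  proof (clarsimp, intro conjI)
    fix a b :: int assume *: "0 \<le> a" "0 \<le> b" "coprime a b" "\<bar>g a b\<bar> < K"
    have "d * (of_int a + of_int b) < K" using d(2)[rule_format, OF *(1-3)] *(4) by linarith
    then have "of_int a + of_int b < K / d" using d(1) by (simp add: field_simps)
    then have "of_int a < K / d" "of_int b < K / d" using * by linarith+
    then show "a \<le> \<lceil>K / d\<rceil>" "b \<le> \<lceil>K / d\<rceil>" by linarith+
  qed
  then show ?thesis by (rule finite_subset) simp
qed

text \<open>\<open>2 z - x y\<close> is the difference of the two values \<open>z\<close> and
  \<open>x y - z\<close> opposite to an edge, so this is the discriminant of the quadratic having
  them as roots.\<close>

lemma trace_discriminant:
  fixes x y z \<mu> :: real
  assumes "x\<^sup>2 + y\<^sup>2 + z\<^sup>2 - x * y * z = \<mu>"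
  shows "(2 * z - x * y)\<^sup>2 = (x\<^sup>2 - 4) * (y\<^sup>2 - 4) + 4 * (\<mu> - 4)"
  unfolding assms[symmetric] by (simp add: power2_eq_square algebra_simps)

text \<open>Real values are not discrete; this uniform gap is what makes the descent to a sink terminate.\<close>
lemma uniform_drop:
  fixes \<mu> K :: real
  assumes "\<mu> \<noteq> 4"
  shows "\<exists>c>0. \<forall>x y z z' :: real. z + z' = x * y \<longrightarrow> x\<^sup>2 + y\<^sup>2 + z\<^sup>2 - x * y * z = \<mu> \<longrightarrow>
      2 \<le> \<bar>x\<bar> \<longrightarrow> 2 \<le> \<bar>y\<bar> \<longrightarrow> \<bar>x\<bar> \<le> K \<longrightarrow> \<bar>y\<bar> \<le> K \<longrightarrow> \<bar>z'\<bar> \<le> max \<bar>x\<bar> \<bar>y\<bar> \<longrightarrow>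
      \<bar>z'\<bar> + c \<le> \<bar>z\<bar> \<and> \<bar>x\<bar> < \<bar>z\<bar> \<and> \<bar>y\<bar> < \<bar>z\<bar>"
proof -
  have "\<exists>c>0. \<forall>x y z z' :: real. z + z' = x * y \<longrightarrow> x\<^sup>2 + y\<^sup>2 + z\<^sup>2 - x * y * z = \<mu> \<longrightarrow>
      2 \<le> \<bar>x\<bar> \<longrightarrow> 2 \<le> \<bar>y\<bar> \<longrightarrow> \<bar>x\<bar> \<le> K \<longrightarrow> \<bar>y\<bar> \<le> K \<longrightarrow> \<bar>z'\<bar> \<le> max \<bar>x\<bar> \<bar>y\<bar> \<longrightarrow> \<bar>z'\<bar> + c \<le> \<bar>z\<bar>"
  proof (cases "\<mu> > 4")
    case True
    \<comment> \<open>Depending on signs, \<open>\<bar>z\<bar> - \<bar>z'\<bar>\<close> equals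
      \<open>\<bar>z - z'\<bar>\<close> or \<open>\<bar>z + z'\<bar>\<close>. The first is at least
      \<open>2 sqrt(\<mu> - 4)\<close> by the discriminant, the second is
      \<open>\<bar>x y\<bar> \<ge> 4\<close>.\<close>
    define c where "c = min (2 * sqrt (\<mu> - 4)) 4"
    have "\<bar>z'\<bar> + c \<le> \<bar>z\<bar>" if *: "z + z' = x * y" "x\<^sup>2 + y\<^sup>2 + z\<^sup>2 - x * y * z = \<mu>" "2 \<le> \<bar>x\<bar>" "2 \<le>
        \<bar>y\<bar>"
      "\<bar>z'\<bar> \<le> max \<bar>x\<bar> \<bar>y\<bar>" for x y z z'
    proof -
      have xy: "2 * \<bar>x\<bar> \<le> \<bar>x * y\<bar>" "2 * \<bar>y\<bar> \<le> \<bar>x * y\<bar>"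
        using * mult_mono[of 2 "\<bar>x\<bar>" "\<bar>y\<bar>" "\<bar>y\<bar>"] mult_mono[of "\<bar>x\<bar>" "\<bar>x\<bar>"
            2 "\<bar>y\<bar>"] by (auto simp: abs_mult)
      then have zz: "\<bar>z'\<bar> \<le> \<bar>z\<bar>" using *(1,5) by linarith
      have "4 \<le> x\<^sup>2" "4 \<le> y\<^sup>2" using *(3,4) power_mono[of 2 "\<bar>x\<bar>" 2] power_mono[of 2 "\<bar>y\<bar>"
          2] by auto
      then have "0 \<le> (x\<^sup>2 - 4) * (y\<^sup>2 - 4)" by simp
      moreover have e: "2 * z - x * y = z - z'" using *(1) by simp
      ultimately have "4 * (\<mu> - 4) \<le> (z - z')\<^sup>2" using trace_discriminant[OF *(2)] unfolding e by
          linarith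
      then have "sqrt (4 * (\<mu> - 4)) \<le> \<bar>z - z'\<bar>" by (metis real_sqrt_abs real_sqrt_le_iff)
      then have "2 * sqrt (\<mu> - 4) \<le> \<bar>z - z'\<bar>" by (simp only: real_sqrt_mult real_sqrt_four)
      moreover have "4 \<le> \<bar>z + z'\<bar>" using xy *(1,3) by simp
      ultimately show ?thesis using zz unfolding c_def by linarith
    qed
    moreover have "c > 0" using True by (simp add: c_def)
    ultimately show ?thesis by blast
  next
    case False
    then have mu: "\<mu> < 4" using assms by simp
    define L where "L = max K 2"
    \<comment> \<open>Here a nonnegative discriminant keeps the edge values away from 2: both exceed
      it by at least \<open>c\<close>. Then \<open>\<bar>x y\<bar>\<close> exceeds
      \<open>2 max \<bar>x\<bar> \<bar>y\<bar>\<close> by at least \<open>2 c\<close>, which bounds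
      the drop.\<close>
    define c where "c = 4 * (4 - \<mu>) / (L\<^sup>2 * (L + 2))"
    have L: "L \<ge> 2" "L\<^sup>2 > 0" by (auto simp: L_def max_def)
    have gap: "c \<le> \<bar>y\<bar> - 2"
      if *: "x\<^sup>2 + y\<^sup>2 + z\<^sup>2 - x * y * z = \<mu>" "2 \<le> \<bar>x\<bar>" "2 \<le> \<bar>y\<bar>" "\<bar>x\<bar> \<le> L" "\<bar>y\<bar> \<le> L" for x y z
    proof -
      have ge: "4 \<le> x\<^sup>2" "4 \<le> y\<^sup>2" using *(2,3) power_mono[of 2 "\<bar>x\<bar>" 2] power_mono[of 2 "\<bar>y\<bar>"
          2] by auto
      have le: "x\<^sup>2 \<le> L\<^sup>2" using *(4) power_mono[of "\<bar>x\<bar>" L 2] by simp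
      have "0 \<le> (2 * z - x * y)\<^sup>2" by simp
      then have "4 * (4 - \<mu>) \<le> (x\<^sup>2 - 4) * (y\<^sup>2 - 4)" using trace_discriminant[OF *(1)] by simp
      also have "\<dots> \<le> L\<^sup>2 * (y\<^sup>2 - 4)" using ge le by (intro mult_right_mono) auto
      also have "y\<^sup>2 - 4 = (\<bar>y\<bar> - 2) * (\<bar>y\<bar> + 2)" by (simp add: algebra_simps power2_eq_square)
      also have "\<dots> \<le> (\<bar>y\<bar> - 2) * (L + 2)" using * by (intro mult_left_mono) auto
      finally have "4 * (4 - \<mu>) \<le> L\<^sup>2 * ((\<bar>y\<bar> - 2) * (L + 2))" using L by simp
      then show ?thesis using L by (simp add: c_def divide_le_eq mult_ac)
    qed
    have c0: "c > 0" using mu L by (simp add: c_def)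
    have "\<bar>z'\<bar> + 2 * c \<le> \<bar>z\<bar>" if *: "z + z' = x * y" "x\<^sup>2 + y\<^sup>2 + z\<^sup>2 - x * y * z = \<mu>" "2 \<le> \<bar>x\<bar>"
        "2 \<le> \<bar>y\<bar>"
      "\<bar>x\<bar> \<le> K" "\<bar>y\<bar> \<le> K" "\<bar>z'\<bar> \<le> max \<bar>x\<bar> \<bar>y\<bar>" for x y z z'
    proof -
      have "y\<^sup>2 + x\<^sup>2 + z\<^sup>2 - y * x * z = \<mu>" using *(2) by (simp add: algebra_simps)
      moreover have "\<bar>x\<bar> \<le> L" "\<bar>y\<bar> \<le> L" using *(5,6) by (auto simp: L_def)
      ultimately have g: "c \<le> \<bar>y\<bar> - 2" "c \<le> \<bar>x\<bar> - 2"
        using gap *(2,3,4) by blast+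
      have "2 * c \<le> \<bar>x\<bar> * (\<bar>y\<bar> - 2)" "2 * c \<le> \<bar>y\<bar> * (\<bar>x\<bar> - 2)"
        using g c0 *(3,4) by (intro mult_mono; linarith)+
      then have "2 * c + 2 * \<bar>x\<bar> \<le> \<bar>x\<bar> * \<bar>y\<bar>" "2 * c + 2 * \<bar>y\<bar> \<le> \<bar>x\<bar> * \<bar>y\<bar>"
        by (simp_all add: algebra_simps)
      then show ?thesis using *(1,7) abs_mult[of x y] by linarith
    qed
    moreover have "2 * c > 0" using c0 by simp
    ultimately show ?thesis by blast
  qed
  then obtain c where c: "c > 0" "\<forall>x y z z' :: real. z + z' = x * y \<longrightarrow> x\<^sup>2 + y\<^sup>2 + z\<^sup>2 - x * y * z =
      \<mu> \<longrightarrow>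
      2 \<le> \<bar>x\<bar> \<longrightarrow> 2 \<le> \<bar>y\<bar> \<longrightarrow> \<bar>x\<bar> \<le> K \<longrightarrow> \<bar>y\<bar> \<le> K \<longrightarrow> \<bar>z'\<bar> \<le> max \<bar>x\<bar> \<bar>y\<bar> \<longrightarrow> \<bar>z'\<bar> + c \<le> \<bar>z\<bar>"
    by blast
  show ?thesis
  proof (intro exI[of _ c] conjI[OF c(1)] allI impI)
    fix x y z z' :: real
    assume *: "z + z' = x * y" "x\<^sup>2 + y\<^sup>2 + z\<^sup>2 - x * y * z = \<mu>" "2 \<le> \<bar>x\<bar>" "2 \<le> \<bar>y\<bar>"
      "\<bar>x\<bar> \<le> K" "\<bar>y\<bar> \<le> K" "\<bar>z'\<bar> \<le> max \<bar>x\<bar> \<bar>y\<bar>"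
    have "2 * \<bar>x\<bar> \<le> \<bar>x * y\<bar>" "2 * \<bar>y\<bar> \<le> \<bar>x * y\<bar>"
      using * mult_mono[of 2 "\<bar>x\<bar>" "\<bar>y\<bar>" "\<bar>y\<bar>"] mult_mono[of "\<bar>x\<bar>" "\<bar>x\<bar>"
          2 "\<bar>y\<bar>"] by (auto simp: abs_mult)
    moreover have "\<bar>z'\<bar> + c \<le> \<bar>z\<bar>" using c(2) * by blast
    ultimately show "\<bar>z'\<bar> + c \<le> \<bar>z\<bar> \<and> \<bar>x\<bar> < \<bar>z\<bar> \<and> \<bar>y\<bar> < \<bar>z\<bar>" using c(1) *(1,7) by linarith
  qed
qed

section \<open>Descent to a sink\<close>

text \<open>Growth away from the triangle (1,0), (0,1), (1,1) across each of its three edges. Across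
  the edge (1,0), (0,1) the far vertex is (1,-1), hence the basis vector (0,-1).\<close>

definition sink :: "(int \<Rightarrow> int \<Rightarrow> real) \<Rightarrow> bool" where
  "sink g \<longleftrightarrow> grows (rebase g 1 0 0 (-1)) \<and> grows (rebase g 1 0 1 1) \<and> grows (rebase g 1 1 0 1)"

text \<open>Finiteness is demanded below every bound, because the constant of an end invariant is
  arbitrary.\<close>

definition tame :: "(int \<Rightarrow> int \<Rightarrow> real) \<Rightarrow> bool" where
  "tame g \<longleftrightarrow> (\<forall>a b. coprime a b \<longrightarrow> 2 \<le> \<bar>g a b\<bar>) \<and>
     (\<forall>K. finite {(a, b). coprime a b \<and> \<bar>g a b\<bar> < K})"

lemma tame_rebase:
  assumes det: "\<bar>p * s - q * r\<bar> = 1" and tame: "tame (rebase g p q r s)"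
  shows "tame g"
  unfolding tame_def
proof (intro conjI allI impI)
  fix a b :: int assume "coprime a b"
  from rebase_coordinates[OF det this] obtain c d
    where "coprime c d" "a = c * p + d * r" "b = c * q + d * s" .
  then show "2 \<le> \<bar>g a b\<bar>" using tame by (auto simp: tame_def rebase_def)
next
  fix K
  let ?f = "\<lambda>(c, d). (c * p + d * r, c * q + d * s)"
  have "{(a, b). coprime a b \<and> \<bar>g a b\<bar> < K}
    \<subseteq> ?f ` {(c, d). coprime c d \<and> \<bar>rebase g p q r s c d\<bar> < K}"
  proof clarify
    fix a b :: int assume *: "coprime a b" "\<bar>g a b\<bar> < K"
    from rebase_coordinates[OF det *(1)] obtain c d
      where "coprime c d" "a = c * p + d * r" "b = c * q + d * s" .
    with * have "(a, b) = ?f (c, d)" "coprime c d \<and> \<bar>rebase g p q r s c d\<bar> < K"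
      by (auto simp: rebase_def)
    then show "(a, b) \<in> ?f ` {(c, d). coprime c d \<and> \<bar>rebase g p q r s c d\<bar> < K}" by blast
  qed
  moreover have "finite {(c, d). coprime c d \<and> \<bar>rebase g p q r s c d\<bar> < K}"
    using tame by (simp add: tame_def)
  ultimately show "finite {(a, b). coprime a b \<and> \<bar>g a b\<bar> < K}"
    by (meson finite_imageI finite_subset)
qed

lemma tame_of_cover:
  assumes g: "markov \<mu> g" and I: "finite I"
    and M: "\<And>p q r s. (p, q, r, s) \<in> I \<Longrightarrow> \<bar>p * s - q * r\<bar> = 1 \<and> grows (rebase g p q r s)"
    and cover: "\<And>a b. coprime a b \<Longrightarrow> \<exists>p q r s c d. (p, q, r, s) \<in> I \<and> coprime c d \<and> 0 \<le> c \<and> 0 \<le> d \<and>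
      ((a = c * p + d * r \<and> b = c * q + d * s) \<or> (-a = c * p + d * r \<and> -b = c * q + d * s))"
  shows "tame g"
  unfolding tame_def
proof (intro conjI allI impI)
  fix a b :: int assume "coprime a b"
  from cover[OF this] obtain p q r s c d where *: "(p, q, r, s) \<in> I" "coprime c d" "0 \<le> c" "0 \<le> d"
    "(a = c * p + d * r \<and> b = c * q + d * s) \<or> (-a = c * p + d * r \<and> -b = c * q + d * s)" by blast
  have "2 \<le> \<bar>rebase g p q r s c d\<bar>"
    using M[OF *(1)] * grows_ge_2[OF markov_rebase[OF g]] by blast
  moreover have "rebase g p q r s c d = g a b"
    using *(5) markov_minus[OF g, of a b] by (auto simp: rebase_def)
  ultimately show "2 \<le> \<bar>g a b\<bar>" by simp
next
  fix K
  let ?S = "\<lambda>(p, q, r, s). {(c, d). 0 \<le> c \<and> 0 \<le> d \<and> coprime c d \<and> \<bar>rebase g p q r s c d\<bar> < K}"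
  let ?f = "\<lambda>(p, q, r, s) (c, d). (c * p + d * r, c * q + d * s)"
  let ?U = "\<Union>i\<in>I. ?f i ` ?S i"
  have fin: "finite ?U"
  proof (intro finite_UN_I finite_imageI I)
    fix i assume "i \<in> I"
    then show "finite (?S i)"
      using M grows_finite[OF markov_rebase[OF g]] by (cases i) auto
  qed
  have "{(a, b). coprime a b \<and> \<bar>g a b\<bar> < K} \<subseteq> ?U \<union> (\<lambda>(a, b). (-a, -b)) ` ?U"
  proof clarify
    fix a b :: int assume ab: "coprime a b" "\<bar>g a b\<bar> < K"
      and neg: "(a, b) \<notin> (\<lambda>(a, b). (-a, -b)) ` ?U"
    from cover[OF ab(1)] obtain p q r s c d where *: "(p, q, r, s) \<in> I" "coprime c d" "0 \<le> c" "0 \<le>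
        d"
      "(a = c * p + d * r \<and> b = c * q + d * s) \<or> (-a = c * p + d * r \<and> -b = c * q + d * s)" by blast
    have "rebase g p q r s c d = g a b"
      using *(5) markov_minus[OF g, of a b] by (auto simp: rebase_def)
    then have "(c, d) \<in> ?S (p, q, r, s)" using * ab by auto
    then have U: "(c * p + d * r, c * q + d * s) \<in> ?U" using *(1) by force
    from *(5) show "(a, b) \<in> ?U"
    proof
      assume "-a = c * p + d * r \<and> -b = c * q + d * s"
      then have "(-a, -b) \<in> ?U" using U by simp
      then have "(a, b) \<in> (\<lambda>(a, b). (-a, -b)) ` ?U"
        by (rule rev_image_eqI) simp
      with neg show ?thesis by blast
    qed (use U in simp)
  qed
  then show "finite {(a, b). coprime a b \<and> \<bar>g a b\<bar> < K}"
    using fin by (meson finite_UnI finite_imageI finite_subset)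
qed

text \<open>The cones on the two sides of one edge already cover all vectors up to sign. This serves
  the situation in which the descent stops at an edge rather than at a triangle.\<close>

lemma tame_of_grows:
  assumes "markov \<mu> g" "grows g" "grows (rebase g 1 0 0 (-1))"
  shows "tame g"
proof (rule tame_of_cover[OF assms(1), of "{(1,0,0,1), (1,0,0,-1)}"])
  have "rebase g 1 0 0 1 = g" by (intro ext) (simp add: rebase_def)
  then show "\<bar>p * s - q * r\<bar> = 1 \<and> grows (rebase g p q r s)"
    if "(p, q, r, s) \<in> {(1,0,0,1), (1,0,0,-1)}" for p q r s
    using that assms by auto
next
  fix a b :: int assume ab: "coprime a b"
  have *: "\<exists>p q r s c d. (p, q, r, s) \<in> {(1,0,0,1), (1,0,0,-1)} \<and> coprime c d \<and> 0 \<le> c \<and> 0 \<le> d \<and>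
      a = c * p + d * r \<and> b = c * q + d * s"
    if cop: "coprime a b" and a: "0 \<le> a" for a b :: int
  proof (cases "0 \<le> b")
    case True
    then have "(1, 0, 0, 1) \<in> {(1,0,0,1), (1,0,0,-1 :: int)} \<and> coprime a b \<and> 0 \<le> a \<and> 0 \<le> b \<and>
      a = a * 1 + b * 0 \<and> b = a * 0 + b * 1" using cop a by simp
    then show ?thesis by blast
  next
    case False
    then have "(1, 0, 0, -1) \<in> {(1,0,0,1), (1,0,0,-1 :: int)} \<and> coprime a (-b) \<and> 0 \<le> a \<and> 0 \<le> -b \<and>
      a = a * 1 + (-b) * 0 \<and> b = a * 0 + (-b) * (-1)" using cop a by simp
    then show ?thesis by blast
  qed
  show "\<exists>p q r s c d. (p, q, r, s) \<in> {(1,0,0,1), (1,0,0,-1)} \<and> coprime c d \<and> 0 \<le> c \<and> 0 \<le> d \<and>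
      ((a = c * p + d * r \<and> b = c * q + d * s) \<or> (- a = c * p + d * r \<and> - b = c * q + d * s))"
  proof (cases "0 \<le> a")
    case True
    show ?thesis using *[OF ab True] by blast
  next
    case False
    then have "coprime (-a) (-b)" "0 \<le> -a" using ab by auto
    from *[OF this] show ?thesis by blast
  qed
qed simp

lemma tame_of_sink:
  assumes "markov \<mu> g" "sink g"
  shows "tame g"
proof (rule tame_of_cover[OF assms(1), of "{(1,0,0,-1), (1,0,1,1), (1,1,0,1)}"])
  show "\<bar>p * s - q * r\<bar> = 1 \<and> grows (rebase g p q r s)"
    if "(p, q, r, s) \<in> {(1,0,0,-1), (1,0,1,1), (1,1,0,1)}" for p q r s
    using that assms by (auto simp: sink_def)
next
  fix a b :: int assume ab: "coprime a b"
  have *: "\<exists>p q r s c d. (p, q, r, s) \<in> {(1,0,0,-1), (1,0,1,1), (1,1,0,1)} \<and> coprime c d \<and> 0 \<le> c \<and>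
      0 \<le> d \<and>
      a = c * p + d * r \<and> b = c * q + d * s"
    if "coprime a b" "0 \<le> a" for a b :: int
  proof -
    consider "b \<le> 0" | "0 \<le> b" "b \<le> a" | "a \<le> b" by linarith
    then show ?thesis
    proof cases
      case 1
      then have "(1, 0, 0, -1) \<in> {(1,0,0,-1), (1,0,1,1), (1,1,0,1 :: int)} \<and> coprime a (-b) \<and> 0 \<le>
          a \<and> 0 \<le> -b \<and>
        a = a * 1 + (-b) * 0 \<and> b = a * 0 + (-b) * (-1)" using that by simp
      then show ?thesis by blast
    next
      case 2
      then have "(1, 0, 1, 1) \<in> {(1,0,0,-1), (1,0,1,1), (1,1,0,1 :: int)} \<and> coprime (a - b) b \<and> 0 \<le>
          a - b \<and> 0 \<le> b \<and>
        a = (a - b) * 1 + b * 1 \<and> b = (a - b) * 0 + b * 1"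
            using that coprime_diff_left[of a b] by simp
      then show ?thesis by blast
    next
      case 3
      then have "(1, 1, 0, 1) \<in> {(1,0,0,-1), (1,0,1,1), (1,1,0,1 :: int)} \<and> coprime a (b - a) \<and> 0 \<le>
          a \<and> 0 \<le> b - a \<and>
        a = a * 1 + (b - a) * 0 \<and> b = a * 1 + (b - a) * 1"
            using that coprime_diff_right[of a b] by simp
      then show ?thesis by blast
    qed
  qed
  show "\<exists>p q r s c d. (p, q, r, s) \<in> {(1,0,0,-1), (1,0,1,1), (1,1,0,1)} \<and> coprime c d \<and> 0 \<le> c \<and> 0 \<le>
      d \<and>
      ((a = c * p + d * r \<and> b = c * q + d * s) \<or> (- a = c * p + d * r \<and> - b = c * q + d * s))"
  proof (cases "0 \<le> a")
    case True
    show ?thesis using *[OF ab True] by blast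
  next
    case False
    then have "coprime (-a) (-b)" "0 \<le> -a" using ab by auto
    from *[OF this] show ?thesis by blast
  qed
qed simp

text \<open>Neighbours in the quadrant other than the initial pair are comparable in both
  coordinates, so subtracting the smaller from the larger leads to the parent triangle inside the
  quadrant.\<close>

lemma nonneg_basis_cases:
  fixes p q r s :: int
  assumes "p * s - q * r = 1" "0 \<le> p" "0 \<le> q" "0 \<le> r" "0 \<le> s"
  obtains "p = 1" "q = 0" "r = 0" "s = 1" | "r \<le> p" "s \<le> q" | "p \<le> r" "q \<le> s"
proof -
  have "p = 1 \<and> q = 0 \<and> r = 0 \<and> s = 1" if "r < p" "q < s"
  proof -
    have "(r + 1) * (q + 1) \<le> p * s" using that assms by (intro mult_mono) auto
    then have "r + q \<le> 0" using assms(1) by (simp add: algebra_simps)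
    then have "q = 0" "r = 0" using assms by auto
    then have "p * s = 1" using assms(1) by simp
    then show ?thesis using assms \<open>q = 0\<close> \<open>r = 0\<close> by (auto simp: zmult_eq_1_iff)
  qed
  moreover have "\<not> (p < r \<and> s < q)"
  proof
    assume "p < r \<and> s < q"
    then have "p * s \<le> r * q" using assms by (intro mult_mono) auto
    then show False using assms(1) by (simp add: mult.commute)
  qed
  ultimately show ?thesis using that by linarith
qed

text \<open>Take a triangle in the cone whose sum of three absolute values is within the uniform gap
  of the infimum; a minimum need not be attained a priori. If growth failed across one of its edges,
  the triangle beyond would have a sum smaller by the gap, hence below the infimum.\<close>

lemma sink_exists:
  assumes g: "markov \<mu> g" and mu: "\<mu> \<noteq> 4"
    and ge: "\<And>a b. 0 \<le> a \<Longrightarrow> 0 \<le> b \<Longrightarrow> coprime a b \<Longrightarrow> 2 \<le> \<bar>g a b\<bar>"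
    and not: "\<not> grows g"
  shows "\<exists>p q r s. p * s - q * r = 1 \<and> sink (rebase g p q r s)"
proof -
  define S where "S = {(p, q, r, s) | p q r s :: int. p * s - q * r = 1 \<and> 0 \<le> p \<and> 0 \<le> q \<and> 0 \<le> r \<and>
      0 \<le> s}"
  define f where "f = (\<lambda>(p, q, r, s). \<bar>g p q\<bar> + \<bar>g r s\<bar> + \<bar>g (p+r) (q+s)\<bar>)"
  have S_iff: "(p, q, r, s) \<in> S \<longleftrightarrow> p * s - q * r = 1 \<and> 0 \<le> p \<and> 0 \<le> q \<and> 0 \<le> r \<and> 0 \<le> s" for p q r s
    by (auto simp: S_def)
  have bdd: "bdd_below (f ` S)" by (rule bdd_belowI[of _ 0]) (auto simp: f_def)
  have "(1, 0, 0, 1) \<in> S" by (simp add: S_iff)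
  then have ne: "f ` S \<noteq> {}" by blast
  define m where "m = Inf (f ` S)"
  have m: "m \<le> f M" if "M \<in> S" for M unfolding m_def using that bdd by (intro cInf_lower) auto
  \<comment> \<open>The gap is fixed for the bound \<open>m + 1\<close> before the triangle is
    chosen; the \<open>min c 1\<close> below keeps all three values under that bound.\<close>
  obtain c where c: "c > 0"
    "\<forall>x y z z' :: real. z + z' = x * y \<longrightarrow> x\<^sup>2 + y\<^sup>2 + z\<^sup>2 - x * y * z = \<mu> \<longrightarrow>
      2 \<le> \<bar>x\<bar> \<longrightarrow> 2 \<le> \<bar>y\<bar> \<longrightarrow> \<bar>x\<bar> \<le> m + 1 \<longrightarrow> \<bar>y\<bar> \<le> m + 1 \<longrightarrow> \<bar>z'\<bar> \<le> max \<bar>x\<bar> \<bar>y\<bar> \<longrightarrow>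
      \<bar>z'\<bar> + c \<le> \<bar>z\<bar> \<and> \<bar>x\<bar> < \<bar>z\<bar> \<and> \<bar>y\<bar> < \<bar>z\<bar>"
    using uniform_drop[OF mu, of "m + 1"] by blast
  have "m < m + min c 1" using c(1) by simp
  then obtain M where M: "M \<in> S" "f M < m + min c 1"
    unfolding m_def using cInf_lessD[OF ne] by blast
  obtain p q r s where Meq: "M = (p, q, r, s)" by (cases M)
  have S: "p * s - q * r = 1" "0 \<le> p" "0 \<le> q" "0 \<le> r" "0 \<le> s" using M(1) by (auto simp: Meq S_iff)
  have det: "\<bar>p * s - q * r\<bar> = 1" using S by simp
  define x y z where "x = g p q" and "y = g r s" and "z = g (p+r) (q+s)"
  have cop: "coprime p q" "coprime r s" "coprime (p+r) (q+s)"
    using coprime_rebase[OF det, of 1 0] coprime_rebase[OF det, of 0 1] coprime_rebase[OF det,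
        of 1 1] by simp_all
  have xyz: "2 \<le> \<bar>x\<bar>" "2 \<le> \<bar>y\<bar>" "2 \<le> \<bar>z\<bar>"
    using ge cop S by (simp_all add: x_def y_def z_def)
  have fM: "\<bar>x\<bar> + \<bar>y\<bar> + \<bar>z\<bar> < m + c" "\<bar>x\<bar> + \<bar>y\<bar> + \<bar>z\<bar> < m + 1"
    using M(2) by (auto simp: Meq f_def x_def y_def z_def)
  have le: "\<bar>x\<bar> \<le> m + 1" "\<bar>y\<bar> \<le> m + 1" "\<bar>z\<bar> \<le> m + 1" using fM(2) by linarith+
  have v: "x\<^sup>2 + y\<^sup>2 + z\<^sup>2 - x * y * z = \<mu>" using markov_vertex[OF g det] by (simp add: x_def y_def
      z_def)
  define z' where "z' = g (p - r) (q - s)"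
  have z': "z + z' = x * y" using markov_sum[OF g det] by (simp add: x_def y_def z_def z'_def)
  define y' where "y' = g (2 * p + r) (2 * q + s)"
  have y': "y + y' = x * z"
  proof -
    have "\<bar>p * (q+s) - q * (p+r)\<bar> = 1" using det by (simp add: algebra_simps)
    from markov_sum[OF g this] markov_minus[OF g, of r s] show ?thesis
      by (simp add: x_def y_def z_def y'_def algebra_simps)
  qed
  define x' where "x' = g (p + 2 * r) (q + 2 * s)"
  have x': "x + x' = z * y"
  proof -
    have "\<bar>(p+r) * s - (q+s) * r\<bar> = 1" using det by (simp add: algebra_simps)
    from markov_sum[OF g this] show ?thesis
      by (simp add: x_def y_def z_def x'_def algebra_simps)
  qed
  have "max \<bar>x\<bar> \<bar>y\<bar> < \<bar>z'\<bar>"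
  proof (rule ccontr)
    assume "\<not> ?thesis"
    then have "\<bar>z'\<bar> \<le> max \<bar>x\<bar> \<bar>y\<bar>" by linarith
    note drop = c(2)[rule_format, OF z' v xyz(1,2) le(1,2) this]
    from S show False
    proof (cases rule: nonneg_basis_cases)
      \<comment> \<open>Only here would the descent leave the cone, across its base edge; but then
        the drop says precisely that the cone grows.\<close>
      case 1
      then show False using drop not xyz by (simp add: grows_def x_def y_def z_def)
    next
      case 2
      then have "(p - r, q - s, r, s) \<in> S" using S by (simp add: S_iff algebra_simps)
      from m[OF this] drop fM show False by (simp add: f_def x_def y_def z_def z'_def)
    next
      case 3
      then have "(p, q, r - p, s - q) \<in> S" using S by (simp add: S_iff algebra_simps)
      from m[OF this] drop fM markov_minus[OF g, of "p - r" "q - s"] show False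
        by (simp add: f_def x_def y_def z_def z'_def)
    qed
  qed
  moreover have "max \<bar>x\<bar> \<bar>z\<bar> < \<bar>y'\<bar>"
  proof (rule ccontr)
    assume "\<not> ?thesis"
    then have "\<bar>y'\<bar> \<le> max \<bar>x\<bar> \<bar>z\<bar>" by linarith
    moreover have "x\<^sup>2 + z\<^sup>2 + y\<^sup>2 - x * z * y = \<mu>" using v by (simp add: algebra_simps)
    ultimately have drop: "\<bar>y'\<bar> + c \<le> \<bar>y\<bar>"
      using c(2)[rule_format, OF y' _ xyz(1,3) le(1,3)] by blast
    have "(p, q, p + r, q + s) \<in> S" using S by (simp add: S_iff algebra_simps)
    from m[OF this] drop fM show False by (simp add: f_def x_def y_def z_def y'_def algebra_simps)
  qed
  moreover have "max \<bar>z\<bar> \<bar>y\<bar> < \<bar>x'\<bar>"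
  proof (rule ccontr)
    assume "\<not> ?thesis"
    then have "\<bar>x'\<bar> \<le> max \<bar>z\<bar> \<bar>y\<bar>" by linarith
    moreover have "z\<^sup>2 + y\<^sup>2 + x\<^sup>2 - z * y * x = \<mu>" using v by (simp add: algebra_simps)
    ultimately have drop: "\<bar>x'\<bar> + c \<le> \<bar>x\<bar>"
      using c(2)[rule_format, OF x' _ xyz(3,2) le(3,2)] by blast
    have "(p + r, q + s, r, s) \<in> S" using S by (simp add: S_iff algebra_simps)
    from m[OF this] drop fM show False by (simp add: f_def x_def y_def z_def x'_def algebra_simps)
  qed
  ultimately have "sink (rebase g p q r s)"
    using xyz markov_minus[OF g, of r s]
    by (simp add: sink_def grows_def rebase_def x_def y_def z_def x'_def y'_def z'_def
        algebra_simps)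
  with S show ?thesis by blast
qed

lemma grows_or_tame:
  assumes "markov \<mu> g" "\<mu> \<noteq> 4"
    and "\<And>a b. 0 \<le> a \<Longrightarrow> 0 \<le> b \<Longrightarrow> coprime a b \<Longrightarrow> 2 \<le> \<bar>g a b\<bar>"
  shows "grows g \<or> tame g"
proof (rule disjCI)
  assume "\<not> tame g"
  show "grows g"
  proof (rule ccontr)
    assume "\<not> grows g"
    from sink_exists[OF assms this] obtain p q r s
      where *: "p * s - q * r = 1" "sink (rebase g p q r s)" by blast
    then have det: "\<bar>p * s - q * r\<bar> = 1" by simp
    have "tame g" using tame_rebase[OF det tame_of_sink[OF markov_rebase[OF assms(1) det] *(2)]] .
    with \<open>\<not> tame g\<close> show False by simp
  qed
qed

text \<open>If the conclusion failed, both cones at the base edge would have to grow, and together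
  they cover everything.\<close>

lemma tame_of_no_elliptic:
  assumes g: "markov \<mu> g" and mu: "\<mu> \<noteq> 4"
    and ge: "\<And>a b. coprime a b \<Longrightarrow> 2 \<le> \<bar>g a b\<bar>"
  shows "tame g"
proof (rule ccontr)
  assume nt: "\<not> tame g"
  have "grows g" using grows_or_tame[OF g mu] ge nt by blast
  moreover have "grows (rebase g 1 0 0 (-1))"
  proof -
    have "\<not> tame (rebase g 1 0 0 (-1))" using tame_rebase[of 1 "-1" 0 0 g] nt by auto
    moreover have "markov \<mu> (rebase g 1 0 0 (-1))" by (rule markov_rebase[OF g]) simp
    ultimately show ?thesis
      using grows_or_tame[OF _ mu, of "rebase g 1 0 0 (-1)"] ge by (simp add: rebase_def)
  qed
  ultimately show False using tame_of_grows[OF g] nt by blast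
qed

section \<open>The lower bound on \<open>\<mu>\<close> when no curve is elliptic\<close>

lemma four_le_square: "2 \<le> \<bar>x\<bar> \<Longrightarrow> 4 \<le> x\<^sup>2" for x :: real
  using power_mono[of 2 "\<bar>x\<bar>" 2] by simp

text \<open>If one of the products \<open>x y z\<close>, \<open>x y z'\<close> is negative, the
  vertex relation there gives at least 4 + 4 + 4 + 8; the triple (2, 2, -2) attains this. If neither
  is negative, all values may be replaced by absolute values, and then \<open>\<mu> \<le> 4\<close>,
  contrary to hypothesis.\<close>

lemma mu_ge_20_aux:
  fixes x y z z' \<mu> :: real
  assumes "z + z' = x * y" "x\<^sup>2 + y\<^sup>2 + z\<^sup>2 - x * y * z = \<mu>" "\<mu> > 4" "2 \<le> \<bar>y\<bar>" "\<bar>y\<bar> \<le> \<bar>x\<bar>"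
    "\<bar>x\<bar> \<le> \<bar>z\<bar>" "\<bar>x\<bar> \<le> \<bar>z'\<bar>"
  shows "20 \<le> \<mu>"
proof -
  have ge: "2 \<le> \<bar>x\<bar>" "2 \<le> \<bar>z\<bar>" "2 \<le> \<bar>z'\<bar>" using assms(4-7) by linarith+
  note sq = four_le_square[OF ge(1)] four_le_square[OF assms(4)] four_le_square[OF ge(2)]
      four_le_square[OF ge(3)]
  have big: "8 \<le> \<bar>x * y * w\<bar>" if "2 \<le> \<bar>w\<bar>" for w
  proof -
    have "2 * 2 * 2 \<le> \<bar>x\<bar> * \<bar>y\<bar> * \<bar>w\<bar>" using ge(1) assms(4) that by (intro mult_mono) simp_all
    then show ?thesis by (simp add: abs_mult)
  qed
  have v': "x\<^sup>2 + y\<^sup>2 + z'\<^sup>2 - x * y * z' = \<mu>"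
  proof -
    have zeq: "z' = x * y - z" using assms(1) by simp
    have "z'\<^sup>2 - x * y * z' = z\<^sup>2 - x * y * z"
      unfolding zeq by (simp add: power2_eq_square algebra_simps)
    then show ?thesis using assms(2) by linarith
  qed
  have bz: "8 \<le> \<bar>x * y * z\<bar>" "8 \<le> \<bar>x * y * z'\<bar>" using big ge by blast+
  show ?thesis
  proof (cases "x * y * z < 0 \<or> x * y * z' < 0")
    case True
    then show ?thesis using sq bz assms(2) v' by linarith
  next
    case False
    define X Y Z Z' where "X = \<bar>x\<bar>" and "Y = \<bar>y\<bar>" and "Z = \<bar>z\<bar>" and "Z' = \<bar>z'\<bar>"
    have "0 \<le> x * y * z" "0 \<le> x * y * z'" using False by linarith+
    then have "x * y * z = X * Y * Z" "x * y * z' = X * Y * Z'"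
      by (simp_all only: X_def Y_def Z_def Z'_def abs_of_nonneg flip: abs_mult)
    then have sumxy: "x * y * (z + z') = X * Y * (Z + Z')" by (simp add: algebra_simps)
    have "x * y * (z + z') = (x * y) * (x * y)" using assms(1) by simp
    also have "\<dots> = (X * Y) * (X * Y)" by (simp add: X_def Y_def flip: abs_mult)
    finally have "X * Y * (Z + Z') = X * Y * (X * Y)" using sumxy by simp
    moreover have "X * Y \<noteq> 0" using assms(4) ge(1) by (simp add: X_def Y_def) linarith
    ultimately have s: "Z + Z' = X * Y" by simp
    have v2: "X\<^sup>2 + Y\<^sup>2 + Z\<^sup>2 - X * Y * Z = \<mu>"
      using assms(2) \<open>x * y * z = X * Y * Z\<close> by (simp add: X_def Y_def Z_def)
    have ord: "2 \<le> Y" "Y \<le> X" "X \<le> Z" "X \<le> Z'" using assms(4-7) by (simp_all only: X_def Y_def Z_def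
        Z'_def)
    \<comment> \<open>The roots \<open>Z\<close>, \<open>Z'\<close> of
      \<open>t^2 - X Y t + X^2 + Y^2 - \<mu>\<close> are both at least \<open>X\<close>, so the
      quadratic is nonnegative at \<open>X\<close>. This bounds \<open>\<mu>\<close> by
      \<open>X^2 (2 - Y) + Y^2\<close>, which is largest at \<open>X = Y\<close>.\<close>
    have "0 \<le> (Z - X) * (Z' - X)" using ord by simp
    also have "\<dots> = Z * (X * Y - Z) - X * (X * Y) + X\<^sup>2"
    proof -
      have zeq: "Z' = X * Y - Z" using s by simp
      show ?thesis unfolding zeq by (simp add: power2_eq_square algebra_simps)
    qed
    also have "\<dots> = X\<^sup>2 + Y\<^sup>2 + X\<^sup>2 - X\<^sup>2 * Y - \<mu>" unfolding v2[symmetric] by (simp add: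
        power2_eq_square algebra_simps)
    finally have "\<mu> \<le> X\<^sup>2 * (2 - Y) + Y\<^sup>2" by (simp add: algebra_simps)
    also have "\<dots> \<le> Y\<^sup>2 * (2 - Y) + Y\<^sup>2"
      using ord by (intro add_right_mono mult_right_mono_neg power_mono) auto
    also have "\<dots> = 4 - (Y - 2) * ((Y - 2) * (Y + 1))" by (simp add: power2_eq_square algebra_simps)
    also have "\<dots> \<le> 4" using ord by simp
    finally show ?thesis using assms(3) by simp
  qed
qed

lemma mu_ge_20_of_edge:
  fixes x y z z' \<mu> :: real
  assumes "z + z' = x * y" "x\<^sup>2 + y\<^sup>2 + z\<^sup>2 - x * y * z = \<mu>" "\<mu> > 4" "2 \<le> \<bar>x\<bar>" "2 \<le> \<bar>y\<bar>"
    "max \<bar>x\<bar> \<bar>y\<bar> \<le> \<bar>z\<bar>" "max \<bar>x\<bar> \<bar>y\<bar> \<le> \<bar>z'\<bar>"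
  shows "20 \<le> \<mu>"
proof (cases "\<bar>y\<bar> \<le> \<bar>x\<bar>")
  case True
  then show ?thesis using mu_ge_20_aux[of z z' x y \<mu>] assms by simp
next
  case False
  then show ?thesis using mu_ge_20_aux[of z z' y x \<mu>] assms by (simp add: algebra_simps)
qed

lemma mu_ge_20_of_no_elliptic:
  assumes g: "markov \<mu> g" and mu: "\<mu> > 4"
    and ge: "\<And>a b. coprime a b \<Longrightarrow> 2 \<le> \<bar>g a b\<bar>"
  shows "20 \<le> \<mu>"
proof -
  have *: "20 \<le> \<mu>" if h: "markov \<mu> h" and ge: "\<And>a b. coprime a b \<Longrightarrow> 2 \<le> \<bar>h a b\<bar>" and not: "\<not> grows h"
      for h
  proof -
    have "\<mu> \<noteq> 4" using mu by simp
    from sink_exists[OF h this ge not] obtain p q r s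
      where det: "p * s - q * r = 1" and sink: "sink (rebase h p q r s)" by blast
    have det': "\<bar>p * s - q * r\<bar> = 1" using det by simp
    define k where "k = rebase h p q r s"
    have k: "markov \<mu> k" unfolding k_def by (rule markov_rebase[OF h det'])
    define x y z where "x = k 1 0" and "y = k 0 1" and "z = k 1 1"
    have v: "x\<^sup>2 + y\<^sup>2 + z\<^sup>2 - x * y * z = \<mu>"
      using markov_vertex[OF k, of 1 1 0 0] by (simp add: x_def y_def z_def)
    have sums: "z + k 1 (-1) = x * y" "y + k 2 1 = x * z" "x + k 1 2 = y * z"
      using markov_sum[OF k, of 1 1 0 0] markov_sum[OF k, of 1 0 1 1] markov_sum[OF k, of 1 1 1 0]
      by (simp_all add: x_def y_def z_def algebra_simps)
    have k01: "k 0 (-1) = k 0 1" using markov_minus[OF k, of 0 1] by simp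
    have "grows (rebase k 1 0 0 (-1))" "grows (rebase k 1 0 1 1)" "grows (rebase k 1 1 0 1)"
      using sink unfolding sink_def k_def by blast+
    then have s: "2 \<le> \<bar>x\<bar>" "2 \<le> \<bar>y\<bar>" "2 \<le> \<bar>z\<bar>" "\<bar>x\<bar> \<le> \<bar>k 1 (-1)\<bar>" "\<bar>y\<bar> \<le> \<bar>k 1 (-1)\<bar>"
      "\<bar>x\<bar> \<le> \<bar>k 2 1\<bar>" "\<bar>z\<bar> \<le> \<bar>k 2 1\<bar>" "\<bar>y\<bar> \<le> \<bar>k 1 2\<bar>" "\<bar>z\<bar> \<le> \<bar>k 1 2\<bar>"
      by (simp_all add: grows_def rebase_def[of k] x_def y_def z_def k01)
    \<comment> \<open>Use the edge opposite to the largest value of the sink triangle: one far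
      vertex dominates the edge by maximality, the other because of the sink.\<close>
    have "(X \<le> Z \<and> Y \<le> Z) \<or> (X \<le> Y \<and> Z \<le> Y) \<or> (Y \<le> X \<and> Z \<le> X)" for X Y Z :: real by linarith
    then consider "\<bar>x\<bar> \<le> \<bar>z\<bar>" "\<bar>y\<bar> \<le> \<bar>z\<bar>" | "\<bar>x\<bar> \<le> \<bar>y\<bar>" "\<bar>z\<bar> \<le> \<bar>y\<bar>" | "\<bar>y\<bar> \<le> \<bar>x\<bar>" "\<bar>z\<bar> \<le> \<bar>x\<bar>"
        by blast
    then show ?thesis
    proof cases
      case 1
      then show ?thesis
        by (intro mu_ge_20_of_edge[OF sums(1) v mu] s max.boundedI)
    next
      case 2
      have "x\<^sup>2 + z\<^sup>2 + y\<^sup>2 - x * z * y = \<mu>" using v by (simp add: algebra_simps)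
      then show ?thesis using 2
        by (intro mu_ge_20_of_edge[OF sums(2) _ mu] s max.boundedI)
    next
      case 3
      have "y\<^sup>2 + z\<^sup>2 + x\<^sup>2 - y * z * x = \<mu>" using v by (simp add: algebra_simps)
      then show ?thesis using 3
        by (intro mu_ge_20_of_edge[OF sums(3) _ mu] s max.boundedI)
    qed
  qed
  show ?thesis
  proof (cases "grows g \<and> grows (rebase g 1 0 0 (-1))")
    case True
    have "g 1 1 + g 1 (-1) = g 1 0 * g 0 1" "(g 1 0)\<^sup>2 + (g 0 1)\<^sup>2 + (g 1 1)\<^sup>2 - g 1 0 * g 0 1 * g 1
        1 = \<mu>"
      using markov_sum[OF g, of 1 1 0 0] markov_vertex[OF g, of 1 1 0 0] by simp_all
    moreover have "2 \<le> \<bar>g 1 0\<bar>" "2 \<le> \<bar>g 0 1\<bar>" "\<bar>g 1 0\<bar> \<le> \<bar>g 1 1\<bar>" "\<bar>g 0 1\<bar> \<le> \<bar>g 1 1\<bar>"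
      "\<bar>g 1 0\<bar> \<le> \<bar>g 1 (-1)\<bar>" "\<bar>g 0 1\<bar> \<le> \<bar>g 1 (-1)\<bar>"
      using True markov_minus[OF g, of 0 1] by (simp_all add: grows_def rebase_def)
    ultimately show ?thesis
      using mu by (intro mu_ge_20_of_edge[of "g 1 1" "g 1 (-1)" "g 1 0" "g 0 1"] max.boundedI)
  next
    case False
    then consider "\<not> grows g" | "\<not> grows (rebase g 1 0 0 (-1))" by blast
    then show ?thesis
    proof cases
      case 1
      then show ?thesis using *[OF g ge] by blast
    next
      case 2
      have m: "markov \<mu> (rebase g 1 0 0 (-1))" by (rule markov_rebase[OF g]) simp
      have "2 \<le> \<bar>rebase g 1 0 0 (-1) a b\<bar>" if "coprime a b" for a b
        using ge[of a "-b"] that by (simp add: rebase_def)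
      from *[OF m this 2] show ?thesis .
    qed
  qed
qed

section \<open>Values on the neighbours of a curve\<close>

text \<open>The third triple in \<open>step\<close> crosses the base edge into the cone of (1,0) and
  (0,-1); evenness of \<open>g\<close> supplies the remaining two quadrants.\<close>

lemma plane_induct:
  assumes g: "markov \<mu> g" and T: "T (g 1 0) (g 0 1) (g 1 1)"
    and step: "\<And>x y z. T x y z \<Longrightarrow> x\<^sup>2 + y\<^sup>2 + z\<^sup>2 - x * y * z = \<mu> \<Longrightarrow>
        T x z (x * z - y) \<and> T z y (y * z - x) \<and> T x y (x * y - z)"
    and P: "\<And>x y z. T x y z \<Longrightarrow> P x \<and> P y \<and> P z"
    and cop: "coprime a b"
  shows "P (g a b)"
proof -
  have e: "P (g 1 0)" "P (g 0 1)" using P[OF T] by auto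
  have pos: "P (h a b)" if "markov \<mu> h" "T (h 1 0) (h 0 1) (h 1 1)" "a \<ge> 1" "b \<ge> 1" "coprime a b"
      for h a b
    using sector_induct[of \<mu> h T a b] that step P by blast
  have h: "markov \<mu> (rebase g 1 0 0 (-1))" by (rule markov_rebase[OF g]) simp
  have "g 1 (-1) = g 1 0 * g 0 1 - g 1 1"
    using markov_sum[OF g, of 1 1 0 0] by simp
  then have Th: "T (rebase g 1 0 0 (-1) 1 0) (rebase g 1 0 0 (-1) 0 1) (rebase g 1 0 0 (-1) 1 1)"
    using step[OF T markov_vertex[OF g, of 1 1 0 0, simplified]] markov_minus[OF g, of 0 1]
    by (simp add: rebase_def)
  consider "a = 0" | "b = 0" | "a \<ge> 1" "b \<ge> 1" | "-a \<ge> 1" "-b \<ge> 1" | "a \<ge> 1" "-b \<ge> 1" | "-a \<ge> 1"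
      "b \<ge> 1"
    by linarith
  then show ?thesis
  proof cases
    case 1
    then have "b = 1 \<or> b = -1" using cop by auto
    then show ?thesis using 1 e markov_minus[OF g, of 0 1] by auto
  next
    case 2
    then have "a = 1 \<or> a = -1" using cop by auto
    then show ?thesis using 2 e markov_minus[OF g, of 1 0] by auto
  next
    case 3
    then show ?thesis using pos[OF g T] cop by blast
  next
    case 4
    then have "P (g (-a) (-b))" using pos[OF g T, of "-a" "-b"] cop by simp
    then show ?thesis using markov_minus[OF g, of a b] by simp
  next
    case 5
    then show ?thesis using pos[OF h Th, of a "-b"] cop by (simp add: rebase_def)
  next
    case 6
    then have "P (g (-a) (-b))" using pos[OF h Th, of "-a" b] cop by (simp add: rebase_def)
    then show ?thesis using markov_minus[OF g, of a b] by simp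
  qed
qed

section \<open>The regime \<open>\<mu> < 4\<close>, and dihedral values\<close>

lemma abs_less_2_iff: "\<bar>x\<bar> < 2 \<longleftrightarrow> x\<^sup>2 < 4" for x :: real
  using four_le_square[of x] power_strict_mono[of "\<bar>x\<bar>" 2 2] by fastforce

lemma abs_greater_2_iff: "2 < \<bar>x\<bar> \<longleftrightarrow> 4 < x\<^sup>2" for x :: real
  using power_mono[of "\<bar>x\<bar>" 2 2] power_strict_mono[of 2 "\<bar>x\<bar>" 2] by fastforce

text \<open>The discriminant is a square, so
  \<open>(x^2 - 4)(y^2 - 4) \<ge> 4 (4 - \<mu>) > 0\<close>: neither factor vanishes and both have
  the same sign.\<close>

lemma small_mu_same_type:
  fixes x y z \<mu> :: real
  assumes "x\<^sup>2 + y\<^sup>2 + z\<^sup>2 - x * y * z = \<mu>" "\<mu> < 4"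
  shows "(\<bar>x\<bar> < 2 \<longrightarrow> \<bar>y\<bar> < 2) \<and> (2 < \<bar>x\<bar> \<longrightarrow> 2 < \<bar>y\<bar>) \<and> (\<bar>x\<bar> < 2 \<or> 2 < \<bar>x\<bar>)"
proof -
  have "0 \<le> (x\<^sup>2 - 4) * (y\<^sup>2 - 4) + 4 * (\<mu> - 4)"
    unfolding trace_discriminant[OF assms(1), symmetric] by simp
  then have "0 < (x\<^sup>2 - 4) * (y\<^sup>2 - 4)" using assms(2) by simp
  then show ?thesis unfolding abs_less_2_iff abs_greater_2_iff by (auto simp: zero_less_mult_iff)
qed

text \<open>Connectedness of the Farey graph, in the form needed for the dichotomy.\<close>

lemma edge_property_propagates:
  assumes g: "markov \<mu> g" and P: "P (g 1 0)" and cop: "coprime a b"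
    and edge: "\<And>x y z. x\<^sup>2 + y\<^sup>2 + z\<^sup>2 - x * y * z = \<mu> \<Longrightarrow> P x \<Longrightarrow> P y"
  shows "P (g a b)"
proof (rule plane_induct[OF g, where T = "\<lambda>x y z. P x \<and> P y \<and> P z"])
  have v: "(g 1 0)\<^sup>2 + (g 0 1)\<^sup>2 + (g 1 1)\<^sup>2 - g 1 0 * g 0 1 * g 1 1 = \<mu>"
    using markov_vertex[OF g, of 1 1 0 0] by simp
  moreover have "(g 1 0)\<^sup>2 + (g 1 1)\<^sup>2 + (g 0 1)\<^sup>2 - g 1 0 * g 1 1 * g 0 1 = \<mu>"
    using v by (simp add: algebra_simps)
  ultimately show "P (g 1 0) \<and> P (g 0 1) \<and> P (g 1 1)" using edge P by blast
next
  fix x y z :: real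
  assume T: "P x \<and> P y \<and> P z" and e: "x\<^sup>2 + y\<^sup>2 + z\<^sup>2 - x * y * z = \<mu>"
  have "x\<^sup>2 + (x * z - y)\<^sup>2 + z\<^sup>2 - x * (x * z - y) * z = \<mu>"
    "y\<^sup>2 + (y * z - x)\<^sup>2 + z\<^sup>2 - y * (y * z - x) * z = \<mu>"
    "x\<^sup>2 + (x * y - z)\<^sup>2 + y\<^sup>2 - x * (x * y - z) * y = \<mu>"
    using e by (simp_all add: power2_eq_square algebra_simps)
  then have "P (x * z - y)" "P (y * z - x)" "P (x * y - z)" using edge T by blast+
  then show "(P x \<and> P z \<and> P (x * z - y)) \<and> (P z \<and> P y \<and> P (y * z - x)) \<and> (P x \<and> P y \<and>
      P (x * y - z))"
    using T by blast
qed (use cop in auto)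

lemma small_mu_dichotomy:
  assumes g: "markov \<mu> g" and mu: "\<mu> < 4"
  shows "(\<forall>a b. coprime a b \<longrightarrow> \<bar>g a b\<bar> < 2) \<or> (\<forall>a b. coprime a b \<longrightarrow> 2 < \<bar>g a b\<bar>)"
proof (cases "\<bar>g 1 0\<bar> < 2")
  case True
  then show ?thesis
    using edge_property_propagates[OF g, where P = "\<lambda>x. \<bar>x\<bar> < 2"] small_mu_same_type[OF _ mu] by
        blast
next
  case False
  have "(g 1 0)\<^sup>2 + (g 0 1)\<^sup>2 + (g 1 1)\<^sup>2 - g 1 0 * g 0 1 * g 1 1 = \<mu>"
    using markov_vertex[OF g, of 1 1 0 0] by simp
  with False have "2 < \<bar>g 1 0\<bar>" using small_mu_same_type[OF _ mu] by blast
  then show ?thesis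
    using edge_property_propagates[OF g, where P = "\<lambda>x. 2 < \<bar>x\<bar>"] small_mu_same_type[OF _ mu] by
        blast
qed

definition dihedral_triple :: "real \<Rightarrow> real \<Rightarrow> real \<Rightarrow> bool" where
  "dihedral_triple x y z \<longleftrightarrow> (x = 0 \<and> y = 0) \<or> (x = 0 \<and> z = 0) \<or> (y = 0 \<and> z = 0)"

text \<open>With two zeros in a triple every pairwise product that occurs in a move vanishes or is
  multiplied into a zero entry, so a move only permutes entries and changes signs.\<close>

lemma dihedral_values:
  assumes g: "markov \<mu> g" and d: "dihedral_triple (g 1 0) (g 0 1) (g 1 1)" and "coprime a b"
  shows "g a b = 0 \<or> (g a b)\<^sup>2 = \<mu>"
  using \<open>coprime a b\<close>
proof (rule plane_induct[OF g, where T = "\<lambda>x y z. dihedral_triple x y z \<and> x\<^sup>2 + y\<^sup>2 + z\<^sup>2 = \<mu>",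
    rotated 3])
  show "dihedral_triple (g 1 0) (g 0 1) (g 1 1) \<and> (g 1 0)\<^sup>2 + (g 0 1)\<^sup>2 + (g 1 1)\<^sup>2 = \<mu>"
    using d markov_vertex[OF g, of 1 1 0 0] by (auto simp: dihedral_triple_def)
qed (auto simp: dihedral_triple_def)

text \<open>Exactly two nonzero entries would give \<open>2 \<mu> = \<mu>\<close>. Three would give
  \<open>x y z = 2 \<mu>\<close> and \<open>(x y z)^2 = \<mu>^3\<close>, hence
  \<open>\<mu> = 4\<close>.\<close>

lemma dihedral_triple_of_values:
  fixes x y z \<mu> :: real
  assumes e: "x\<^sup>2 + y\<^sup>2 + z\<^sup>2 - x * y * z = \<mu>" and mu: "\<mu> > 4"
    and "x = 0 \<or> x\<^sup>2 = \<mu>" "y = 0 \<or> y\<^sup>2 = \<mu>" "z = 0 \<or> z\<^sup>2 = \<mu>"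
  shows "dihedral_triple x y z"
proof (rule ccontr)
  assume "\<not> ?thesis"
  then consider "x\<^sup>2 = \<mu>" "y\<^sup>2 = \<mu>" "z = 0" | "x\<^sup>2 = \<mu>" "z\<^sup>2 = \<mu>" "y = 0" | "y\<^sup>2 = \<mu>" "z\<^sup>2 = \<mu>" "x =
      0"
    | "x\<^sup>2 = \<mu>" "y\<^sup>2 = \<mu>" "z\<^sup>2 = \<mu>"
    using assms(3-5) by (auto simp: dihedral_triple_def)
  then show False
  proof cases
    case 4
    then have xyz: "x * y * z = 2 * \<mu>" using e by simp
    have "(x * y * z)\<^sup>2 = \<mu> * \<mu> * \<mu>" using 4 by (simp add: power_mult_distrib)
    then have "\<mu> * \<mu> * \<mu> = 4 * (\<mu> * \<mu>)" unfolding xyz by (simp add: power2_eq_square)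
    then show False using mu by simp
  qed (use e mu in auto)
qed

section \<open>Linear recurrences along the neighbours of a curve\<close>

text \<open>The values on \<open>v + n u\<close> for a curve u of trace \<open>x\<close>. The
  characteristic polynomial \<open>t^2 - x t + 1\<close> is that of the matrix of u: a rotation for
  \<open>\<bar>x\<bar> < 2\<close>, a saddle for \<open>\<bar>x\<bar> > 2\<close>.\<close>

definition chain :: "real \<Rightarrow> (nat \<Rightarrow> real) \<Rightarrow> bool" where
  "chain x Y \<longleftrightarrow> (\<forall>n. Y (Suc (Suc n)) = x * Y (Suc n) - Y n)"

lemma chain_markov:
  assumes g: "markov \<mu> g"
  shows "chain (g 1 0) (\<lambda>n. g (int n) 1)"
    "(g (int n) 1)\<^sup>2 + (g (int (Suc n)) 1)\<^sup>2 - g 1 0 * g (int n) 1 * g (int (Suc n)) 1 =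
        \<mu> - (g 1 0)\<^sup>2"
proof -
  show "chain (g 1 0) (\<lambda>n. g (int n) 1)"
    unfolding chain_def
  proof
    fix n
    show "g (int (Suc (Suc n))) 1 = g 1 0 * g (int (Suc n)) 1 - g (int n) 1"
      using markov_sum[OF g, of "1 + int n" 0 1 1] by (simp add: algebra_simps)
  qed
  show "(g (int n) 1)\<^sup>2 + (g (int (Suc n)) 1)\<^sup>2 - g 1 0 * g (int n) 1 * g (int (Suc n)) 1 =
      \<mu> - (g 1 0)\<^sup>2"
    using markov_vertex[OF g, of 1 1 0 "int n"] by (simp add: algebra_simps)
qed

lemma chain_shift: "chain x Y \<Longrightarrow> chain x (\<lambda>n. Y (n + k))"
  by (simp add: chain_def)

lemma chain_uminus: "chain x Y \<Longrightarrow> chain x (\<lambda>n. - Y n)"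
  by (simp add: chain_def)

text \<open>Alternating signs replace \<open>x\<close> by \<open>-x\<close>, so arguments that
  depend on the sign of \<open>x\<close> need only one case.\<close>

lemma chain_twist:
  assumes "chain x Y"
  shows "chain (-x) (\<lambda>n. (-1) ^ n * Y n)"
  unfolding chain_def
proof
  fix n
  have eq: "Y (Suc (Suc n)) = x * Y (Suc n) - Y n" using assms by (simp add: chain_def)
  show "(-1) ^ Suc (Suc n) * Y (Suc (Suc n)) = - x * ((-1) ^ Suc n * Y (Suc n)) - (-1) ^ n * Y n"
    unfolding eq by (simp add: algebra_simps)
qed

lemma chain_invariant:
  assumes "chain x Y"
  shows "(Y n)\<^sup>2 + (Y (Suc n))\<^sup>2 - x * Y n * Y (Suc n) = (Y 0)\<^sup>2 + (Y 1)\<^sup>2 - x * Y 0 * Y 1"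
proof (induction n)
  case (Suc n)
  have eq: "Y (Suc (Suc n)) = x * Y (Suc n) - Y n" using assms by (simp add: chain_def)
  show ?case using Suc.IH unfolding eq by (simp add: power2_eq_square algebra_simps)
qed simp

lemma chain_zero:
  assumes "chain x Y" "Y n = 0" "Y (Suc n) = 0"
  shows "Y 0 = 0 \<and> Y 1 = 0"
  using assms(2,3)
proof (induction n)
  case (Suc n)
  have "Y (Suc (Suc n)) = x * Y (Suc n) - Y n" using assms(1) by (simp add: chain_def)
  then show ?case using Suc by simp
qed simp

text \<open>Where it is nonnegative, an elliptic chain is concave; so it cannot stay nonnegative.\<close>
lemma chain_negative:
  assumes ch: "chain x Y" and x: "x < 2" and nz: "Y 0 \<noteq> 0 \<or> Y 1 \<noteq> 0"
  shows "\<exists>n. Y n < 0"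
proof (rule ccontr)
  assume "\<not> ?thesis"
  then have nn: "0 \<le> Y n" for n by (simp add: not_less)
  define D where "D n = Y (Suc n) - Y n" for n
  have DS: "D (Suc n) = D n - (2 - x) * Y (Suc n)" for n
    using ch by (simp add: D_def chain_def algebra_simps)
  have anti: "D (k + j) \<le> D k" for k j
  proof (induction j)
    case (Suc j)
    have "0 \<le> (2 - x) * Y (Suc (k + j))" using x nn by simp
    then show ?case using Suc DS[of "k + j"] by simp
  qed simp
  have D0: "0 \<le> D k" for k
  proof (rule ccontr)
    assume "\<not> 0 \<le> D k"
    then have neg: "0 < - D k" by simp
    have le: "Y (k + j) \<le> Y k + real j * D k" for j
    proof (induction j)
      case (Suc j)
      have "Y (k + Suc j) = Y (k + j) + D (k + j)" by (simp add: D_def)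
      then show ?case using Suc anti[of k j] by (simp add: algebra_simps)
    qed simp
    obtain j where "Y k < real j * (- D k)" using reals_Archimedean3[OF neg] by blast
    with le[of j] nn[of "k + j"] show False by simp
  qed
  have "Y 1 > 0"
  proof (rule ccontr)
    assume "\<not> 0 < Y 1"
    then have "Y 1 = 0" using nn[of 1] by simp
    then show False using D0[of 0] nn[of 0] nz by (simp add: D_def)
  qed
  have Y1: "Y 1 \<le> Y (Suc n)" for n
  proof (induction n)
    case (Suc n)
    then show ?case using D0[of "Suc n"] by (simp add: D_def)
  qed simp
  \<comment> \<open>From index 1 on \<open>Y\<close> stays above the positive \<open>Y 1\<close>, so
    each increment is smaller than the last by at least this fixed amount and eventually turns
    negative.\<close>
  have pos: "0 < (2 - x) * Y 1" using x \<open>Y 1 > 0\<close> by simp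
  have le: "D n \<le> D 0 - real n * ((2 - x) * Y 1)" for n
  proof (induction n)
    case (Suc n)
    have "(2 - x) * Y 1 \<le> (2 - x) * Y (Suc n)" using Y1 x by (intro mult_left_mono) auto
    then show ?case using Suc DS[of n] by (simp add: algebra_simps)
  qed simp
  obtain n where "D 0 < real n * ((2 - x) * Y 1)" using reals_Archimedean3[OF pos] by blast
  with le[of n] D0[of n] show False by simp
qed

lemma chain_negative_after:
  assumes ch: "chain x Y" and x: "x < 2" and nz: "Y 0 \<noteq> 0 \<or> Y 1 \<noteq> 0"
  shows "\<exists>n\<ge>k. Y n < 0" "\<exists>n\<ge>k. 0 < Y n"
proof -
  have nz': "Y (0 + k) \<noteq> 0 \<or> Y (1 + k) \<noteq> 0" using chain_zero[OF ch, of k] nz by auto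
  from chain_negative[OF chain_shift[OF ch] x nz'] obtain n where "Y (n + k) < 0" by blast
  then show "\<exists>n\<ge>k. Y n < 0" by (intro exI[of _ "n + k"]) simp
  have "- Y (0 + k) \<noteq> 0 \<or> - Y (1 + k) \<noteq> 0" using nz' by simp
  from chain_negative[OF chain_uminus[OF chain_shift[OF ch]] x this] obtain n where "- Y (n + k) <
      0" by blast
  then show "\<exists>n\<ge>k. 0 < Y n" by (intro exI[of _ "n + k"]) simp
qed

lemma chain_opposite_signs:
  assumes ch: "chain x Y" and x: "x < 2"
  shows "\<exists>n. Y n * Y (Suc n) \<le> 0"
proof (cases "Y 0 = 0")
  case True
  then show ?thesis by (intro exI[of _ 0]) simp
next
  case False
  show ?thesis
  proof (rule ccontr)
    assume "\<not> ?thesis"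
    then have p: "0 < Y n * Y (Suc n)" for n by (simp add: not_le)
    have same: "0 < Y 0 * Y n" for n
    proof (induction n)
      case 0
      then show ?case using False by (auto simp: zero_less_mult_iff)
    next
      case (Suc n)
      then show ?case using p[of n] by (auto simp: zero_less_mult_iff)
    qed
    obtain n n' where "Y n < 0" "0 < Y n'" using chain_negative_after[OF ch x, of 0] False by blast
    then show False using same[of n] same[of n'] by (auto simp: zero_less_mult_iff)
  qed
qed

text \<open>A positive value lies between two negative ones, so a positive local maximum
  \<open>Y n\<close> exists. The product of its differences to both neighbours is nonnegative;
  substituting the recurrence turns this into the bound on the invariant.\<close>

lemma chain_local_max_aux:
  assumes ch: "chain x Y" and x: "x < 2" and C: "0 < (Y 0)\<^sup>2 + (Y 1)\<^sup>2 - x * Y 0 * Y 1"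
  shows "\<exists>n. (Y 0)\<^sup>2 + (Y 1)\<^sup>2 - x * Y 0 * Y 1 \<le> (2 - x) * (Y (Suc n))\<^sup>2"
proof -
  have nz: "Y 0 \<noteq> 0 \<or> Y 1 \<noteq> 0" using C by auto
  note after = chain_negative_after[OF ch x nz]
  obtain a where a: "Y a < 0" using after(1) by blast
  obtain b where b: "a \<le> b" "0 < Y b" using after(2) by blast
  obtain c where c: "b \<le> c" "Y c < 0" using after(1) by blast
  have "Max (Y ` {a..c}) \<in> Y ` {a..c}" using b c by (intro Max_in) auto
  then obtain n where n: "n \<in> {a..c}" "Y n = Max (Y ` {a..c})" by fastforce
  have le: "Y k \<le> Y n" if "a \<le> k" "k \<le> c" for k
    unfolding n(2) using that by (intro Max_ge) auto
  have "0 < Y n" using le[of b] b c by linarith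
  then have "a < n" "n < c" using n(1) a c by (auto simp: le_less)
  then obtain m where m: "n = Suc m" "a \<le> m" by (cases n) auto
  have "Y m \<le> Y n" "Y (Suc n) \<le> Y n" using le m \<open>n < c\<close> by auto
  then have "0 \<le> (Y n - Y m) * (Y n - Y (Suc n))" by simp
  also have "Y (Suc n) = x * Y n - Y m" using ch by (simp add: chain_def m)
  finally have "(Y m)\<^sup>2 + (Y n)\<^sup>2 - x * Y m * Y n \<le> (2 - x) * (Y n)\<^sup>2"
    by (simp add: power2_eq_square algebra_simps)
  then show ?thesis using chain_invariant[OF ch, of m] by (auto simp: m(1))
qed

lemma chain_local_max:
  assumes ch: "chain x Y" and x: "\<bar>x\<bar> < 2" and C: "0 < (Y 0)\<^sup>2 + (Y 1)\<^sup>2 - x * Y 0 * Y 1"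
  shows "\<exists>n. (Y 0)\<^sup>2 + (Y 1)\<^sup>2 - x * Y 0 * Y 1 \<le> (2 - \<bar>x\<bar>) * (Y (Suc n))\<^sup>2"
proof (cases "0 \<le> x")
  case True
  then show ?thesis using chain_local_max_aux[OF ch _ C] x by simp
next
  case False
  have "((-1) ^ n)\<^sup>2 = (1 :: real)" for n by (cases "even n") auto
  then show ?thesis
    using chain_local_max_aux[OF chain_twist[OF ch]] x C False by (simp add: power_mult_distrib)
qed

text \<open>For \<open>x \<ge> 0\<close> choose consecutive terms of opposite signs: the mixed term
  then only adds to two squares of at least 4. The twist handles negative \<open>x\<close>.\<close>

lemma chain_invariant_ge_8:
  assumes ch: "chain x Y" and x: "\<bar>x\<bar> < 2" and Y: "\<And>n. 2 \<le> \<bar>Y n\<bar>"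
  shows "8 \<le> (Y 0)\<^sup>2 + (Y 1)\<^sup>2 - x * Y 0 * Y 1"
proof -
  have *: "8 \<le> (Y 0)\<^sup>2 + (Y 1)\<^sup>2 - x * Y 0 * Y 1"
    if ch: "chain x Y" and x: "0 \<le> x" "x < 2" and Y: "\<And>n. 2 \<le> \<bar>Y n\<bar>" for x Y
  proof -
    obtain n where n: "Y n * Y (Suc n) \<le> 0" using chain_opposite_signs[OF ch x(2)] by blast
    have "4 \<le> (Y n)\<^sup>2" "4 \<le> (Y (Suc n))\<^sup>2" using Y four_le_square by blast+
    moreover have "x * Y n * Y (Suc n) \<le> 0" using n x(1) by (simp add: mult.assoc
        mult_nonneg_nonpos)
    ultimately show ?thesis using chain_invariant[OF ch, of n] by linarith
  qed
  show ?thesis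
  proof (cases "0 \<le> x")
    case True
    then show ?thesis using *[OF ch] x Y by simp
  next
    case False
    then show ?thesis using *[OF chain_twist[OF ch]] x Y by (simp add: abs_mult)
  qed
qed

text \<open>The form \<open>a^2 - x a b + b^2\<close> has eigenvalues \<open>1 + x/2\<close> and
  \<open>1 - x/2\<close>, so it is comparable to the Euclidean norm while
  \<open>\<bar>x\<bar> < 2\<close>.\<close>

lemma elliptic_form_bounds:
  fixes x a b :: real
  shows "(1 - \<bar>x\<bar> / 2) * (a\<^sup>2 + b\<^sup>2) \<le> a\<^sup>2 + b\<^sup>2 - x * a * b"
    "a\<^sup>2 + b\<^sup>2 - x * a * b \<le> (1 + \<bar>x\<bar> / 2) * (a\<^sup>2 + b\<^sup>2)"
proof -
  have "2 * \<bar>a * b\<bar> \<le> a\<^sup>2 + b\<^sup>2"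
    using sum_squares_bound[of "\<bar>a\<bar>" "\<bar>b\<bar>"] by (simp add: abs_mult mult.assoc)
  then have "\<bar>x\<bar> * (2 * \<bar>a * b\<bar>) \<le> \<bar>x\<bar> * (a\<^sup>2 + b\<^sup>2)" by (intro mult_left_mono) auto
  moreover have "\<bar>x * a * b\<bar> = \<bar>x\<bar> * \<bar>a * b\<bar>" by (simp add: abs_mult mult.assoc)
  ultimately have "2 * \<bar>x * a * b\<bar> \<le> \<bar>x\<bar> * (a\<^sup>2 + b\<^sup>2)" by simp
  then show "(1 - \<bar>x\<bar> / 2) * (a\<^sup>2 + b\<^sup>2) \<le> a\<^sup>2 + b\<^sup>2 - x * a * b"
    "a\<^sup>2 + b\<^sup>2 - x * a * b \<le> (1 + \<bar>x\<bar> / 2) * (a\<^sup>2 + b\<^sup>2)"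
    by (simp_all add: left_diff_distrib distrib_right)
qed

text \<open>The recursion acts as an isometry of the definite form above, so its bounded orbits recur.\<close>
lemma chain_recurrent:
  assumes ch: "chain x Y" and x: "\<bar>x\<bar> < 2" and e: "0 < e"
  shows "\<exists>m\<ge>N. \<bar>Y m - Y 0\<bar> < e"
proof -
  define c where "c = 1 - \<bar>x\<bar> / 2"
  have c: "0 < c" using x by (simp add: c_def)
  define C where "C = (Y 0)\<^sup>2 + (Y 1)\<^sup>2 - x * Y 0 * Y 1"
  define p where "p n = (Y n, Y (Suc n))" for n
  have "norm (p n) \<le> sqrt (C / c)" for n
  proof -
    have "c * ((Y n)\<^sup>2 + (Y (Suc n))\<^sup>2) \<le> C"
      using elliptic_form_bounds(1)[of x "Y n" "Y (Suc n)"] chain_invariant[OF ch,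
          of n] by (simp add: c_def C_def)
    then have "(Y n)\<^sup>2 + (Y (Suc n))\<^sup>2 \<le> C / c" using c by (simp add: field_simps)
    then show ?thesis by (simp add: p_def norm_Pair)
  qed
  then have "bounded (range p)" by (auto simp: bounded_iff)
  then obtain l r where r: "strict_mono r" "(p \<circ> r) \<longlonglongrightarrow> l"
    using bounded_imp_convergent_subsequence by blast
  \<comment> \<open>The form lies between \<open>c\<close> and 2 times the squared norm. Transport
    from index \<open>i\<close> to 0 thus yields
    \<open>c (Z 0)^2 \<le> 2 d^2 = c e^2 / 2\<close>.\<close>
  define d where "d = e * sqrt c / 2"
  have d: "0 < d" using e c by (simp add: d_def)
  have "Cauchy (p \<circ> r)" using r(2) by (rule LIMSEQ_imp_Cauchy)
  then obtain M where M: "\<forall>i\<ge>M. \<forall>j\<ge>M. dist ((p \<circ> r) i) ((p \<circ> r) j) < d"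
    using d unfolding Cauchy_def by blast
  define i where "i = r M"
  define m where "m = r (M + N) - r M"
  have "N \<le> m"
  proof -
    have "r M + n \<le> r (M + n)" for n
    proof (induction n)
      case (Suc n)
      have "r (M + n) < r (M + Suc n)" using r(1) by (simp add: strict_mono_def)
      then show ?case using Suc by simp
    qed simp
    from this[of N] show ?thesis by (simp add: m_def)
  qed
  have im: "r (M + N) = i + m" using r(1) by (simp add: i_def m_def strict_mono_less_eq)
  \<comment> \<open>The difference of a chain and its shift by the return time \<open>m\<close> is
    again a chain. Its invariant is small at \<open>i\<close>, hence also at index 0.\<close>
  define Z where "Z n = Y (n + m) - Y n" for n
  have chZ: "chain x Z"
    unfolding chain_def
  proof
    fix n
    have "Y (Suc (Suc n)) = x * Y (Suc n) - Y n" "Y (Suc (Suc n) + m) =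
        x * Y (Suc n + m) - Y (n + m)"
      using ch by (simp_all add: chain_def)
    then show "Z (Suc (Suc n)) = x * Z (Suc n) - Z n" by (simp only: Z_def right_diff_distrib)
  qed
  have "dist (p (i + m)) (p i) < d"
    using M[rule_format, of "M + N" M] by (simp add: im flip: i_def)
  then have "sqrt ((Z i)\<^sup>2 + (Z (Suc i))\<^sup>2) < d"
    by (simp add: p_def dist_Pair_Pair dist_real_def Z_def add.commute)
  then have "(Z i)\<^sup>2 + (Z (Suc i))\<^sup>2 < d\<^sup>2"
    using d by (metis real_sqrt_less_iff real_sqrt_unique less_eq_real_def)
  then have "(1 + \<bar>x\<bar> / 2) * ((Z i)\<^sup>2 + (Z (Suc i))\<^sup>2) \<le> 2 * d\<^sup>2"
    using x by (intro mult_mono) auto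
  with elliptic_form_bounds(2)[where x = x]
  have "(Z i)\<^sup>2 + (Z (Suc i))\<^sup>2 - x * Z i * Z (Suc i) \<le> 2 * d\<^sup>2" by (rule order_trans)
  then have "(Z 0)\<^sup>2 + (Z 1)\<^sup>2 - x * Z 0 * Z 1 \<le> 2 * d\<^sup>2" using chain_invariant[OF chZ,
      of i] by simp
  with elliptic_form_bounds(1)[where x = x]
  have "c * ((Z 0)\<^sup>2 + (Z 1)\<^sup>2) \<le> 2 * d\<^sup>2" unfolding c_def by (rule order_trans)
  moreover have "c * (Z 0)\<^sup>2 \<le> c * ((Z 0)\<^sup>2 + (Z 1)\<^sup>2)" using c by simp
  moreover have "2 * d\<^sup>2 = c * (e\<^sup>2 / 2)" using c by (simp add: d_def power_mult_distrib
      power_divide)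
  ultimately have "(Z 0)\<^sup>2 \<le> e\<^sup>2 / 2" using c by (metis mult_le_cancel_left_pos order_trans)
  also have "\<dots> < e\<^sup>2" using e by simp
  finally have "\<bar>Z 0\<bar> < e" using e by (metis abs_le_square_iff abs_of_pos not_le)
  then show ?thesis using \<open>N \<le> m\<close> by (auto simp: Z_def)
qed

lemma chain_growth:
  assumes ch: "chain x Y" and x: "2 \<le> \<bar>x\<bar>" and gt: "\<bar>Y 0\<bar> < \<bar>Y 1\<bar>"
  shows "\<bar>Y n\<bar> < \<bar>Y (Suc n)\<bar> \<and> \<bar>Y 1\<bar> - \<bar>Y 0\<bar> \<le> \<bar>Y (Suc n)\<bar> - \<bar>Y n\<bar>"
proof (induction n)
  case (Suc n)
  have "2 * \<bar>Y (Suc n)\<bar> \<le> \<bar>x * Y (Suc n)\<bar>" using x by (simp add: abs_mult mult_right_mono)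
  moreover have "Y (Suc (Suc n)) = x * Y (Suc n) - Y n" using ch by (simp add: chain_def)
  ultimately show ?case using Suc gt by linarith
qed (use gt in simp)

lemma chain_unbounded:
  assumes ch: "chain x Y" and x: "2 \<le> \<bar>x\<bar>" and gt: "\<bar>Y 0\<bar> < \<bar>Y 1\<bar>"
  shows "\<exists>n. B < \<bar>Y n\<bar>"
proof -
  have le: "real n * (\<bar>Y 1\<bar> - \<bar>Y 0\<bar>) \<le> \<bar>Y n\<bar>" for n
  proof (induction n)
    case (Suc n)
    then show ?case using chain_growth[OF ch x gt, of n] by (simp add: distrib_right)
  qed simp
  obtain n where "B < real n * (\<bar>Y 1\<bar> - \<bar>Y 0\<bar>)"
    using reals_Archimedean3[of "\<bar>Y 1\<bar> - \<bar>Y 0\<bar>"] gt by auto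
  then show ?thesis using le[of n] by (intro exI[of _ n]) simp
qed

text \<open>A chain that never increases lies on the contracting eigenline:
  \<open>\<bar>x\<bar> \<bar>Y (Suc n)\<bar>\<close> is at most
  \<open>\<bar>Y (Suc n)\<bar> + \<bar>Y n\<bar>\<close>, which gives the ratio
  \<open>1 / (\<bar>x\<bar> - 1) < 1\<close>.\<close>

lemma chain_decay:
  assumes ch: "chain x Y" and x: "2 < \<bar>x\<bar>" and dec: "\<And>n. \<bar>Y (Suc n)\<bar> \<le> \<bar>Y n\<bar>"
  shows "Y \<longlonglongrightarrow> 0"
proof -
  define q where "q = 1 / (\<bar>x\<bar> - 1)"
  have q: "0 \<le> q" "q < 1" using x by (auto simp: q_def)
  have step: "\<bar>Y (Suc n)\<bar> \<le> q * \<bar>Y n\<bar>" for n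
  proof -
    have "x * Y (Suc n) = Y (Suc (Suc n)) + Y n" using ch by (simp add: chain_def)
    then have "\<bar>x\<bar> * \<bar>Y (Suc n)\<bar> \<le> \<bar>Y (Suc n)\<bar> + \<bar>Y n\<bar>"
      using dec[of "Suc n"] by (simp flip: abs_mult)
    then have "(\<bar>x\<bar> - 1) * \<bar>Y (Suc n)\<bar> \<le> \<bar>Y n\<bar>" by (simp add: algebra_simps)
    then show ?thesis using x by (simp add: q_def field_simps)
  qed
  have "norm (Y n) \<le> q ^ n * \<bar>Y 0\<bar>" for n
  proof (induction n)
    case (Suc n)
    then show ?case using step[of n] mult_left_mono[OF Suc q(1)] by (simp add: mult.assoc)
  qed simp
  moreover have "(\<lambda>n. q ^ n * \<bar>Y 0\<bar>) \<longlonglongrightarrow> 0"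
    using q by (intro tendsto_mult_left_zero LIMSEQ_realpow_zero)
  ultimately show ?thesis by (intro Lim_null_comparison[of Y "\<lambda>n. q ^ n * \<bar>Y 0\<bar>"]) auto
qed

text \<open>Values that never increase would tend to 0 when \<open>\<bar>x\<bar> > 2\<close>,
  forcing the invariant \<open>\<mu> - x^2\<close> to vanish. After one increase the chain grows
  past both 2 and \<open>\<bar>x\<bar>\<close>, and the cone between the curve and a late neighbour
  passes the growth test.\<close>

lemma hyperbolic_neighbours_grow:
  assumes g: "markov \<mu> g" and mu: "\<mu> > 4" and x: "2 \<le> \<bar>g 1 0\<bar>" and ne: "(g 1 0)\<^sup>2 \<noteq> \<mu>"
  shows "\<exists>n. grows (rebase g 1 0 (int n) 1)"
proof -
  define Y where "Y n = g (int n) 1" for n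
  define C where "C = \<mu> - (g 1 0)\<^sup>2"
  have ch: "chain (g 1 0) Y" using chain_markov(1)[OF g] by (simp add: Y_def[abs_def])
  have inv: "(Y n)\<^sup>2 + (Y (Suc n))\<^sup>2 - g 1 0 * Y n * Y (Suc n) = C" for n
    using chain_markov(2)[OF g] by (simp add: Y_def C_def)
  have "\<exists>k. \<bar>Y k\<bar> < \<bar>Y (Suc k)\<bar>"
  proof (rule ccontr)
    assume "\<not> ?thesis"
    then have dec: "\<bar>Y (Suc n)\<bar> \<le> \<bar>Y n\<bar>" for n by (simp add: not_less)
    show False
    proof (cases "2 < \<bar>g 1 0\<bar>")
      case True
      have "Y \<longlonglongrightarrow> 0" by (rule chain_decay[OF ch True dec])
      then have "(\<lambda>n. (Y n)\<^sup>2 + (Y (Suc n))\<^sup>2 - g 1 0 * Y n * Y (Suc n)) \<longlonglongrightarrow> 0\<^sup>2 + 0\<^sup>2 - g 1 0 * 0 *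
          0"
        by (intro tendsto_intros LIMSEQ_Suc)
      then have "C = 0" by (simp add: inv LIMSEQ_const_iff)
      then show False using ne by (simp add: C_def)
    next
      case False
      \<comment> \<open>In the parabolic case the chain, up to signs, is an arithmetic progression
        with squared difference \<open>\<mu> - 4\<close>, which is unbounded because that is not
        0.\<close>
      define s where "s = g 1 0 / 2"
      have s: "s = 1 \<or> s = -1" "g 1 0 = 2 * s" using False x by (auto simp: s_def)
      define W where "W n = s ^ n * Y n" for n
      define d where "d = W 1 - W 0"
      have Wd: "W (Suc n) - W n = d" for n
      proof (induction n)
        case (Suc n)
        have eq: "Y (Suc (Suc n)) = 2 * s * Y (Suc n) - Y n" using ch s by (simp add: chain_def)
        have ss: "s ^ Suc (Suc n) = s ^ n" using s(1) by auto
        have "W (Suc (Suc n)) = 2 * W (Suc n) - W n"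
          unfolding W_def eq ss by (simp add: algebra_simps)
        then show ?case using Suc by simp
      qed (simp add: d_def)
      have absW: "\<bar>W n\<bar> \<le> \<bar>Y 0\<bar>" for n
      proof -
        have "\<bar>Y n\<bar> \<le> \<bar>Y 0\<bar>"
        proof (induction n)
          case (Suc n)
          with dec[of n] show ?case by (rule order_trans)
        qed simp
        moreover have "\<bar>s ^ n\<bar> = 1" using s(1) by (auto simp: power_abs)
        ultimately show ?thesis by (simp add: W_def abs_mult)
      qed
      have Wn: "W n = W 0 + real n * d" for n
      proof (induction n)
        case (Suc n)
        then show ?case using Wd[of n] by (simp add: algebra_simps)
      qed simp
      have "d\<^sup>2 = C"
      proof -
        have "C = (Y 0)\<^sup>2 + (Y 1)\<^sup>2 - 2 * s * Y 0 * Y 1" using inv[of 0] s by simp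
        moreover have "s * s = 1" using s(1) by auto
        ultimately show ?thesis using s(1) by (auto simp: d_def W_def power2_eq_square
            algebra_simps)
      qed
      moreover have "C = \<mu> - 4" using s by (auto simp: C_def)
      ultimately have "0 < \<bar>d\<bar>" using mu by auto
      then obtain n where n: "2 * \<bar>Y 0\<bar> < real n * \<bar>d\<bar>" using reals_Archimedean3 by blast
      have "real n * \<bar>d\<bar> = \<bar>W n - W 0\<bar>" using Wn[of n] by (simp add: abs_mult)
      then show False using n absW[of n] absW[of 0] by linarith
    qed
  qed
  then obtain k where k: "\<bar>Y k\<bar> < \<bar>Y (Suc k)\<bar>" by blast
  define Z where "Z n = Y (n + k)" for n
  have chZ: "chain (g 1 0) Z" using chain_shift[OF ch] by (simp add: Z_def[abs_def])
  have k': "\<bar>Z 0\<bar> < \<bar>Z 1\<bar>" using k by (simp add: Z_def)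
  obtain j where "max 2 \<bar>g 1 0\<bar> < \<bar>Z j\<bar>" using chain_unbounded[OF chZ x k'] by blast
  then have j: "2 < \<bar>Z j\<bar>" "\<bar>g 1 0\<bar> < \<bar>Z j\<bar>" by linarith+
  have j': "\<bar>Z j\<bar> < \<bar>Z (Suc j)\<bar>" using chain_growth[OF chZ x k'] by blast
  have r: "rebase g 1 0 (int (j + k)) 1 1 0 = g 1 0" "rebase g 1 0 (int (j + k)) 1 0 1 = Z j"
    "rebase g 1 0 (int (j + k)) 1 1 1 = Z (Suc j)"
    by (simp_all add: rebase_def Z_def Y_def add.commute)
  have "grows (rebase g 1 0 (int (j + k)) 1)"
    unfolding grows_def r using j j' x by linarith
  then show ?thesis by blast
qed

text \<open>The assumed values are bounded, so a nonzero chain must decay. Far out, two consecutive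
  terms have a small nonzero product, and the curve of their sum has trace close to but different
  from \<open>- g 1 0\<close>: neither elliptic nor a square root of \<open>\<mu>\<close>.\<close>

lemma sector_dihedral_of_fixed:
  assumes g: "markov \<mu> g" and mu: "\<mu> > 4" and x: "(g 1 0)\<^sup>2 = \<mu>"
    and S: "\<And>a b. 0 \<le> a \<Longrightarrow> 0 \<le> b \<Longrightarrow> coprime a b \<Longrightarrow> \<bar>g a b\<bar> < 2 \<or> (g a b)\<^sup>2 = \<mu>"
  shows "g 0 1 = 0 \<and> g 1 1 = 0"
proof -
  define Y where "Y n = g (int n) 1" for n
  have ch: "chain (g 1 0) Y" using chain_markov(1)[OF g] by (simp add: Y_def[abs_def])
  have inv: "(Y n)\<^sup>2 + (Y (Suc n))\<^sup>2 = g 1 0 * Y n * Y (Suc n)" for n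
    using chain_markov(2)[OF g, of n] x by (simp add: Y_def)
  define m where "m = \<bar>g 1 0\<bar>"
  have m: "2 < m" using x mu by (simp add: m_def abs_greater_2_iff)
  have Ym: "\<bar>Y n\<bar> \<le> m" for n
  proof -
    have "\<bar>Y n\<bar> < 2 \<or> (Y n)\<^sup>2 = (g 1 0)\<^sup>2" using S[of "int n" 1] x by (simp add: Y_def)
    then show ?thesis
    proof
      assume "(Y n)\<^sup>2 = (g 1 0)\<^sup>2"
      then have "Y n = g 1 0 \<or> Y n = - g 1 0" by (simp only: power2_eq_iff)
      then show ?thesis unfolding m_def by (elim disjE) simp_all
    qed (use m in linarith)
  qed
  have "Y 0 = 0 \<and> Y 1 = 0"
  proof (rule ccontr)
    assume nz: "\<not> ?thesis"
    have dec: "\<bar>Y (Suc n)\<bar> \<le> \<bar>Y n\<bar>" for n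
    proof (rule ccontr)
      assume "\<not> ?thesis"
      then have "\<exists>j. m < \<bar>Y (j + n)\<bar>"
        using chain_unbounded[OF chain_shift[OF ch, of n]] m by (simp add: m_def)
      then show False using Ym by (meson not_le)
    qed
    have "Y \<longlonglongrightarrow> 0" using chain_decay[OF ch _ dec] m by (simp add: m_def)
    then have "(\<lambda>n. Y n * Y (Suc n)) \<longlonglongrightarrow> 0 * 0" by (intro tendsto_intros LIMSEQ_Suc)
    then have "(\<lambda>n. Y n * Y (Suc n)) \<longlonglongrightarrow> 0" by simp
    then have "(\<lambda>n. \<bar>Y n * Y (Suc n)\<bar>) \<longlonglongrightarrow> 0" by (rule tendsto_rabs_zero)
    from order_tendstoD(2)[OF this, of "m - 2"] obtain n where n: "\<bar>Y n * Y (Suc n)\<bar> < m - 2"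
      using m by (auto simp: eventually_sequentially)
    have "Y n * Y (Suc n) \<noteq> 0"
    proof
      assume "Y n * Y (Suc n) = 0"
      then have "(Y n)\<^sup>2 + (Y (Suc n))\<^sup>2 = 0" using inv[of n] by (simp add: mult.assoc)
      then have "Y n = 0" "Y (Suc n) = 0" by (simp_all add: sum_power2_eq_zero_iff)
      then show False using chain_zero[OF ch] nz by blast
    qed
    \<comment> \<open>\<open>(2 n + 1, 2)\<close> is the sum of the neighbours \<open>(n, 1)\<close>
      and \<open>(n + 1, 1)\<close>, whose difference is (1,0) up to sign.\<close>
    define t where "t = g (2 * int n + 1) 2"
    have t: "t = Y n * Y (Suc n) - g 1 0"
      using markov_sum[OF g, of "1 + int n" 1 1 "int n"] by (simp add: t_def Y_def algebra_simps)
    have "coprime (2 * int n + 1) 2" by simp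
    then have "\<bar>t\<bar> < 2 \<or> t\<^sup>2 = \<mu>" using S[of "2 * int n + 1" 2] by (simp add: t_def)
    moreover have "\<not> \<bar>t\<bar> < 2" using n t unfolding m_def by linarith
    ultimately have "t\<^sup>2 = (g 1 0)\<^sup>2" using x by simp
    then have "t = g 1 0 \<or> t = - g 1 0" by (simp add: power2_eq_iff)
    then show False
    proof
      assume "t = g 1 0"
      then have "Y n * Y (Suc n) = 2 * g 1 0" using t by simp
      then show False using n m unfolding m_def by simp
    next
      assume "t = - g 1 0"
      then show False using t \<open>Y n * Y (Suc n) \<noteq> 0\<close> by simp
    qed
  qed
  then show ?thesis by (simp add: Y_def)
qed

text \<open>At a local maximum \<open>y\<close> of the neighbours of an elliptic value \<open>x\<close> one has
  \<open>y\<^sup>2 \<ge> x\<^sup>2 + (\<mu> - 4) / 2\<close>, so a cone of elliptic values would contain arbitrarily large ones.\<close>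
lemma sector_not_all_elliptic:
  assumes g: "markov \<mu> g" and mu: "\<mu> > 4"
  shows "\<exists>a b. 0 \<le> a \<and> 0 \<le> b \<and> coprime a b \<and> 2 \<le> \<bar>g a b\<bar>"
proof (rule ccontr)
  assume "\<not> ?thesis"
  then have all: "\<forall>a b. 0 \<le> a \<longrightarrow> 0 \<le> b \<longrightarrow> coprime a b \<longrightarrow> \<bar>g a b\<bar> < 2" by (meson not_le)
  define d where "d = (\<mu> - 4) / 2"
  have d: "0 < d" using mu by (simp add: d_def)
  have ex: "\<exists>h. markov \<mu> h \<and> (\<forall>a b. 0 \<le> a \<longrightarrow> 0 \<le> b \<longrightarrow> coprime a b \<longrightarrow> \<bar>h a b\<bar> < 2) \<and> real k * d \<le>
      (h 1 0)\<^sup>2" for k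
  proof (induction k)
    case 0
    then show ?case using g all by (intro exI[of _ g]) simp
  next
    case (Suc k)
    then obtain h where h: "markov \<mu> h" "\<forall>a b. 0 \<le> a \<longrightarrow> 0 \<le> b \<longrightarrow> coprime a b \<longrightarrow> \<bar>h a b\<bar> < 2"
      "real k * d \<le> (h 1 0)\<^sup>2" by blast
    define X where "X = \<bar>h 1 0\<bar>"
    have X: "0 \<le> X" "X < 2" using h(2) by (simp_all add: X_def)
    have sq: "(h 1 0)\<^sup>2 = X\<^sup>2" by (simp add: X_def)
    have X2: "\<bar>h 1 0\<bar> < 2" using X by (simp add: X_def)
    then have pos: "0 < \<mu> - (h 1 0)\<^sup>2" using mu abs_less_2_iff[of "h 1 0"] by simp
    have C: "(h (int 0) 1)\<^sup>2 + (h (int 1) 1)\<^sup>2 - h 1 0 * h (int 0) 1 * h (int 1) 1 = \<mu> - (h 1 0)\<^sup>2"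
      using chain_markov(2)[OF h(1), of 0] by simp
    obtain n where n: "\<mu> - (h 1 0)\<^sup>2 \<le> (2 - X) * (h (int (Suc n)) 1)\<^sup>2"
      using chain_local_max[OF chain_markov(1)[OF h(1)] X2, unfolded C,
          OF pos] unfolding X_def by blast
    define y where "y = h (int (Suc n)) 1"
    have "(2 - X) * (X\<^sup>2 + d) \<le> \<mu> - X\<^sup>2"
    proof -
      \<comment> \<open>With \<open>d = (\<mu> - 4) / 2\<close> the terms \<open>2 d\<close> cancel
        on expansion, leaving \<open>X^3 - 3 X^2 + 4 + X d\<close>.\<close>
      have "0 \<le> (X - 2)\<^sup>2 * (X + 1) + X * d" using X d by simp
      also have "\<dots> = 4 + 2 * d - X\<^sup>2 - (2 - X) * (X\<^sup>2 + d)"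
          by (simp add: power2_eq_square algebra_simps)
      also have "4 + 2 * d = \<mu>" by (simp add: d_def field_simps)
      finally show ?thesis by simp
    qed
    also have "\<dots> \<le> (2 - X) * y\<^sup>2" using n by (simp add: sq y_def)
    finally have "X\<^sup>2 + d \<le> y\<^sup>2" using X by simp
    then have yk: "real (Suc k) * d \<le> y\<^sup>2" using h(3) sq by (simp add: distrib_right)
    \<comment> \<open>The curve of larger squared trace becomes the first basis vector. Both basis
      vectors are nonnegative, so the new cone lies in the old one and remains elliptic.\<close>
    define h' where "h' = rebase h (int (Suc n)) 1 1 0"
    have h10: "h' 1 0 = y" by (simp add: h'_def rebase_def y_def)
    have hm: "markov \<mu> h'" unfolding h'_def by (rule markov_rebase[OF h(1)]) simp
    have hs: "\<bar>h' a b\<bar> < 2" if "0 \<le> a" "0 \<le> b" "coprime a b" for a b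
    proof -
      have 1: "coprime (a * int (Suc n) + b * 1) (a * 1 + b * 0)"
        by (rule coprime_rebase[OF _ that(3)]) simp
      have 2: "0 \<le> a * int (Suc n) + b * 1" "0 \<le> a * 1 + b * 0" using that by simp_all
      from h(2)[rule_format, OF 2 1] show ?thesis unfolding h'_def rebase_def .
    qed
    have "real (Suc k) * d \<le> (h' 1 0)\<^sup>2" unfolding h10 by (rule yk)
    with hm hs show ?case by blast
  qed
  obtain k where k: "4 < real k * d" using reals_Archimedean3[OF d] by blast
  from ex[of k] obtain h :: "int \<Rightarrow> int \<Rightarrow> real"
    where h: "\<forall>a b. 0 \<le> a \<longrightarrow> 0 \<le> b \<longrightarrow> coprime a b \<longrightarrow> \<bar>h a b\<bar> < 2" "real k * d \<le> (h 1 0)\<^sup>2"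
    by blast
  have "\<bar>h 1 0\<bar> < 2" using h(1) by simp
  moreover have "4 < (h 1 0)\<^sup>2" using k h(2) by linarith
  ultimately show False using abs_less_2_iff[of "h 1 0"] by simp
qed

text \<open>A Bezout solution stays a solution when a multiple of \<open>(a, b)\<close> is added;
  the multiple \<open>k\<close> is large enough to make both entries nonnegative.\<close>

lemma nonneg_basis_extension:
  fixes a b :: int
  assumes "0 \<le> a" "0 \<le> b" "coprime a b"
  shows "\<exists>r s. 0 \<le> r \<and> 0 \<le> s \<and> \<bar>a * s - b * r\<bar> = 1"
proof -
  consider "a = 0" | "b = 0" | "1 \<le> a" "1 \<le> b" using assms by linarith
  then show ?thesis
  proof cases
    case 1
    then show ?thesis using assms by (intro exI[of _ 1] exI[of _ 0]) auto
  next
    case 2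
    then show ?thesis using assms by (intro exI[of _ 0] exI[of _ 1]) auto
  next
    case 3
    obtain u v where uv: "u * a + v * b = 1" using bezout_int[of a b] assms by auto
    define k where "k = \<bar>u\<bar> + \<bar>v\<bar>"
    have "k * 1 \<le> k * a" "k * 1 \<le> k * b" using 3 by (intro mult_left_mono; simp add: k_def)+
    moreover have "v \<le> k" "- u \<le> k" by (simp_all add: k_def)
    ultimately have "0 \<le> k * a - v" "0 \<le> k * b + u" by linarith+
    moreover have "a * (k * b + u) - b * (k * a - v) = 1" using uv by (simp add: algebra_simps)
    ultimately show ?thesis by (intro exI[of _ "k * a - v"] exI[of _ "k * b + u"]) simp
  qed
qed

text \<open>A cone cannot be entirely elliptic, so it contains a value of square
  \<open>\<mu>\<close>. In a basis starting there two zeros appear, and a single dihedral triple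
  determines all values.\<close>

lemma sector_dihedral:
  assumes g: "markov \<mu> g" and mu: "\<mu> > 4"
    and S: "\<And>a b. 0 \<le> a \<Longrightarrow> 0 \<le> b \<Longrightarrow> coprime a b \<Longrightarrow> \<bar>g a b\<bar> < 2 \<or> (g a b)\<^sup>2 = \<mu>"
    and "coprime c d"
  shows "g c d = 0 \<or> (g c d)\<^sup>2 = \<mu>"
proof -
  obtain a b where ab: "0 \<le> a" "0 \<le> b" "coprime a b" "2 \<le> \<bar>g a b\<bar>"
    using sector_not_all_elliptic[OF g mu] by blast
  then have sq: "(g a b)\<^sup>2 = \<mu>" using S by force
  obtain r s where rs: "0 \<le> r" "0 \<le> s" and det: "\<bar>a * s - b * r\<bar> = 1"
    using nonneg_basis_extension[OF ab(1-3)] by blast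
  define h where "h = rebase g a b r s"
  have h: "markov \<mu> h" unfolding h_def by (rule markov_rebase[OF g det])
  have "h 0 1 = 0 \<and> h 1 1 = 0"
  proof (rule sector_dihedral_of_fixed[OF h mu])
    show "(h 1 0)\<^sup>2 = \<mu>" using sq by (simp add: h_def rebase_def)
    show "\<bar>h c d\<bar> < 2 \<or> (h c d)\<^sup>2 = \<mu>" if "0 \<le> c" "0 \<le> d" "coprime c d" for c d
      using S[of "c * a + d * r" "c * b + d * s"] coprime_rebase[OF det that(3)] that ab rs
      by (simp add: h_def rebase_def)
  qed
  then have dih: "dihedral_triple (h 1 0) (h 0 1) (h 1 1)" by (simp add: dihedral_triple_def)
  obtain c' d' where "coprime c' d'" "c = c' * a + d' * r" "d = c' * b + d' * s"
    using rebase_coordinates[OF det \<open>coprime c d\<close>] by metis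
  then show ?thesis using dihedral_values[OF h dih, of c' d'] by (simp add: h_def rebase_def)
qed

section \<open>Farey intervals on the circle\<close>

definition vec2 :: "int \<Rightarrow> int \<Rightarrow> complex" where
  "vec2 p q = Complex (of_int p) (of_int q)"

definition cross :: "complex \<Rightarrow> complex \<Rightarrow> real" where
  "cross X Y = Im X * Re Y - Re X * Im Y"

text \<open>Squaring doubles the argument and so identifies a vector with its negative:
  \<open>proj X\<close> stands for the line through \<open>X\<close>.\<close>

definition proj :: "complex \<Rightarrow> complex" where
  "proj X = X\<^sup>2 / of_real ((cmod X)\<^sup>2)"

lemma pl_pt_eq: "pl_pt (p, q) = proj (vec2 p q)"
proof -
  have "of_int p + \<i> * of_int q = vec2 p q" by (simp add: vec2_def complex_eq_iff)
  then show ?thesis by (simp add: pl_pt_def proj_def)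
qed

lemma norm_proj: "X \<noteq> 0 \<Longrightarrow> cmod (proj X) = 1"
  by (simp add: proj_def norm_divide norm_power)

lemma vec2_nonzero: "coprime p q \<Longrightarrow> vec2 p q \<noteq> 0"
  by (auto simp: vec2_def complex_eq_iff)

lemma pl_pt_in_PL: "coprime p q \<Longrightarrow> pl_pt (p, q) \<in> PL"
  by (simp add: pl_pt_eq PL_def norm_proj vec2_nonzero)

lemma norm_vec2_ge_1: "coprime p q \<Longrightarrow> 1 \<le> cmod (vec2 p q)"
proof -
  assume "coprime p q"
  then have "p \<noteq> 0 \<or> q \<noteq> 0" by auto
  then have "1 \<le> p\<^sup>2 + q\<^sup>2"
    by (metis add_nonneg_nonneg int_one_le_iff_zero_less order_le_less sum_power2_eq_zero_iff
        zero_le_power2)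
  then have "1 \<le> real_of_int (p\<^sup>2 + q\<^sup>2)" by linarith
  then have "1 \<le> (real_of_int p)\<^sup>2 + (real_of_int q)\<^sup>2" by simp
  then show ?thesis by (simp add: vec2_def cmod_def)
qed

lemma vec2_combination:
  "vec2 (a * p + b * r) (a * q + b * s) = of_int a * vec2 p q + of_int b * vec2 r s"
  by (simp add: vec2_def complex_eq_iff)

lemma vec2_minus: "vec2 (-p) (-q) = - vec2 p q"
  by (simp add: vec2_def complex_eq_iff)

lemma pl_pt_minus: "pl_pt (-p, -q) = pl_pt (p, q)"
  by (simp add: pl_pt_eq vec2_minus proj_def)

text \<open>The chord between angles \<open>2 s\<close> and \<open>2 t\<close> has length
  \<open>2 \<bar>sin (s - t)\<bar>\<close>, and \<open>cross\<close> is that sine times both norms,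
  up to sign.\<close>

lemma dist_proj:
  assumes "X \<noteq> 0" "Y \<noteq> 0"
  shows "dist (proj X) (proj Y) = 2 * \<bar>cross X Y\<bar> / (cmod X * cmod Y)"
proof -
  have e: "proj Z = Z / cnj Z" if "Z \<noteq> 0" for Z
    using that by (simp only: proj_def complex_norm_square) (simp add: power2_eq_square)
  have "proj X - proj Y = (X * cnj Y - Y * cnj X) / (cnj X * cnj Y)"
    using assms by (simp add: e field_simps)
  moreover have "X * cnj Y - Y * cnj X = of_real (2 * cross X Y) * \<i>"
    by (simp add: complex_eq_iff cross_def algebra_simps)
  ultimately show ?thesis by (simp add: dist_norm norm_divide norm_mult)
qed

lemma cross_vec2: "cross (vec2 a b) (vec2 p q) = of_int (b * p - a * q)"
  by (simp add: cross_def vec2_def)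

lemma cross_combination:
  "cross (of_real a * U + of_real b * V) (of_real c * U + of_real d * V) =
      (a * d - b * c) * cross U V"
  by (simp add: cross_def algebra_simps)

lemma coprime_columns:
  fixes p q r s :: int
  assumes "\<bar>p * s - q * r\<bar> = 1"
  shows "coprime p q" "coprime r s"
  using coprime_rebase[OF assms, of 1 0] coprime_rebase[OF assms, of 0 1] by simp_all

definition in_sector :: "int \<times> int \<times> int \<times> int \<Rightarrow> int \<Rightarrow> int \<Rightarrow> bool" where
  "in_sector M a b = (case M of (p, q, r, s) \<Rightarrow> \<exists>c d. 0 \<le> c \<and> 0 \<le> d \<and> coprime c d \<and>
     ((a = c * p + d * r \<and> b = c * q + d * s) \<or> (a = - (c * p + d * r) \<and> b = - (c * q + d * s))))"

lemma dist_rational: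
  assumes det: "\<bar>p * s - q * r\<bar> = 1" and cop: "coprime a b"
  shows "dist (pl_pt (a * p + b * r, a * q + b * s)) (pl_pt (p, q)) =
    2 * \<bar>of_int b\<bar> / (cmod (of_int a * vec2 p q + of_int b * vec2 r s) * cmod (vec2 p q))"
proof -
  have "\<bar>real_of_int ((a * q + b * s) * p - (a * p + b * r) * q)\<bar> = \<bar>of_int b\<bar>"
  proof -
    have "(a * q + b * s) * p - (a * p + b * r) * q = b * (p * s - q * r)"
        by (simp add: algebra_simps)
    moreover have "\<bar>real_of_int (p * s - q * r)\<bar> = 1" using det by linarith
    ultimately show ?thesis by (simp only: of_int_mult abs_mult mult_1_right)
  qed
  then have c: "\<bar>cross (vec2 (a * p + b * r) (a * q + b * s)) (vec2 p q)\<bar> = \<bar>of_int b\<bar>"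
    by (simp only: cross_vec2)
  then show ?thesis
    using dist_proj[OF vec2_nonzero[OF coprime_rebase[OF det cop]] vec2_nonzero[OF
        coprime_columns(1)[OF det]]]
    unfolding c pl_pt_eq by (simp only: vec2_combination)
qed

text \<open>A vector W of the cone from U to \<open>V + N U\<close> with second coordinate
  \<open>b\<close> has norm at least \<open>b (N - \<bar>V\<bar>) > 2 b / e\<close>, whereas the
  chord to U is \<open>2 b\<close> over the product of the norms.\<close>

lemma rational_sector_small:
  assumes det: "\<bar>p * s - q * r\<bar> = 1" and N: "cmod (vec2 r s) + 2 / e < real N" and e: "0 < e"
    and ab: "0 \<le> a" "0 \<le> b" "coprime a b"
  shows "dist (pl_pt (a * p + b * (r + int N * p), a * q + b * (s + int N * q))) (pl_pt (p, q)) < e"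
proof -
  have det': "\<bar>p * (s + int N * q) - q * (r + int N * p)\<bar> = 1"
    using det by (simp add: algebra_simps)
  define U V where "U = vec2 p q" and "V = vec2 r s"
  have U1: "1 \<le> cmod U" unfolding U_def by (rule norm_vec2_ge_1[OF coprime_columns(1)[OF det]])
  have "vec2 (r + int N * p) (s + int N * q) = V + of_int (int N) * U"
    by (simp add: V_def U_def vec2_def complex_eq_iff)
  then have d: "dist (pl_pt (a * p + b * (r + int N * p), a * q + b * (s + int N * q))) (pl_pt (p,
      q))
    = 2 * of_int b / (cmod (of_int a * U + of_int b * (V + of_int (int N) * U)) * cmod U)"
    using dist_rational[OF det' ab(3)] ab by (simp add: U_def V_def)
  show ?thesis
  proof (cases "b = 0")
    case True
    then show ?thesis using d e by simp
  next
    case False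
    then have b: "0 < real_of_int b" using ab by simp
    define W where "W = of_int a * U + of_int b * (V + of_int (int N) * U)"
    define x where "x = of_int a + of_int b * real N"
    have x: "0 \<le> x" using ab by (simp add: x_def)
    have "W = of_real x * U - of_real (- b) * V" by (simp add: W_def x_def algebra_simps)
    then have "cmod (of_real x * U) - cmod (of_real (- b) * V) \<le> cmod W"
      by (metis norm_triangle_ineq2)
    moreover have "cmod (of_real x * U) = (of_int a + of_int b * real N) * cmod U"
      using x by (simp add: norm_mult flip: x_def)
    moreover have "(of_int b * real N) * 1 \<le> (of_int a + of_int b * real N) * cmod U"
      using ab U1 by (intro mult_mono) auto
    moreover have "cmod (of_real (- b) * V) = of_int b * cmod V" using ab by (simp add: norm_mult)
    ultimately have "of_int b * (real N - cmod V) \<le> cmod W" by (simp add: algebra_simps)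
    moreover have "of_int b * (2 / e) < of_int b * (real N - cmod V)"
      using N b by (intro mult_strict_left_mono) (auto simp: V_def)
    ultimately have "of_int b * (2 / e) < cmod W" by linarith
    moreover have "cmod W * 1 \<le> cmod W * cmod U" using U1 by (intro mult_left_mono) auto
    ultimately have "of_int b * (2 / e) < cmod W * cmod U" by linarith
    then have *: "2 * of_int b < e * (cmod W * cmod U)" using e by (simp add: field_simps)
    moreover have "0 < cmod W * cmod U" using \<open>of_int b * (2 / e) < cmod W * cmod U\<close> b e
      by (metis divide_pos_pos less_trans mult_pos_pos zero_less_numeral)
    ultimately show ?thesis unfolding d W_def[symmetric] by (simp add: divide_less_eq)
  qed
qed

text \<open>If \<open>W = c U + d V\<close> has \<open>\<bar>c\<bar> < N \<bar>d\<bar>\<close>, its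
  norm is at most \<open>\<bar>d\<bar> B\<close> and its chord to U is at least
  \<open>2 / (B \<bar>U\<bar>)\<close>, the chosen radius. Closer vectors have
  \<open>\<bar>c\<bar> \<ge> N \<bar>d\<bar>\<close> and, up to sign, lie in one of two thin cones
  along U.\<close>

lemma rational_nbhd:
  assumes det: "\<bar>p * s - q * r\<bar> = 1"
  shows "\<exists>e>0. \<forall>a b. coprime a b \<longrightarrow> dist (pl_pt (a, b)) (pl_pt (p, q)) < e \<longrightarrow>
    in_sector (p, q, r + int N * p, s + int N * q) a b \<or> in_sector (p, q, - r + int N * p,
        - s + int N * q) a b"
proof -
  define U V where "U = vec2 p q" and "V = vec2 r s"
  have U1: "1 \<le> cmod U" unfolding U_def by (rule norm_vec2_ge_1[OF coprime_columns(1)[OF det]])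
  have V1: "1 \<le> cmod V" unfolding V_def by (rule norm_vec2_ge_1[OF coprime_columns(2)[OF det]])
  define B where "B = real N * cmod U + cmod V"
  have "0 \<le> real N * cmod U" by simp
  then have B: "0 < B" using V1 unfolding B_def by linarith
  define e where "e = 2 / (B * cmod U)"
  have "0 < cmod U" using U1 by linarith
  then have e: "0 < e" using B by (simp add: e_def)
  have "in_sector (p, q, r + int N * p, s + int N * q) a b \<or> in_sector (p, q, - r + int N * p,
      - s + int N * q) a b"
    if cop: "coprime a b" and near: "dist (pl_pt (a, b)) (pl_pt (p, q)) < e" for a b
  proof -
    obtain c d where cd: "coprime c d" "a = c * p + d * r" "b = c * q + d * s"
      using rebase_coordinates[OF det cop] by metis
    have ge: "int N * \<bar>d\<bar> \<le> \<bar>c\<bar>"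
    proof (rule ccontr)
      assume "\<not> ?thesis"
      then have lt: "\<bar>c\<bar> < int N * \<bar>d\<bar>" by simp
      then have d0: "d \<noteq> 0" by auto
      define W where "W = of_int c * U + of_int d * V"
      have W0: "W \<noteq> 0"
        using vec2_nonzero[OF coprime_rebase[OF det cd(1)]] by (simp add: W_def U_def V_def
            vec2_combination)
      have "cmod W \<le> \<bar>of_int c\<bar> * cmod U + \<bar>of_int d\<bar> * cmod V"
        unfolding W_def by (rule order_trans[OF norm_triangle_ineq]) (simp add: norm_mult)
      also have "real_of_int \<bar>c\<bar> \<le> real_of_int (int N * \<bar>d\<bar>)" using lt by linarith
      then have "\<bar>of_int c\<bar> * cmod U \<le> (real N * \<bar>of_int d\<bar>) * cmod U"
        by (intro mult_right_mono) auto
      finally have "cmod W \<le> \<bar>of_int d\<bar> * B" by (simp add: B_def algebra_simps)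
      then have "cmod W * cmod U \<le> \<bar>of_int d\<bar> * B * cmod U" by (intro mult_right_mono) auto
      then have "2 * \<bar>of_int d\<bar> / (\<bar>of_int d\<bar> * B * cmod U) \<le> 2 * \<bar>of_int d\<bar> / (cmod W * cmod U)"
        using W0 U1 by (intro divide_left_mono mult_pos_pos) (use d0 B in auto)
      moreover have "2 * \<bar>of_int d\<bar> / (\<bar>of_int d\<bar> * B * cmod U) = e" using d0 by (simp add: e_def)
      moreover have "dist (pl_pt (a, b)) (pl_pt (p, q)) = 2 * \<bar>of_int d\<bar> / (cmod W * cmod U)"
        using dist_rational[OF det cd(1)] by (simp add: cd W_def U_def V_def)
      ultimately show False using near by linarith
    qed
    have pos: "in_sector (p, q, r + int N * p, s + int N * q) a b \<or> in_sector (p, q,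
        - r + int N * p, - s + int N * q) a b"
      if "coprime c d" "0 \<le> c" "int N * \<bar>d\<bar> \<le> \<bar>c\<bar>"
        "(a = c * p + d * r \<and> b = c * q + d * s) \<or> (a = - (c * p + d * r) \<and> b = - (c * q + d * s))"
            for c d
    proof (cases "0 \<le> d")
      case True
      have "coprime (c - int N * d) d"
        using coprime_rebase[of 1 1 "- int N" 0 d c] that(1) by (simp add: coprime_commute
            algebra_simps)
      then have "in_sector (p, q, r + int N * p, s + int N * q) a b"
        unfolding in_sector_def using that True
        by (intro case_prodI exI[of _ "c - int N * d"] exI[of _ d]) (simp; elim disjE; simp add:
            algebra_simps)
      then show ?thesis ..
    next
      case False
      have "coprime (c + int N * d) (- d)"
        using coprime_rebase[of 1 1 "int N" 0 d c] that(1) by (simp add: coprime_commute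
            algebra_simps)
      then have "in_sector (p, q, - r + int N * p, - s + int N * q) a b"
        unfolding in_sector_def using that False
        by (intro case_prodI exI[of _ "c + int N * d"] exI[of _ "- d"]) (simp; elim disjE; simp add:
            algebra_simps)
      then show ?thesis ..
    qed
    show ?thesis
    proof (cases "0 \<le> c")
      case True
      then show ?thesis using pos[OF cd(1)] cd ge by blast
    next
      case False
      then show ?thesis using pos[of "-c" "-d"] cd ge by simp
    qed
  qed
  with e show ?thesis by blast
qed

text \<open>The slow continued fraction algorithm, subtracting the smaller coefficient from the
  larger; irrationality prevents equality. The angle between the basis vectors stays at most a right
  angle, so every step adds at least 1 to the sum of squares.\<close>

lemma irrational_basis:
  assumes irr: "\<And>a b. coprime a b \<Longrightarrow> cross (vec2 a b) X \<noteq> 0"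
  shows "\<exists>p q r s \<alpha> \<beta>. \<bar>p * s - q * r\<bar> = 1 \<and> 0 < \<alpha> \<and> 0 < \<beta> \<and>
    X = of_real \<alpha> * vec2 p q + of_real \<beta> * vec2 r s \<and> 0 \<le> p * r + q * s \<and> int n \<le>
        p\<^sup>2 + q\<^sup>2 + r\<^sup>2 + s\<^sup>2"
proof (induction n)
  case 0
  have "Re X \<noteq> 0" "Im X \<noteq> 0"
    using irr[of 0 1] irr[of 1 0] by (auto simp: cross_def vec2_def)
  define p where "p = (if 0 < Re X then 1 else -1 :: int)"
  define s where "s = (if 0 < Im X then 1 else -1 :: int)"
  have "\<bar>p * s - 0 * 0\<bar> = 1" by (simp add: p_def s_def)
  moreover have "X = of_real \<bar>Re X\<bar> * vec2 p 0 + of_real \<bar>Im X\<bar> * vec2 0 s"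
    by (simp add: p_def s_def vec2_def complex_eq_iff)
  moreover have "0 < \<bar>Re X\<bar>" "0 < \<bar>Im X\<bar>" using \<open>Re X \<noteq> 0\<close> \<open>Im X \<noteq> 0\<close> by auto
  moreover have "0 \<le> p * 0 + 0 * s" "int 0 \<le> p\<^sup>2 + 0\<^sup>2 + 0\<^sup>2 + s\<^sup>2" by simp_all
  ultimately show ?case by blast
next
  case (Suc n)
  then obtain p q r s \<alpha> \<beta> where *: "\<bar>p * s - q * r\<bar> = 1" "0 < \<alpha>" "0 < \<beta>"
    "X = of_real \<alpha> * vec2 p q + of_real \<beta> * vec2 r s" "0 \<le> p * r + q * s" "int n \<le>
        p\<^sup>2 + q\<^sup>2 + r\<^sup>2 + s\<^sup>2"
    by blast
  have v: "vec2 (p + r) (q + s) = vec2 p q + vec2 r s" by (simp add: vec2_def complex_eq_iff)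
  have nz: "1 \<le> p\<^sup>2 + q\<^sup>2" "1 \<le> r\<^sup>2 + s\<^sup>2"
    using coprime_columns[OF *(1)]
    by (auto simp: int_one_le_iff_zero_less sum_power2_gt_zero_iff)
  have "\<alpha> \<noteq> \<beta>"
  proof
    assume "\<alpha> = \<beta>"
    then have "X = of_real \<alpha> * vec2 (p + r) (q + s)" using * by (simp add: v algebra_simps)
    then have "cross (vec2 (p + r) (q + s)) X = 0" by (simp add: cross_def)
    moreover have "coprime (p + r) (q + s)" using coprime_rebase[OF *(1), of 1 1] by simp
    ultimately show False using irr by blast
  qed
  then consider "\<beta> < \<alpha>" | "\<alpha> < \<beta>" by linarith
  then show ?case
  proof cases
    case 1
    have "\<bar>p * (q + s) - q * (p + r)\<bar> = 1" using *(1) by (simp add: algebra_simps)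
    moreover have "X = of_real (\<alpha> - \<beta>) * vec2 p q + of_real \<beta> * vec2 (p + r) (q + s)"
      unfolding v *(4) by (simp add: algebra_simps)
    moreover have "0 \<le> p * (p + r) + q * (q + s)" "int (Suc n) \<le> p\<^sup>2 + q\<^sup>2 + (p + r)\<^sup>2 + (q + s)\<^sup>2"
    proof -
      have "p * (p + r) + q * (q + s) = (p\<^sup>2 + q\<^sup>2) + (p * r + q * s)"
      "p\<^sup>2 + q\<^sup>2 + (p + r)\<^sup>2 + (q + s)\<^sup>2 = (p\<^sup>2 + q\<^sup>2 + r\<^sup>2 + s\<^sup>2) + (p\<^sup>2 + q\<^sup>2) + 2 * (p * r + q *
          s)"
        by (simp_all add: power2_eq_square algebra_simps)
      moreover have "0 \<le> (p\<^sup>2 + q\<^sup>2) + (p * r + q * s)"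
        "int (Suc n) \<le> (p\<^sup>2 + q\<^sup>2 + r\<^sup>2 + s\<^sup>2) + (p\<^sup>2 + q\<^sup>2) + 2 * (p * r + q * s)"
        using *(5,6) nz by simp_all
      ultimately show "0 \<le> p * (p + r) + q * (q + s)" "int (Suc n) \<le>
          p\<^sup>2 + q\<^sup>2 + (p + r)\<^sup>2 + (q + s)\<^sup>2"
        by (simp_all only:)
    qed
    moreover have "0 < \<alpha> - \<beta>" "0 < \<beta>" using * 1 by simp_all
    ultimately show ?thesis by blast
  next
    case 2
    have "\<bar>(p + r) * s - (q + s) * r\<bar> = 1" using *(1) by (simp add: algebra_simps)
    moreover have "X = of_real \<alpha> * vec2 (p + r) (q + s) + of_real (\<beta> - \<alpha>) * vec2 r s"
      unfolding v *(4) by (simp add: algebra_simps)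
    moreover have "0 \<le> (p + r) * r + (q + s) * s" "int (Suc n) \<le> (p + r)\<^sup>2 + (q + s)\<^sup>2 + r\<^sup>2 + s\<^sup>2"
    proof -
      have "(p + r) * r + (q + s) * s = (r\<^sup>2 + s\<^sup>2) + (p * r + q * s)"
      "(p + r)\<^sup>2 + (q + s)\<^sup>2 + r\<^sup>2 + s\<^sup>2 = (p\<^sup>2 + q\<^sup>2 + r\<^sup>2 + s\<^sup>2) + (r\<^sup>2 + s\<^sup>2) + 2 * (p * r + q *
          s)"
        by (simp_all add: power2_eq_square algebra_simps)
      moreover have "0 \<le> (r\<^sup>2 + s\<^sup>2) + (p * r + q * s)"
        "int (Suc n) \<le> (p\<^sup>2 + q\<^sup>2 + r\<^sup>2 + s\<^sup>2) + (r\<^sup>2 + s\<^sup>2) + 2 * (p * r + q * s)"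
        using *(5,6) nz by simp_all
      ultimately show "0 \<le> (p + r) * r + (q + s) * s" "int (Suc n) \<le>
          (p + r)\<^sup>2 + (q + s)\<^sup>2 + r\<^sup>2 + s\<^sup>2"
        by (simp_all only:)
    qed
    moreover have "0 < \<alpha>" "0 < \<beta> - \<alpha>" using * 2 by simp_all
    ultimately show ?thesis by blast
  qed
qed

lemma norm_acute:
  assumes "0 \<le> a" "0 \<le> b" "0 \<le> Re U * Re V + Im U * Im V"
  shows "a * cmod U \<le> cmod (of_real a * U + of_real b * V)" "b * cmod V \<le>
      cmod (of_real a * U + of_real b * V)"
proof -
  have e: "(cmod (of_real a * U + of_real b * V))\<^sup>2
    = a\<^sup>2 * (cmod U)\<^sup>2 + b\<^sup>2 * (cmod V)\<^sup>2 + 2 * (a * b) * (Re U * Re V + Im U * Im V)"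
    unfolding cmod_power2 by (simp add: power2_eq_square algebra_simps)
  have "0 \<le> 2 * (a * b) * (Re U * Re V + Im U * Im V)" using assms by simp
  then have "(a * cmod U)\<^sup>2 \<le> (cmod (of_real a * U + of_real b * V))\<^sup>2"
    "(b * cmod V)\<^sup>2 \<le> (cmod (of_real a * U + of_real b * V))\<^sup>2"
    unfolding e by (simp_all add: power_mult_distrib)
  then show "a * cmod U \<le> cmod (of_real a * U + of_real b * V)" "b * cmod V \<le>
      cmod (of_real a * U + of_real b * V)"
    by (auto intro: power2_le_imp_le)
qed

definition farey_cover :: "complex \<Rightarrow> real \<Rightarrow> (int \<times> int \<times> int \<times> int) set \<Rightarrow> real \<Rightarrow> bool" where
  "farey_cover L e I e' \<longleftrightarrow> I \<noteq> {} \<and> finite I \<and> 0 < e' \<and>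
    (\<forall>(p, q, r, s) \<in> I. \<bar>p * s - q * r\<bar> = 1 \<and>
       (\<forall>a b. 0 \<le> a \<longrightarrow> 0 \<le> b \<longrightarrow> coprime a b \<longrightarrow> dist (pl_pt (a * p + b * r, a * q + b * s)) L < e)) \<and>
    (\<forall>a b. coprime a b \<longrightarrow> dist (pl_pt (a, b)) L < e' \<longrightarrow> (\<exists>M\<in>I. in_sector M a b))"

text \<open>Near a point of the circle, the coprime pairs are covered by the cones of at most two small
    Farey
  intervals: two adjacent ones at a rational point, a single one around an irrational point.\<close>
lemma farey_nbhd:
  assumes L: "L \<in> PL" and e: "0 < e"
  shows "\<exists>I e'. farey_cover L e I e'"
proof -
  define X where "X = csqrt L"
  have X2: "X\<^sup>2 = L" by (simp add: X_def)
  have normL: "cmod L = 1" using L by (simp add: PL_def)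
  have "(cmod X)\<^sup>2 = 1" using X2 normL by (metis norm_power)
  then have "cmod X = 1 \<or> cmod X = -1" by (simp only: power2_eq_1_iff)
  then have normX: "cmod X = 1" using norm_ge_zero[of X] by linarith
  then have X0: "X \<noteq> 0" by auto
  have LX: "L = proj X" by (simp add: proj_def X2 normX)
  show ?thesis
  proof (cases "\<exists>p q. coprime p q \<and> cross (vec2 p q) X = 0")
    case True
    then obtain p q where pq: "coprime p q" "cross (vec2 p q) X = 0" by blast
    have "dist (proj (vec2 p q)) (proj X) = 0"
      using dist_proj[OF vec2_nonzero[OF pq(1)] X0] pq by simp
    then have Lpq: "L = pl_pt (p, q)" by (simp add: LX pl_pt_eq)
    obtain u v where "u * p + v * q = 1" using bezout_int[of p q] pq by auto
    then have det: "\<bar>p * u - q * (-v)\<bar> = 1" by (simp add: mult.commute)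
    define r s where "r = -v" and "s = u"
    have det: "\<bar>p * s - q * r\<bar> = 1" using det by (simp add: r_def s_def)
    have det': "\<bar>p * (-s) - q * (-r)\<bar> = 1" using det by (simp add: abs_minus_commute)
    obtain N where N: "cmod (vec2 r s) + 2 / e < real N" using reals_Archimedean2 by blast
    have N': "cmod (vec2 (-r) (-s)) + 2 / e < real N" using N by (simp add: vec2_minus)
    obtain e' where e': "0 < e'" "\<forall>a b. coprime a b \<longrightarrow> dist (pl_pt (a, b)) (pl_pt (p, q)) < e' \<longrightarrow>
      in_sector (p, q, r + int N * p, s + int N * q) a b \<or> in_sector (p, q, - r + int N * p,
          - s + int N * q) a b"
      using rational_nbhd[OF det] by blast
    define I where "I = {(p, q, r + int N * p, s + int N * q), (p, q, - r + int N * p,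
        - s + int N * q)}"
    have "\<forall>a b. coprime a b \<longrightarrow> dist (pl_pt (a, b)) L < e' \<longrightarrow> (\<exists>M\<in>I. in_sector M a b)"
      using e'(2) by (auto simp: I_def Lpq)
    moreover have "\<bar>p * (s + int N * q) - q * (r + int N * p)\<bar> = 1"
        "\<bar>p * (- s + int N * q) - q * (- r + int N * p)\<bar> = 1"
      using det by (simp_all add: algebra_simps abs_minus_commute)
    moreover have "dist (pl_pt (a * p + b * (r + int N * p), a * q + b * (s + int N * q))) L < e"
      "dist (pl_pt (a * p + b * (- r + int N * p), a * q + b * (- s + int N * q))) L < e"
      if "0 \<le> a" "0 \<le> b" "coprime a b" for a b
      unfolding Lpq using rational_sector_small[OF det N e that] rational_sector_small[OF det' N' e
          that] by auto
    ultimately show ?thesis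
      using e'(1) by (intro exI[of _ I] exI[of _ e']) (simp add: farey_cover_def I_def)
  next
    case False
    then have irr: "\<And>a b. coprime a b \<Longrightarrow> cross (vec2 a b) X \<noteq> 0" by blast
    \<comment> \<open>As both norms are at least 1, \<open>(\<bar>U\<bar> \<bar>V\<bar>)^2 \<ge>
      \<bar>U\<bar>^2 + \<bar>V\<bar>^2 - 1\<close>. This \<open>n\<close> therefore makes
      \<open>e \<bar>U\<bar> \<bar>V\<bar>\<close> larger than \<open>sqrt 8\<close>, hence than the
      required 2.\<close>
    obtain n :: nat where n: "8 / e\<^sup>2 + 1 < real n" using reals_Archimedean2 by blast
    obtain p q r s \<alpha> \<beta> where *: "\<bar>p * s - q * r\<bar> = 1" "0 < \<alpha>" "0 < \<beta>"
      "X = of_real \<alpha> * vec2 p q + of_real \<beta> * vec2 r s" "0 \<le> p * r + q * s" "int n \<le>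
          p\<^sup>2 + q\<^sup>2 + r\<^sup>2 + s\<^sup>2"
      using irrational_basis[OF irr, of n] by blast
    define U V where "U = vec2 p q" and "V = vec2 r s"
    have XUV: "X = of_real \<alpha> * U + of_real \<beta> * V" using * by (simp add: U_def V_def)
    have UV1: "1 \<le> cmod U" "1 \<le> cmod V"
      unfolding U_def V_def using norm_vec2_ge_1 coprime_columns[OF *(1)] by blast+
    have acute: "0 \<le> Re U * Re V + Im U * Im V"
    proof -
      have "0 \<le> real_of_int (p * r + q * s)" using *(5) by linarith
      then show ?thesis by (simp add: U_def V_def vec2_def)
    qed
    have crUV: "\<bar>cross U V\<bar> = 1"
    proof -
      have "\<bar>real_of_int (q * r - p * s)\<bar> = 1" using *(1) by linarith
      then show ?thesis by (simp add: U_def V_def cross_vec2)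
    qed
    have big: "2 < e * (cmod U * cmod V)"
    proof -
      have "real n \<le> real_of_int (p\<^sup>2 + q\<^sup>2 + r\<^sup>2 + s\<^sup>2)" using *(6) by linarith
      then have "real n \<le> (cmod U)\<^sup>2 + (cmod V)\<^sup>2"
        by (simp add: U_def V_def vec2_def cmod_power2)
      moreover have "0 \<le> ((cmod U)\<^sup>2 - 1) * ((cmod V)\<^sup>2 - 1)" using UV1 by simp
      then have "(cmod U)\<^sup>2 + (cmod V)\<^sup>2 - 1 \<le> (cmod U * cmod V)\<^sup>2"
        by (simp add: power_mult_distrib algebra_simps)
      ultimately have "8 / e\<^sup>2 < (cmod U * cmod V)\<^sup>2" using n by linarith
      then have "8 < (e * (cmod U * cmod V))\<^sup>2" using e by (simp add: field_simps)
      then have "2\<^sup>2 < (e * (cmod U * cmod V))\<^sup>2" by simp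
      then show ?thesis using e by (intro power2_less_imp_less[of 2]) auto
    qed
    have dist: "dist (pl_pt (c * p + d * r, c * q + d * s)) L
      = 2 * \<bar>of_int c * \<beta> - of_int d * \<alpha>\<bar> / cmod (of_real (of_int c) * U + of_real (of_int d) * V)"
      if "coprime c d" for c d
    proof -
      have W: "vec2 (c * p + d * r) (c * q + d * s) = of_real (of_int c) * U + of_real (of_int d) *
          V"
        by (simp add: vec2_combination U_def V_def)
      have "vec2 (c * p + d * r) (c * q + d * s) \<noteq> 0" using vec2_nonzero[OF coprime_rebase[OF *(1)
          that]] .
      from dist_proj[OF this X0] show ?thesis
        unfolding pl_pt_eq LX W unfolding XUV cross_combination
        using crUV normX by (simp add: abs_mult XUV[symmetric])
    qed
    have small: "dist (pl_pt (a * p + b * r, a * q + b * s)) L < e" if ab: "0 \<le> a" "0 \<le> b"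
        "coprime a b" for a b
    proof -
      define W where "W = of_real (of_int a) * U + of_real (of_int b) * V"
      have W0: "W \<noteq> 0"
        using vec2_nonzero[OF coprime_rebase[OF *(1) ab(3)]] by (simp add: W_def U_def V_def
            vec2_combination)
      have W: "of_int a * cmod U \<le> cmod W" "of_int b * cmod V \<le> cmod W"
        unfolding W_def using ab by (intro norm_acute acute; simp)+
      have X: "\<alpha> * cmod U \<le> 1" "\<beta> * cmod V \<le> 1"
        using norm_acute[of \<alpha> \<beta> U V] * acute normX by (simp_all add: XUV)
      have "(of_int a * cmod U) * (\<beta> * cmod V) \<le> cmod W * 1" "(of_int b * cmod V) * (\<alpha> * cmod U) \<le>
          cmod W * 1"
        using W X ab * by (intro mult_mono; simp)+
      then have le: "(of_int a * \<beta>) * (cmod U * cmod V) \<le> cmod W"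
          "(of_int b * \<alpha>) * (cmod U * cmod V) \<le> cmod W"
        by (simp_all add: mult_ac)
      have nn: "0 \<le> of_int a * \<beta>" "0 \<le> of_int b * \<alpha>" using ab * by simp_all
      have "\<bar>of_int a * \<beta> - of_int b * \<alpha>\<bar> \<le> max (of_int a * \<beta>) (of_int b * \<alpha>)" using nn by linarith
      then have "\<bar>of_int a * \<beta> - of_int b * \<alpha>\<bar> * (cmod U * cmod V) \<le>
          max (of_int a * \<beta>) (of_int b * \<alpha>) * (cmod U * cmod V)"
        by (intro mult_right_mono) auto
      also have "\<dots> \<le> cmod W" using le by (auto simp: max_def)
      finally have t: "\<bar>of_int a * \<beta> - of_int b * \<alpha>\<bar> * (cmod U * cmod V) \<le> cmod W" .
      show ?thesis
      proof (cases "of_int a * \<beta> - of_int b * \<alpha> = 0")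
        case True
        then show ?thesis using dist[OF ab(3)] e by simp
      next
        case False
        have "\<bar>of_int a * \<beta> - of_int b * \<alpha>\<bar> * 2 < \<bar>of_int a * \<beta> - of_int b * \<alpha>\<bar> * (e * (cmod U *
            cmod V))"
          using False big by (intro mult_strict_left_mono) auto
        also have "\<dots> = e * (\<bar>of_int a * \<beta> - of_int b * \<alpha>\<bar> * (cmod U * cmod V))" by simp
        also have "\<dots> \<le> e * cmod W" using t e by (intro mult_left_mono) auto
        finally have "2 * \<bar>of_int a * \<beta> - of_int b * \<alpha>\<bar> < e * cmod W" by linarith
        then have "2 * \<bar>of_int a * \<beta> - of_int b * \<alpha>\<bar> / cmod W < e"
            using W0 by (simp add: divide_less_eq)
        then show ?thesis using dist[OF ab(3)] unfolding W_def by linarith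
      qed
    qed
    define B where "B = cmod U + cmod V"
    \<comment> \<open>For \<open>c\<close>, \<open>d\<close> of opposite signs the cross product
      with \<open>X\<close> is a sum without cancellation, at least
      \<open>(\<bar>c\<bar> + \<bar>d\<bar>) min \<alpha> \<beta>\<close>, while the norm is at most
      \<open>(\<bar>c\<bar> + \<bar>d\<bar>) B\<close>. Vectors outside the cone thus keep distance
      \<open>e'\<close> from \<open>L\<close>.\<close>
    define e' where "e' = 2 * min \<alpha> \<beta> / B"
    have B: "0 < B" using UV1 by (simp add: B_def)
    have "0 < e'" using B * by (simp add: e'_def)
    moreover have "in_sector (p, q, r, s) a b" if cop: "coprime a b" and near: "dist (pl_pt (a,
        b)) L < e'" for a b
    proof -
      obtain c d where cd: "coprime c d" "a = c * p + d * r" "b = c * q + d * s"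
        using rebase_coordinates[OF *(1) cop] by metis
      have "(0 \<le> c \<and> 0 \<le> d) \<or> (c \<le> 0 \<and> d \<le> 0)"
      proof (rule ccontr)
        assume neg: "\<not> ?thesis"
        define W where "W = of_real (of_int c) * U + of_real (of_int d) * V"
        have W0: "W \<noteq> 0"
          using vec2_nonzero[OF coprime_rebase[OF *(1) cd(1)]] by (simp add: W_def U_def V_def
              vec2_combination)
        define k where "k = real_of_int \<bar>c\<bar> + real_of_int \<bar>d\<bar>"
        have "cmod W \<le> \<bar>of_int c\<bar> * cmod U + \<bar>of_int d\<bar> * cmod V"
          unfolding W_def by (rule order_trans[OF norm_triangle_ineq]) (simp add: norm_mult)
        also have "\<dots> \<le> k * cmod U + k * cmod V"
          by (intro add_mono mult_right_mono) (auto simp: k_def)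
        finally have Wk: "cmod W \<le> k * B" by (simp add: B_def algebra_simps)
        have "k * min \<alpha> \<beta> \<le> real_of_int \<bar>c\<bar> * \<beta> + real_of_int \<bar>d\<bar> * \<alpha>"
          unfolding k_def distrib_right by (intro add_mono mult_left_mono) auto
        also have "\<dots> = \<bar>of_int c * \<beta> - of_int d * \<alpha>\<bar>"
        proof -
          from neg consider "0 < c" "d < 0" | "c < 0" "0 < d" by linarith
          then show ?thesis
          proof cases
            case 1
            then have "0 < of_int c * \<beta>" "of_int d * \<alpha> < 0" using * by (simp_all add: mult_neg_pos)
            then show ?thesis using 1 by simp
          next
            case 2
            then have "of_int c * \<beta> < 0" "0 < of_int d * \<alpha>" using * by (simp_all add: mult_neg_pos)
            then show ?thesis using 2 by simp
          qed
        qed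
        finally have km: "k * min \<alpha> \<beta> \<le> \<bar>of_int c * \<beta> - of_int d * \<alpha>\<bar>" .
        have "e' * cmod W \<le> e' * (k * B)" using Wk \<open>0 < e'\<close> by (intro mult_left_mono) auto
        also have "\<dots> = 2 * (k * min \<alpha> \<beta>)" using B by (simp add: e'_def)
        also have "\<dots> \<le> 2 * \<bar>of_int c * \<beta> - of_int d * \<alpha>\<bar>" using km by simp
        finally have "e' \<le> 2 * \<bar>of_int c * \<beta> - of_int d * \<alpha>\<bar> / cmod W"
            using W0 by (simp add: le_divide_eq)
        then have "e' \<le> dist (pl_pt (a, b)) L"
          using dist[OF cd(1)] unfolding cd(2,3) W_def by linarith
        then show False using near by simp
      qed
      then show ?thesis
      proof
        assume "0 \<le> c \<and> 0 \<le> d"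
        then show ?thesis using cd unfolding in_sector_def by auto
      next
        assume "c \<le> 0 \<and> d \<le> 0"
        then show ?thesis unfolding in_sector_def using cd
          by (intro case_prodI exI[of _ "-c"] exI[of _ "-d"]) simp
      qed
    qed
    ultimately show ?thesis
      using small *(1) by (intro exI[of _ "{(p, q, r, s)}"] exI[of _ e']) (simp add:
          farey_cover_def)
  qed
qed

section \<open>Cantor sets on the circle\<close>

definition ternary :: "(nat \<Rightarrow> nat) \<Rightarrow> real" where
  "ternary d = (\<Sum>n. real (d n) / 3 ^ Suc n)"

lemma middle_third_cantor_eq: "middle_third_cantor = ternary ` {d. \<forall>n. d n \<in> {0, 2}}"
  by (auto simp: middle_third_cantor_def ternary_def)

lemma ternary_digit_bounds:
  assumes "\<forall>n. d n \<in> {0, 2::nat}"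
  shows "0 \<le> real (d n) / 3 ^ Suc n" "real (d n) / 3 ^ Suc n \<le> 2 / 3 * (1 / 3) ^ n"
proof -
  have "real (d n) \<le> 2" using assms[rule_format, of n] by auto
  then show "real (d n) / 3 ^ Suc n \<le> 2 / 3 * (1 / 3) ^ n" "0 \<le> real (d n) / 3 ^ Suc n"
    by (simp_all add: power_one_over field_simps)
qed

lemma ternary_geometric: "(\<lambda>n. 2 / 3 * (1 / 3) ^ n :: real) sums 1"
  using sums_mult[OF geometric_sums[of "1/3::real"], of "2/3"] by simp

lemma ternary_summable:
  assumes "\<forall>n. d n \<in> {0, 2::nat}"
  shows "summable (\<lambda>n. real (d n) / 3 ^ Suc n)"
proof (rule summable_comparison_test'[where N = 0])
  show "summable (\<lambda>n. 2 / 3 * (1 / 3) ^ n :: real)" using ternary_geometric by (rule sums_summable)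
  show "norm (real (d n) / 3 ^ Suc n) \<le> 2 / 3 * (1 / 3) ^ n" for n
    using ternary_digit_bounds[OF assms, of n] by simp
qed

lemma ternary_bounds:
  assumes "\<forall>n. d n \<in> {0, 2::nat}"
  shows "0 \<le> ternary d" "ternary d \<le> 1"
proof -
  show "0 \<le> ternary d" unfolding ternary_def
    by (rule suminf_nonneg[OF ternary_summable[OF assms] ternary_digit_bounds(1)[OF assms]])
  have "ternary d \<le> (\<Sum>n. 2 / 3 * (1 / 3) ^ n)" unfolding ternary_def
    by (rule suminf_le[OF ternary_digit_bounds(2)[OF assms] ternary_summable[OF assms]
        sums_summable[OF ternary_geometric]])
  then show "ternary d \<le> 1" using sums_unique[OF ternary_geometric] by simp
qed

lemma ternary_shift:
  assumes "\<forall>n. d n \<in> {0, 2::nat}"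
  shows "ternary d = (real (d 0) + ternary (\<lambda>n. d (Suc n))) / 3"
proof -
  have "ternary d = real (d 0) / 3 + (\<Sum>n. real (d (Suc n)) / 3 ^ Suc (Suc n))"
    using suminf_split_head[OF ternary_summable[OF assms]] by (simp add: ternary_def)
  also have "(\<Sum>n. real (d (Suc n)) / 3 ^ Suc (Suc n)) = (\<Sum>n. (real (d (Suc n)) / 3 ^ Suc n) / 3)"
    by (simp add: field_simps)
  also have "\<dots> = ternary (\<lambda>n. d (Suc n)) / 3"
    unfolding ternary_def by (rule suminf_divide) (use ternary_summable[of "\<lambda>n. d (Suc n)"] assms in
        simp)
  finally show ?thesis by (simp add: add_divide_distrib)
qed

text \<open>Tails lie in \<open>[0, 1]\<close> and distinct first digits differ by 2, so equal sums
  force equal first digits and equal tails.\<close>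

lemma ternary_inj:
  assumes "\<forall>n. d n \<in> {0, 2::nat}" "\<forall>n. e n \<in> {0, 2::nat}" "ternary d = ternary e"
  shows "d n = e n"
  using assms
proof (induction n arbitrary: d e)
  case 0
  have "\<forall>n. d (Suc n) \<in> {0, 2}" "\<forall>n. e (Suc n) \<in> {0, 2}" using 0 by blast+
  note b = ternary_bounds[OF this(1)] ternary_bounds[OF this(2)]
  have "real (d 0) + ternary (\<lambda>n. d (Suc n)) = real (e 0) + ternary (\<lambda>n. e (Suc n))"
    using 0 ternary_shift[of d] ternary_shift[of e] by simp
  moreover have "d 0 = 0 \<or> d 0 = 2" "e 0 = 0 \<or> e 0 = 2" using 0 by auto
  ultimately show ?case using b by auto
next
  case (Suc n)
  have s: "\<forall>n. d (Suc n) \<in> {0, 2}" "\<forall>n. e (Suc n) \<in> {0, 2}" using Suc.prems by blast+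
  note b = ternary_bounds[OF s(1)] ternary_bounds[OF s(2)]
  have "real (d 0) + ternary (\<lambda>n. d (Suc n)) = real (e 0) + ternary (\<lambda>n. e (Suc n))"
    using Suc.prems ternary_shift[of d] ternary_shift[of e] by simp
  moreover have "d 0 = 0 \<or> d 0 = 2" "e 0 = 0 \<or> e 0 = 2" using Suc.prems by auto
  ultimately have "ternary (\<lambda>n. d (Suc n)) = ternary (\<lambda>n. e (Suc n))" using b by auto
  from Suc.IH[OF s this] show ?case .
qed

lemma ternary_close:
  assumes "\<forall>n. d n \<in> {0, 2::nat}" "\<forall>n. e n \<in> {0, 2::nat}" "\<And>k. k < n \<Longrightarrow> d k = e k"
  shows "\<bar>ternary d - ternary e\<bar> \<le> (1 / 3) ^ n"
  using assms
proof (induction n arbitrary: d e)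
  case 0
  show ?case using ternary_bounds[OF 0(1)] ternary_bounds[OF 0(2)] by simp
next
  case (Suc n)
  have "\<forall>n. d (Suc n) \<in> {0, 2}" "\<forall>n. e (Suc n) \<in> {0, 2}" using Suc.prems by blast+
  from Suc.IH[OF this] Suc.prems(3)
  have "\<bar>ternary (\<lambda>n. d (Suc n)) - ternary (\<lambda>n. e (Suc n))\<bar> \<le> (1 / 3) ^ n" by simp
  moreover have "ternary d - ternary e = (ternary (\<lambda>n. d (Suc n)) - ternary (\<lambda>n. e (Suc n))) / 3"
    using ternary_shift[OF Suc.prems(1)] ternary_shift[OF Suc.prems(2)] Suc.prems(3)[of 0] by (simp
        add: field_simps)
  ultimately show ?case by (simp only: abs_divide power_Suc) simp
qed

text \<open>End points outside the set make the part inside the interval relatively clopen; the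
  continuity of the itinerary rests on this.\<close>

definition cut_interval :: "real set \<Rightarrow> real \<times> real \<Rightarrow> bool" where
  "cut_interval S I \<longleftrightarrow> fst I \<notin> S \<and> snd I \<notin> S \<and> S \<inter> {fst I..snd I} \<noteq> {}"

text \<open>The last clause contracts diameters by 2/3. It is phrased through an arbitrary bound
  \<open>D\<close>, so that it iterates without computing suprema.\<close>

definition cut_point :: "real set \<Rightarrow> real \<Rightarrow> real \<Rightarrow> real \<Rightarrow> bool" where
  "cut_point S l r c \<longleftrightarrow> l < c \<and> c < r \<and> cut_interval S (l, c) \<and> cut_interval S (c, r) \<and>
    (\<forall>D. (\<forall>x\<in>S \<inter> {l..r}. \<forall>y\<in>S \<inter> {l..r}. \<bar>x - y\<bar> \<le> D) \<longrightarrow>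
      (\<forall>x\<in>S \<inter> {l..c}. \<forall>y\<in>S \<inter> {l..c}. \<bar>x - y\<bar> \<le> 2 / 3 * D) \<and>
      (\<forall>x\<in>S \<inter> {c..r}. \<forall>y\<in>S \<inter> {c..r}. \<bar>x - y\<bar> \<le> 2 / 3 * D))"

text \<open>The piece has a least point \<open>a\<close> and a greatest point \<open>b\<close>,
  distinct by perfectness. A missing point in the middle third of \<open>[a, b]\<close> leaves at
  most two thirds of the hull on either side.\<close>

lemma cut_interval_split:
  fixes S :: "real set"
  assumes comp: "compact S"
    and perf: "\<And>x e. x \<in> S \<Longrightarrow> 0 < e \<Longrightarrow> \<exists>y\<in>S. y \<noteq> x \<and> \<bar>y - x\<bar> < e"
    and gap: "\<And>a b. a < b \<Longrightarrow> \<exists>c. a < c \<and> c < b \<and> c \<notin> S"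
    and I: "cut_interval S (l, r)"
  shows "\<exists>c. cut_point S l r c"
proof -
  define T where "T = S \<inter> {l..r}"
  have lr: "l \<notin> S" "r \<notin> S" and ne: "T \<noteq> {}" using I by (auto simp: cut_interval_def T_def)
  have "compact T" unfolding T_def using comp by (intro compact_Int) auto
  then obtain a b where a: "a \<in> T" "\<forall>x\<in>T. a \<le> x" and b: "b \<in> T" "\<forall>x\<in>T. x \<le> b"
    using compact_attains_inf[OF _ ne] compact_attains_sup[OF _ ne] by blast
  have ab: "l < a" "a < r" "l < b" "b < r" using a b lr by (auto simp: T_def le_less)
  obtain y where y: "y \<in> S" "y \<noteq> a" "\<bar>y - a\<bar> < min (a - l) (r - a)"
    using perf[of a "min (a - l) (r - a)"] a ab by (auto simp: T_def)
  have "y \<in> T" using y by (auto simp: T_def)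
  then have "a < b" using y a b by (metis antisym_conv1 le_less_trans)
  then obtain c where c: "a + (b - a) / 3 < c" "c < b - (b - a) / 3" "c \<notin> S"
    using gap[of "a + (b - a) / 3" "b - (b - a) / 3"] by (auto simp: field_simps)
  have acb: "a < c" "c < b" using c \<open>a < b\<close> by (simp_all add: field_simps)
  have aT: "a \<in> S" "l \<le> a" "b \<in> S" "b \<le> r" using a(1) b(1) by (auto simp: T_def)
  have "cut_interval S (l, c)" "cut_interval S (c, r)"
    using lr c acb aT unfolding cut_interval_def by force+
  moreover have "l < c" "c < r" using ab acb by auto
  moreover have "(\<forall>x\<in>S \<inter> {l..c}. \<forall>y\<in>S \<inter> {l..c}. \<bar>x - y\<bar> \<le> 2 / 3 * D) \<and>
      (\<forall>x\<in>S \<inter> {c..r}. \<forall>y\<in>S \<inter> {c..r}. \<bar>x - y\<bar> \<le> 2 / 3 * D)"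
    if D: "\<forall>x\<in>S \<inter> {l..r}. \<forall>y\<in>S \<inter> {l..r}. \<bar>x - y\<bar> \<le> D" for D
  proof -
    have "b - a \<le> D" using D a(1) b(1) unfolding T_def by force
    then have 1: "c - a \<le> 2 / 3 * D" "b - c \<le> 2 / 3 * D" using c by (simp_all add: field_simps)
    have 2: "a \<le> x \<and> x \<le> b" if "x \<in> S" "l \<le> x" "x \<le> r" for x using that a b by (simp add: T_def)
    have "\<bar>x - y\<bar> \<le> 2 / 3 * D" if "x \<in> S \<inter> {l..c}" "y \<in> S \<inter> {l..c}" for x y
    proof -
      have "a \<le> x" "a \<le> y" "x \<le> c" "y \<le> c" using 2[of x] 2[of y] that \<open>c < r\<close> by auto
      then show ?thesis using 1 by linarith
    qed
    moreover have "\<bar>x - y\<bar> \<le> 2 / 3 * D" if "x \<in> S \<inter> {c..r}" "y \<in> S \<inter> {c..r}" for x y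
    proof -
      have "x \<le> b" "y \<le> b" "c \<le> x" "c \<le> y" using 2[of x] 2[of y] that \<open>l < c\<close> by auto
      then show ?thesis using 1 by linarith
    qed
    ultimately show ?thesis by blast
  qed
  ultimately have "cut_point S l r c" unfolding cut_point_def by blast
  then show ?thesis ..
qed

text \<open>Cut the set repeatedly at points outside it, close to the middle of its hull.  The left/right
  itinerary of a point, read as a ternary expansion with digits 0 and 2, is the homeomorphism.\<close>
theorem homeomorphic_middle_third_cantor:
  fixes S :: "real set"
  assumes comp: "compact S" and ne: "S \<noteq> {}"
    and perf: "\<And>x e. x \<in> S \<Longrightarrow> 0 < e \<Longrightarrow> \<exists>y\<in>S. y \<noteq> x \<and> \<bar>y - x\<bar> < e"
    and gap: "\<And>a b. a < b \<Longrightarrow> \<exists>c. a < c \<and> c < b \<and> c \<notin> S"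
  shows "S homeomorphic middle_third_cantor"
proof -
  define cut where "cut l r = (SOME c. cut_point S l r c)" for l r
  have cut: "cut_point S l r (cut l r)" if "cut_interval S (l, r)" for l r
    unfolding cut_def using cut_interval_split[OF comp perf gap that] by (rule someI_ex)
  obtain B where B: "\<forall>x\<in>S. \<bar>x\<bar> \<le> B" using compact_imp_bounded[OF comp] by (auto simp: bounded_iff)
  define I0 where "I0 = (- B - 1, B + 1)"
  have sub0: "S \<subseteq> {fst I0..snd I0}" using B by (force simp: I0_def)
  have good0: "cut_interval S I0" using B ne sub0 by (force simp: cut_interval_def I0_def)
  define half :: "nat \<Rightarrow> real \<times> real \<Rightarrow> real \<times> real" where
    "half k I = (if k = 0 then (fst I, cut (fst I) (snd I)) else (cut (fst I) (snd I), snd I))"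
        for k I
  define K :: "(nat \<Rightarrow> nat) \<Rightarrow> nat \<Rightarrow> real \<times> real" where "K d = rec_nat I0 (\<lambda>n. half (d n))" for d
  have K0: "K d 0 = I0" and KS: "K d (Suc n) = half (d n) (K d n)" for d n by (simp_all add: K_def)
  define piece :: "real \<times> real \<Rightarrow> real set" where "piece I = S \<inter> {fst I..snd I}" for I
  define D where "D = 2 * B"
  have half: "cut_interval S (half k I) \<and> piece (half k I) \<subseteq> piece I \<and>
      (\<forall>D. (\<forall>x\<in>piece I. \<forall>y\<in>piece I. \<bar>x - y\<bar> \<le> D) \<longrightarrow> (\<forall>x\<in>piece (half k I). \<forall>y\<in>piece (half k I). \<bar>x -
          y\<bar> \<le> 2 / 3 * D))"
    if "cut_interval S I" for k I
  proof -
    have "cut_interval S (fst I, snd I)" using that by simp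
    note c = cut[OF this, unfolded cut_point_def]
    show ?thesis
    proof (cases "k = 0")
      case True
      have "half k I = (fst I, cut (fst I) (snd I))" using True by (simp add: half_def)
      then have "piece (half k I) = S \<inter> {fst I..cut (fst I) (snd I)}" "cut_interval S (half k I)"
        using c by (simp_all add: piece_def)
      moreover have "S \<inter> {fst I..cut (fst I) (snd I)} \<subseteq> S \<inter> {fst I..snd I}" using c by auto
      ultimately show ?thesis using c unfolding piece_def[of I] by blast
    next
      case False
      have "half k I = (cut (fst I) (snd I), snd I)" using False by (simp add: half_def)
      then have "piece (half k I) = S \<inter> {cut (fst I) (snd I)..snd I}" "cut_interval S (half k I)"
        using c by (simp_all add: piece_def)
      moreover have "S \<inter> {cut (fst I) (snd I)..snd I} \<subseteq> S \<inter> {fst I..snd I}" using c by auto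
      ultimately show ?thesis using c unfolding piece_def[of I] by blast
    qed
  qed
  have goodK: "cut_interval S (K d n)" for d n
    by (induction n) (simp_all only: K0 KS good0 half)
  have setmono: "piece (K d (Suc n)) \<subseteq> piece (K d n)" for d n
    unfolding KS using half[OF goodK[of d n], of "d n"] by blast
  have diam: "\<forall>x\<in>piece (K d n). \<forall>y\<in>piece (K d n). \<bar>x - y\<bar> \<le> (2 / 3) ^ n * D" for d n
  proof (induction n)
    case 0
    have "\<bar>x - y\<bar> \<le> 2 * B" if "x \<in> S" "y \<in> S" for x y
      using B[rule_format, OF that(1)] B[rule_format, OF that(2)] by linarith
    then show ?case by (simp add: piece_def D_def)
  next
    case (Suc n)
    then have "\<forall>x\<in>piece (half (d n) (K d n)). \<forall>y\<in>piece (half (d n) (K d n)). \<bar>x - y\<bar> \<le>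
        2 / 3 * ((2 / 3) ^ n * D)"
      using half[OF goodK[of d n], of "d n"] by blast
    then show ?case by (simp only: KS power_Suc mult.assoc)
  qed
  define side where "side I x = (if x < cut (fst I) (snd I) then 0 else 2 :: nat)"
      for I :: "real \<times> real" and x
  \<comment> \<open>\<open>J\<close> always keeps the half that contains \<open>x\<close>, whereas
    \<open>K\<close> follows prescribed digits; \<open>JK\<close> identifies the two along the
    itinerary of \<open>x\<close>.\<close>
  define J where "J x = rec_nat I0 (\<lambda>n I. half (side I x) I)" for x
  define dig where "dig x n = side (J x n) x" for x n
  have J0: "J x 0 = I0" and JS: "J x (Suc n) = half (dig x n) (J x n)" for x n
    by (simp_all add: J_def dig_def)
  have JK: "J x n = K (dig x) n" for x n by (induction n) (simp_all add: J0 JS K0 KS)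
  have dig02: "\<forall>n. dig x n \<in> {0, 2}" for x by (simp add: dig_def side_def)
  have inJ: "x \<in> piece (J x n)" if "x \<in> S" for x n
  proof (induction n)
    case 0
    then show ?case using that sub0 by (auto simp: J0 piece_def)
  next
    case (Suc n)
    then show ?case by (auto simp: JS dig_def side_def half_def piece_def)
  qed
  have side_eq: "side I x = k" if "cut_interval S I" "x \<in> piece (half k I)" "k \<in> {0, 2}" for I x k
  proof -
    have "cut (fst I) (snd I) \<notin> S" using cut[of "fst I"
        "snd I"] that(1) by (simp add: cut_interval_def cut_point_def)
    then show ?thesis using that by (cases "k = 0") (auto simp: side_def half_def piece_def le_less)
  qed
  have follow: "J x n = K d n \<and> (\<forall>k<n. dig x k = d k)"
    if "\<forall>n. d n \<in> {0, 2}" "x \<in> piece (K d n)" for x d n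
    using that(2)
  proof (induction n)
    case 0
    then show ?case by (simp add: J0 K0)
  next
    case (Suc n)
    have "x \<in> piece (K d n)" using Suc.prems half[OF goodK[of d n], of "d n"] by (auto simp: KS)
    note IH = Suc.IH[OF this]
    have "dig x n = d n"
      unfolding dig_def using IH Suc.prems side_eq[OF goodK[of d n],
          of x "d n"] that(1) by (simp add: KS)
    then show ?case using IH by (auto simp: JS KS less_Suc_eq)
  qed
  define F where "F x = ternary (dig x)" for x
  have cont: "continuous_on S F"
    unfolding continuous_on_iff
  proof (intro ballI allI impI)
    fix x e :: real assume x: "x \<in> S" and e: "0 < e"
    obtain n where n: "(1 / 3 :: real) ^ n < e" using real_arch_pow_inv[of e "1/3"] e by auto
    \<comment> \<open>The end points are not in \<open>S\<close>, so \<open>x\<close> is interior;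
      points of \<open>S\<close> this close stay in the same interval of generation \<open>n\<close>
      and share the first \<open>n\<close> digits.\<close>
    define l r where "l = fst (J x n)" and "r = snd (J x n)"
    have "l \<notin> S" "r \<notin> S" using goodK[of "dig x" n] by (auto simp: l_def r_def cut_interval_def simp
        flip: JK)
    moreover have "l \<le> x" "x \<le> r" using inJ[OF x, of n] by (auto simp: l_def r_def piece_def)
    ultimately have "l < x" "x < r" using x by (auto simp: le_less)
    moreover have "dist (F y) (F x) < e" if "y \<in> S" "dist y x < min (x - l) (r - x)" for y
    proof -
      have "y \<in> piece (K (dig x) n)"
        using that by (auto simp: piece_def dist_real_def l_def r_def simp flip: JK)
      from follow[OF dig02 this] have "\<And>k. k < n \<Longrightarrow> dig y k = dig x k" by blast
      then have "\<bar>ternary (dig y) - ternary (dig x)\<bar> \<le> (1 / 3) ^ n"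
        by (intro ternary_close dig02) blast
      then show ?thesis using n by (simp add: F_def dist_real_def)
    qed
    ultimately show "\<exists>d>0. \<forall>x'\<in>S. dist x' x < d \<longrightarrow> dist (F x') (F x) < e"
      by (intro exI[of _ "min (x - l) (r - x)"]) simp
  qed
  have inj: "inj_on F S"
  proof (rule inj_onI)
    fix x y assume xy: "x \<in> S" "y \<in> S" "F x = F y"
    have "dig x = dig y" using ternary_inj[OF dig02 dig02] xy(3) by (auto simp: F_def)
    then have "J x n = J y n" for n by (simp add: JK)
    then have le: "\<bar>x - y\<bar> \<le> (2 / 3) ^ n * D" for n
      using diam[of "dig x" n] inJ[OF xy(1), of n] inJ[OF xy(2), of n] by (simp flip: JK)
    have "(\<lambda>n. (2 / 3) ^ n * D) \<longlonglongrightarrow> 0"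
      by (intro tendsto_mult_left_zero LIMSEQ_realpow_zero) auto
    then have "\<bar>x - y\<bar> \<le> 0" by (rule LIMSEQ_le_const) (use le in auto)
    then show "x = y" by simp
  qed
  have "F ` S = middle_third_cantor"
  proof (intro equalityI subsetI)
    fix t assume "t \<in> F ` S"
    then show "t \<in> middle_third_cantor" using dig02 by (auto simp: middle_third_cantor_eq F_def)
  next
    fix t assume "t \<in> middle_third_cantor"
    then obtain d where d: "\<forall>n. d n \<in> {0, 2}" "t = ternary d" by (auto simp: middle_third_cantor_eq)
    \<comment> \<open>Every digit sequence is realized: the pieces it selects are nested, compact
      and nonempty.\<close>
    have "\<Inter> (range (\<lambda>n. piece (K d n))) \<noteq> {}"
    proof (rule compact_nest)
      show "compact (piece (K d n))" for n unfolding piece_def using comp by (intro compact_Int)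
          auto
      show "piece (K d n) \<noteq> {}" for n using goodK[of d n] by (simp add: piece_def cut_interval_def)
      show "piece (K d n) \<subseteq> piece (K d m)" if "m \<le> n" for m n
        by (rule lift_Suc_antimono_le[of "\<lambda>n. piece (K d n)", OF setmono that])
    qed
    then obtain x where x: "\<And>n. x \<in> piece (K d n)" by blast
    have "dig x = d"
    proof
      fix n
      show "dig x n = d n" using follow[OF d(1) x[of "Suc n"]] by simp
    qed
    moreover have "x \<in> S" using x[of 0] by (simp add: piece_def)
    ultimately show "t \<in> F ` S" using d(2) by (auto simp: F_def)
  qed
  from homeomorphic_compact[OF comp cont this inj] show ?thesis .
qed

text \<open>Stereographic projection \<open>f\<close> from a point \<open>c\<close> of the circle
  outside \<open>E\<close> reduces to the line. The rational parametrization \<open>h\<close>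
  inverts it and gives injectivity; gaps are carried over by continuity of \<open>f\<close>.\<close>

lemma cantor_set_in_circle:
  assumes E: "closed E" "E \<subseteq> sphere 0 1" "E \<noteq> {}"
    and perf: "\<And>z e. z \<in> E \<Longrightarrow> 0 < e \<Longrightarrow> \<exists>w\<in>E. w \<noteq> z \<and> dist w z < e"
    and gap: "\<And>z e. z \<in> sphere (0::complex) 1 \<Longrightarrow> 0 < e \<Longrightarrow> \<exists>w\<in>sphere 0 1. w \<notin> E \<and> dist w z < e"
  shows "cantor_set E"
proof -
  obtain c where c: "c \<in> sphere (0::complex) 1" "c \<notin> E" using gap[of 1 1] by auto
  have c0: "c \<noteq> 0" "cmod c = 1" using c by auto
  define P where "P = sphere (0::complex) 1 - {c}"
  define f where "f z = Im (z / c) / (1 - Re (z / c))" for z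
  define h where "h t = c * Complex ((t\<^sup>2 - 1) / (t\<^sup>2 + 1)) (2 * t / (t\<^sup>2 + 1))" for t
  have EP: "E \<subseteq> P" using E c by (auto simp: P_def)
  have Re1: "Re (z / c) \<noteq> 1" if "z \<in> P" for z
  proof
    assume 1: "Re (z / c) = 1"
    have "cmod (z / c) = 1" using that c0 by (simp add: P_def norm_divide)
    then have "(Re (z / c))\<^sup>2 + (Im (z / c))\<^sup>2 = 1" by (metis cmod_power2 one_power2)
    then have "z / c = 1" using 1 by (simp add: complex_eq_iff)
    then show False using that c0 by (simp add: P_def)
  qed
  have hf: "h (f z) = z" if "z \<in> P" for z
  proof -
    define u v where "u = Re (z / c)" and "v = Im (z / c)"
    have u1: "u \<noteq> 1" using Re1[OF that] by (simp add: u_def)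
    have "cmod (z / c) = 1" using that c0 by (simp add: P_def norm_divide)
    then have uv: "u\<^sup>2 + v\<^sup>2 = 1" unfolding u_def v_def by (metis cmod_power2 one_power2)
    define t where "t = v / (1 - u)"
    have v: "v = t * (1 - u)" using u1 by (simp add: t_def)
    have "v\<^sup>2 = (1 + u) * (1 - u)" using uv by (simp add: power2_eq_square algebra_simps)
    then have "t\<^sup>2 * (1 - u) = 1 + u" using u1 unfolding v by (simp add: power_mult_distrib
        power2_eq_square)
    then have t2: "(t\<^sup>2 + 1) * (1 - u) = 2" by (simp add: algebra_simps)
    have pos: "t\<^sup>2 + 1 \<noteq> 0" by (metis add_nonneg_eq_0_iff zero_le_one zero_le_power2 zero_neq_one)
    have "v * (t\<^sup>2 + 1) = t * ((t\<^sup>2 + 1) * (1 - u))" by (subst v) (simp add: algebra_simps)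
    then have "2 * t / (t\<^sup>2 + 1) = v" using pos unfolding t2 by (simp add: divide_eq_eq)
    moreover have "(t\<^sup>2 - 1) / (t\<^sup>2 + 1) = u" using t2 pos by (simp add: divide_eq_eq algebra_simps)
    ultimately have "h t = c * (z / c)" by (simp add: h_def u_def v_def complex_eq_iff)
    then show ?thesis using c0 by (simp add: f_def t_def u_def v_def)
  qed
  have contf: "continuous_on P f"
    unfolding f_def using Re1 c0 by (intro continuous_intros) auto
  have injf: "inj_on f P" by (rule inj_on_inverseI[of _ h]) (rule hf)
  have comp: "compact E" using E(1,2) by (meson bounded_sphere bounded_subset
      compact_eq_bounded_closed)
  have "f ` E homeomorphic middle_third_cantor"
  proof (rule homeomorphic_middle_third_cantor)
    show "compact (f ` E)" using comp continuous_on_subset[OF contf EP] by (rule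
        compact_continuous_image[rotated])
    show "f ` E \<noteq> {}" using E by simp
  next
    fix x e :: real assume "x \<in> f ` E" and e: "0 < e"
    then obtain z where z: "z \<in> E" "x = f z" by blast
    obtain d where d: "0 < d" "\<forall>w\<in>P. dist w z < d \<longrightarrow> dist (f w) (f z) < e"
      using contf z EP e unfolding continuous_on_iff by blast
    obtain w where w: "w \<in> E" "w \<noteq> z" "dist w z < d" using perf[OF z(1) d(1)] by blast
    have "f w \<noteq> f z" using injf w z EP by (meson inj_on_def subsetD)
    then show "\<exists>y\<in>f ` E. y \<noteq> x \<and> \<bar>y - x\<bar> < e"
      using d(2) w z EP by (intro bexI[of _ "f w"]) (auto simp: dist_real_def)
  next
    fix a b :: real assume ab: "a < b"
    show "\<exists>x. a < x \<and> x < b \<and> x \<notin> f ` E"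
    proof (rule ccontr)
      assume neg: "\<not> ?thesis"
      define t where "t = (a + b) / 2"
      have "a < t" "t < b" using ab by (auto simp: t_def)
      then obtain z where z: "z \<in> E" "t = f z" using neg by blast
      have zP: "z \<in> P" using z EP by blast
      obtain d where d: "0 < d" "\<forall>w\<in>P. dist w z < d \<longrightarrow> dist (f w) (f z) < (b - a) / 2"
        using contf zP ab unfolding continuous_on_iff by (metis diff_gt_0_iff_gt half_gt_zero)
      have "0 < dist c z" using zP by (auto simp: P_def)
      \<comment> \<open>The bound \<open>dist c z\<close> keeps \<open>w\<close> away from the
        projection centre.\<close>
      then obtain w where w: "w \<in> sphere 0 1" "w \<notin> E" "dist w z < min d (dist c z)"
        using gap[of z "min d (dist c z)"] d zP by (auto simp: P_def)
      have "w \<in> P" using w by (auto simp: P_def)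
      then have "\<bar>f w - t\<bar> < (b - a) / 2" using d(2) w z by (simp add: dist_real_def)
      then have "a < f w" "f w < b" unfolding t_def by (simp_all add: abs_less_iff field_simps)
      then obtain w' where "w' \<in> E" "f w = f w'" using neg by blast
      then have "w = w'" using injf \<open>w \<in> P\<close> EP by (meson inj_on_def subsetD)
      then show False using w \<open>w' \<in> E\<close> by simp
    qed
  qed
  moreover have "E homeomorphic f ` E"
    using homeomorphic_compact[OF comp continuous_on_subset[OF contf EP] refl inj_on_subset[OF injf
        EP]] .
  ultimately show ?thesis unfolding cantor_set_def by (rule homeomorphic_trans[rotated])
qed

section \<open>End invariants and elliptic curves\<close>

text \<open>End invariants without sequences: one bound \<open>K\<close> serves all radii. Pairs are
  not normalised, so each curve occurs twice, which does not affect infiniteness.\<close>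

definition lim_set :: "(int \<Rightarrow> int \<Rightarrow> real) \<Rightarrow> complex set" where
  "lim_set g = {L \<in> PL. \<exists>K>0. \<forall>e>0.
     infinite {(a, b). coprime a b \<and> \<bar>g a b\<bar> < K \<and> dist (pl_pt (a, b)) L < e}}"

definition elliptic :: "(int \<Rightarrow> int \<Rightarrow> real) \<Rightarrow> (int \<times> int) set" where
  "elliptic g = {(a, b). coprime a b \<and> \<bar>g a b\<bar> < 2}"

lemma ess_curves_coprime: "(a, b) \<in> ess_curves \<Longrightarrow> coprime a b"
  by (simp add: ess_curves_def)

lemma ess_curves_cases:
  assumes "coprime a b"
  shows "(a, b) \<in> ess_curves \<or> (-a, -b) \<in> ess_curves"
proof -
  have "b = 1 \<or> b = -1" if "a = 0" using assms that by auto
  then show ?thesis using assms by (auto simp: ess_curves_def)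
qed

lemma ess_curves_minus: "(a, b) \<in> ess_curves \<Longrightarrow> (-a, -b) \<notin> ess_curves"
  by (auto simp: ess_curves_def)

lemma infinite_ess_curves_iff:
  assumes "\<And>a b. Q (-a) (-b) = Q a b"
  shows "infinite {(a, b). (a, b) \<in> ess_curves \<and> Q a b} \<longleftrightarrow> infinite {(a, b). coprime a b \<and> Q a b}"
    (is "infinite ?E \<longleftrightarrow> infinite ?C")
proof -
  have "?E \<subseteq> ?C" by (auto simp: ess_curves_def)
  moreover have "?C \<subseteq> ?E \<union> (\<lambda>(a, b). (-a, -b)) ` ?E"
  proof (rule subsetI)
    fix W assume "W \<in> ?C"
    then obtain a b where W: "W = (a, b)" and ab: "coprime a b" "Q a b" by blast
    show "W \<in> ?E \<union> (\<lambda>(a, b). (-a, -b)) ` ?E"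
    proof (cases "(a, b) \<in> ess_curves")
      case True
      then show ?thesis using W ab by simp
    next
      case False
      then have "(-a, -b) \<in> ?E" using ess_curves_cases[OF ab(1)] assms[of a b] ab by simp
      then have "(\<lambda>(a, b). (-a, -b)) (-a, -b) \<in> (\<lambda>(a, b). (-a, -b)) ` ?E" by (rule imageI)
      then show ?thesis using W by simp
    qed
  qed
  ultimately show ?thesis by (meson finite_UnI finite_imageI finite_subset)
qed

text \<open>Each choice has a larger code than the previous one, which makes the sequence
  injective.\<close>

lemma infinite_nested_sequence:
  fixes S :: "nat \<Rightarrow> ('a::countable) set"
  assumes "\<And>n. infinite (S n)"
  obtains f where "inj f" "\<And>n. f n \<in> S n"
proof -
  have ex: "\<exists>y\<in>S n. m < to_nat y" for n m
  proof (rule ccontr)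
    assume "\<not> ?thesis"
    then have "S n \<subseteq> to_nat -` {..m}" by (auto simp: not_less)
    moreover have "finite ((to_nat :: 'a \<Rightarrow> nat) -` {..m})" by (intro finite_vimageI) auto
    ultimately show False using assms finite_subset by blast
  qed
  have "\<exists>f. \<forall>n. f n \<in> S n \<and> to_nat (f n) < to_nat (f (Suc n))"
    by (rule dependent_nat_choice[where P = "\<lambda>n x. x \<in> S n" and Q = "\<lambda>n x y. to_nat x < to_nat y"])
      (use ex in \<open>blast, blast\<close>)
  then obtain f where f: "\<And>n. f n \<in> S n" "\<And>n. to_nat (f n) < to_nat (f (Suc n))" by blast
  have "strict_mono (\<lambda>n. to_nat (f n))" using f(2) by (simp add: strict_mono_Suc_iff)
  then have "inj f" by (metis (mono_tags, lifting) injI strict_mono_eq)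
  with f(1) show ?thesis using that by blast
qed

lemma ends_eq_lim_set:
  assumes AB: "A \<in> SL2C" "B \<in> SL2C" "real_char A B"
  shows "ends A B = lim_set (trace_fn A B)"
proof -
  let ?g = "trace_fn A B"
  have iff: "end_invariant A B L \<longleftrightarrow> L \<in> PL \<and> (\<exists>K>0. \<forall>e>0.
      infinite {(a, b). (a, b) \<in> ess_curves \<and> \<bar>?g a b\<bar> < K \<and> dist (pl_pt (a, b)) L < e})" for L
  proof -
    have tr: "cmod (trc A B (a, b)) = \<bar>?g a b\<bar>" if "(a, b) \<in> ess_curves" for a b
      using trc_eq_trace_fn[OF AB that] by simp
    have "(\<exists>Xs :: nat \<Rightarrow> int \<times> int. inj Xs \<and> range Xs \<subseteq> ess_curves \<and>
        (\<lambda>n. pl_pt (Xs n)) \<longlonglongrightarrow> L \<and> (\<forall>n. cmod (trc A B (Xs n)) < K)) \<longleftrightarrow>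
      (\<forall>e>0. infinite {(a, b). (a, b) \<in> ess_curves \<and> \<bar>?g a b\<bar> < K \<and> dist (pl_pt (a, b)) L < e})"
          for K
    proof
      assume "\<exists>Xs :: nat \<Rightarrow> int \<times> int. inj Xs \<and> range Xs \<subseteq> ess_curves \<and>
        (\<lambda>n. pl_pt (Xs n)) \<longlonglongrightarrow> L \<and> (\<forall>n. cmod (trc A B (Xs n)) < K)"
      then obtain Xs :: "nat \<Rightarrow> int \<times> int" where X: "inj Xs" "range Xs \<subseteq> ess_curves"
        "(\<lambda>n. pl_pt (Xs n)) \<longlonglongrightarrow> L" "\<And>n. cmod (trc A B (Xs n)) < K" by blast
      show "\<forall>e>0. infinite {(a, b). (a, b) \<in> ess_curves \<and> \<bar>?g a b\<bar> < K \<and> dist (pl_pt (a, b)) L < e}"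
      proof (intro allI impI)
        fix e :: real assume "0 < e"
        then obtain N where N: "\<And>n. N \<le> n \<Longrightarrow> dist (pl_pt (Xs n)) L < e"
          using X(3) unfolding lim_sequentially by blast
        have "Xs ` {N..} \<subseteq> {(a, b). (a, b) \<in> ess_curves \<and> \<bar>?g a b\<bar> < K \<and> dist (pl_pt (a, b)) L < e}"
        proof (rule image_subsetI)
          fix n assume n: "n \<in> {N..}"
          obtain a b where ab: "Xs n = (a, b)" by (cases "Xs n")
          have "(a, b) \<in> ess_curves" using X(2) unfolding ab[symmetric] by blast
          then show "Xs n \<in> {(a, b). (a, b) \<in> ess_curves \<and> \<bar>?g a b\<bar> < K \<and> dist (pl_pt (a,
              b)) L < e}"
            using X(4)[of n] N[of n] n tr[of a b] unfolding ab by simp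
        qed
        moreover have "infinite (Xs ` {N..})"
          using finite_imageD[OF _ inj_on_subset[OF X(1)], of "{N..}"] infinite_Ici by blast
        ultimately show "infinite {(a, b). (a, b) \<in> ess_curves \<and> \<bar>?g a b\<bar> < K \<and> dist (pl_pt (a,
            b)) L < e}"
          using finite_subset by blast
      qed
    next
      assume inf: "\<forall>e>0. infinite {(a, b). (a, b) \<in> ess_curves \<and> \<bar>?g a b\<bar> < K \<and> dist (pl_pt (a,
          b)) L < e}"
      define S where "S n = {(a, b). (a, b) \<in> ess_curves \<and> \<bar>?g a b\<bar> < K \<and> dist (pl_pt (a,
          b)) L < inverse (real (Suc n))}" for n
      have "infinite (S n)" for n using inf by (simp add: S_def)
      then obtain Xs where X: "inj Xs" "\<And>n. Xs n \<in> S n"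
          using infinite_nested_sequence[of S] by blast
      have X': "Xs n \<in> ess_curves \<and> cmod (trc A B (Xs n)) < K \<and>
          dist (pl_pt (Xs n)) L < inverse (real (Suc n))" for n
        using X(2)[of n] tr by (cases "Xs n") (auto simp: S_def)
      have "(\<lambda>n. dist (pl_pt (Xs n)) L) \<longlonglongrightarrow> 0"
        by (rule Lim_null_comparison[OF _ LIMSEQ_inverse_real_of_nat]) (use X' in \<open>auto intro!:
            always_eventually less_imp_le\<close>)
      then have "(\<lambda>n. pl_pt (Xs n)) \<longlonglongrightarrow> L" by (subst tendsto_dist_iff)
      then show "\<exists>Xs :: nat \<Rightarrow> int \<times> int. inj Xs \<and> range Xs \<subseteq> ess_curves \<and>
        (\<lambda>n. pl_pt (Xs n)) \<longlonglongrightarrow> L \<and> (\<forall>n. cmod (trc A B (Xs n)) < K)"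
        using X(1) X' by blast
    qed
    then show ?thesis by (simp add: end_invariant_def)
  qed
  have "infinite {(a, b). (a, b) \<in> ess_curves \<and> \<bar>?g a b\<bar> < K \<and> dist (pl_pt (a, b)) L < e} \<longleftrightarrow>
    infinite {(a, b). coprime a b \<and> \<bar>?g a b\<bar> < K \<and> dist (pl_pt (a, b)) L < e}" for K e L
    by (rule infinite_ess_curves_iff) (simp add: trace_fn_minus pl_pt_minus)
  then show ?thesis by (simp add: ends_def lim_set_def iff)
qed

lemma lim_set_tame:
  assumes "tame g"
  shows "lim_set g = {}"
proof -
  have "finite {(a, b). coprime a b \<and> \<bar>g a b\<bar> < K \<and> dist (pl_pt (a, b)) L < e}" for K L e
    by (rule finite_subset[of _ "{(a, b). coprime a b \<and>
        \<bar>g a b\<bar> < K}"]) (use assms in \<open>auto simp: tame_def\<close>)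
  then show ?thesis by (auto simp: lim_set_def intro!: exI[of _ 1])
qed

lemma infinite_sector_image:
  assumes det: "\<bar>p * s - q * r\<bar> = 1"
  shows "infinite ((\<lambda>n. (int n * p + r, int n * q + s)) ` {N..})"
proof -
  have "p \<noteq> 0 \<or> q \<noteq> 0" using det by auto
  then have "inj (\<lambda>n. (int n * p + r, int n * q + s))" by (auto intro!: injI)
  then show ?thesis
    using finite_imageD[OF _ inj_on_subset, of "\<lambda>n. (int n * p + r, int n * q + s)" "{N..}"
        UNIV] infinite_Ici[of N] by blast
qed

lemma farey_sector_small:
  assumes "L \<in> PL" "0 < e"
  shows "\<exists>p q r s. \<bar>p * s - q * r\<bar> = 1 \<and>
    (\<forall>a b. 0 \<le> a \<longrightarrow> 0 \<le> b \<longrightarrow> coprime a b \<longrightarrow> dist (pl_pt (a * p + b * r, a * q + b * s)) L < e)"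
proof -
  obtain I e' where I: "farey_cover L e I e'" using farey_nbhd[OF assms] by blast
  then obtain M where M: "M \<in> I" by (auto simp: farey_cover_def)
  obtain p q r s where "M = (p, q, r, s)" by (cases M)
  then have "\<bar>p * s - q * r\<bar> = 1 \<and>
    (\<forall>a b. 0 \<le> a \<longrightarrow> 0 \<le> b \<longrightarrow> coprime a b \<longrightarrow> dist (pl_pt (a * p + b * r, a * q + b * s)) L < e)"
    using I M unfolding farey_cover_def by fast
  then show ?thesis by blast
qed

lemma lim_set_bounded:
  assumes K: "\<And>a b. coprime a b \<Longrightarrow> \<bar>g a b\<bar> < K"
  shows "lim_set g = PL"
proof -
  have "0 < K" using K[of 1 1] by simp
  have "infinite {(a, b). coprime a b \<and> \<bar>g a b\<bar> < K \<and> dist (pl_pt (a, b)) L < e}" if L: "L \<in> PL"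
      and e: "0 < e" for L e
  proof -
    obtain p q r s :: int where det: "\<bar>p * s - q * r\<bar> = 1" and small:
      "\<forall>a b. 0 \<le> a \<longrightarrow> 0 \<le> b \<longrightarrow> coprime a b \<longrightarrow> dist (pl_pt (a * p + b * r, a * q + b * s)) L < e"
      using farey_sector_small[OF L e] by blast
    have "(\<lambda>n. (int n * p + r, int n * q + s)) ` {0..} \<subseteq> {(a, b). coprime a b \<and> \<bar>g a b\<bar> < K \<and>
        dist (pl_pt (a, b)) L < e}"
    proof (rule image_subsetI)
      fix n :: nat
      show "(int n * p + r, int n * q + s) \<in> {(a, b). coprime a b \<and> \<bar>g a b\<bar> < K \<and> dist (pl_pt (a,
          b)) L < e}"
        using coprime_rebase[OF det, of "int n" 1] small[rule_format, of "int n" 1] K by simp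
    qed
    then show ?thesis using infinite_sector_image[OF det] finite_subset by blast
  qed
  then show ?thesis using \<open>0 < K\<close> by (auto simp: lim_set_def)
qed

lemma neighbours_converge:
  assumes det: "\<bar>p * s - q * r\<bar> = 1" and e: "0 < e"
  shows "\<exists>N0. \<forall>N\<ge>N0. dist (pl_pt (int N * p + r, int N * q + s)) (pl_pt (p, q)) < e"
proof -
  obtain N0 where N0: "cmod (vec2 r s) + 2 / e < real N0" using reals_Archimedean2 by blast
  have "dist (pl_pt (int N * p + r, int N * q + s)) (pl_pt (p, q)) < e" if "N0 \<le> N" for N
  proof -
    have "cmod (vec2 r s) + 2 / e < real N" using N0 that by linarith
    from rational_sector_small[OF det this e, of 0 1] show ?thesis by (simp add: add.commute)
  qed
  then show ?thesis by blast
qed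

lemma basis_extension:
  fixes p q :: int
  assumes "coprime p q"
  obtains r s where "\<bar>p * s - q * r\<bar> = 1"
proof -
  obtain u v where "u * p + v * q = 1" using bezout_int[of p q] assms by auto
  then have "p * u - q * (- v) = 1" by (simp add: mult.commute)
  then show ?thesis using that[of u "- v"] by simp
qed

text \<open>The neighbours \<open>v + n u\<close> converge to u, and their traces are bounded
  because the invariant is a definite form. The bound on the square passes to the absolute value
  through \<open>2 \<bar>y\<bar> \<le> y^2 + 1\<close>, which explains the shape of
  \<open>K\<close>.\<close>

lemma elliptic_in_lim_set:
  assumes g: "markov \<mu> g" and pq: "(p, q) \<in> elliptic g"
  shows "pl_pt (p, q) \<in> lim_set g"
proof -
  have cop: "coprime p q" and x: "\<bar>g p q\<bar> < 2" using pq by (auto simp: elliptic_def)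
  obtain r s where det: "\<bar>p * s - q * r\<bar> = 1" using basis_extension[OF cop] .
  define h where "h = rebase g p q r s"
  have h: "markov \<mu> h" unfolding h_def by (rule markov_rebase[OF g det])
  have h10: "h 1 0 = g p q" by (simp add: h_def rebase_def)
  define c where "c = 1 - \<bar>g p q\<bar> / 2"
  have c: "0 < c" using x by (simp add: c_def)
  define K where "K = max 0 ((\<mu> - (g p q)\<^sup>2) / c) + 2"
  have bd: "\<bar>h (int n) 1\<bar> < K" for n
  proof -
    define y z where "y = h (int n) 1" and "z = h (int (Suc n)) 1"
    have "c * (y\<^sup>2 + z\<^sup>2) \<le> \<mu> - (g p q)\<^sup>2"
      using elliptic_form_bounds(1)[of "g p q" y z] chain_markov(2)[OF h,
          of n] by (simp add: c_def h10 y_def z_def)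
    then have "y\<^sup>2 + z\<^sup>2 \<le> (\<mu> - (g p q)\<^sup>2) / c" using c by (simp add: le_divide_eq mult.commute)
    then have "y\<^sup>2 \<le> (\<mu> - (g p q)\<^sup>2) / c" using zero_le_power2[of z] by linarith
    then have "y\<^sup>2 \<le> K - 2" unfolding K_def by linarith
    moreover have "0 \<le> (\<bar>y\<bar> - 1)\<^sup>2" by simp
    then have "2 * \<bar>y\<bar> \<le> y\<^sup>2 + 1" by (simp add: power2_eq_square algebra_simps)
    moreover have "0 \<le> \<bar>y\<bar>" by simp
    ultimately show ?thesis unfolding y_def[symmetric] by linarith
  qed
  have "infinite {(a, b). coprime a b \<and> \<bar>g a b\<bar> < K \<and> dist (pl_pt (a, b)) (pl_pt (p, q)) < e}"
      if e: "0 < e" for e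
  proof -
    obtain N0 where N0: "\<forall>N\<ge>N0. dist (pl_pt (int N * p + r, int N * q + s)) (pl_pt (p, q)) < e"
      using neighbours_converge[OF det e] by blast
    have "(\<lambda>n. (int n * p + r, int n * q + s)) ` {N0..} \<subseteq>
      {(a, b). coprime a b \<and> \<bar>g a b\<bar> < K \<and> dist (pl_pt (a, b)) (pl_pt (p, q)) < e}"
    proof (rule image_subsetI)
      fix n assume "n \<in> {N0..}"
      then show "(int n * p + r, int n * q + s) \<in>
          {(a, b). coprime a b \<and> \<bar>g a b\<bar> < K \<and> dist (pl_pt (a, b)) (pl_pt (p, q)) < e}"
        using coprime_rebase[OF det, of "int n" 1] N0 bd[of n] by (simp add: h_def rebase_def)
    qed
    then show ?thesis using infinite_sector_image[OF det] finite_subset by blast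
  qed
  moreover have "0 < K" by (simp add: K_def)
  ultimately show ?thesis using pl_pt_in_PL[OF cop] by (auto simp: lim_set_def)
qed

text \<open>Off the closure, small Farey cones near the point contain no elliptic curve, so each of
  them grows unless \<open>g\<close> is tame; the latter is impossible as an elliptic curve exists.
  Finitely many growing cones hold finitely many curves below any bound.\<close>

lemma lim_set_eq_closure:
  assumes g: "markov \<mu> g" and mu: "\<mu> \<noteq> 4" and ne: "elliptic g \<noteq> {}"
  shows "lim_set g = closure (pl_pt ` elliptic g)"
proof (intro equalityI subsetI)
  fix L assume L: "L \<in> lim_set g"
  then have PL: "L \<in> PL" by (simp add: lim_set_def)
  show "L \<in> closure (pl_pt ` elliptic g)"
  proof (rule ccontr)
    assume "L \<notin> closure (pl_pt ` elliptic g)"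
    then obtain e where e: "0 < e" "\<And>W. W \<in> elliptic g \<Longrightarrow> e \<le> dist (pl_pt W) L"
      unfolding closure_approachable by (meson image_eqI not_le)
    obtain I e' where cover: "farey_cover L e I e'" using farey_nbhd[OF PL e(1)] by blast
    then have I: "finite I" "0 < e'" "\<And>a b. coprime a b \<Longrightarrow> dist (pl_pt (a, b)) L < e' \<Longrightarrow>
        \<exists>M\<in>I. in_sector M a b"
      unfolding farey_cover_def by blast+
    have fin: "finite {(a, b). in_sector (p, q, r, s) a b \<and> \<bar>g a b\<bar> < K}" if M: "(p, q, r, s) \<in> I"
        for p q r s K
    proof -
      have det: "\<bar>p * s - q * r\<bar> = 1"
        and small: "\<And>a b. 0 \<le> a \<Longrightarrow> 0 \<le> b \<Longrightarrow> coprime a b \<Longrightarrow> dist (pl_pt (a * p + b * r,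
            a * q + b * s)) L < e"
        using cover M unfolding farey_cover_def by fast+
      define h where "h = rebase g p q r s"
      have h: "markov \<mu> h" unfolding h_def by (rule markov_rebase[OF g det])
      have "2 \<le> \<bar>h a b\<bar>" if "0 \<le> a" "0 \<le> b" "coprime a b" for a b
      proof (rule ccontr)
        assume "\<not> ?thesis"
        then have "(a * p + b * r, a * q + b * s) \<in> elliptic g"
          using coprime_rebase[OF det that(3)] by (simp add: elliptic_def h_def rebase_def)
        from e(2)[OF this] small[OF that] show False by simp
      qed
      then have "grows h \<or> tame h" by (rule grows_or_tame[OF h mu])
      moreover have "\<not> tame h"
        using tame_rebase[OF det, of g] ne by (fastforce simp: h_def elliptic_def tame_def)
      ultimately have "grows h" by blast
      from grows_finite[OF h this, of K]
      have f: "finite {(c, d). 0 \<le> c \<and> 0 \<le> d \<and> coprime c d \<and> \<bar>h c d\<bar> < K}" (is "finite ?F") .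
      have "{(a, b). in_sector (p, q, r, s) a b \<and> \<bar>g a b\<bar> < K} \<subseteq>
        (\<lambda>(c, d). (c * p + d * r, c * q + d * s)) ` ?F \<union> (\<lambda>(c, d). (- (c * p + d * r),
            - (c * q + d * s))) ` ?F"
      proof (rule subsetI)
        fix W assume "W \<in> {(a, b). in_sector (p, q, r, s) a b \<and> \<bar>g a b\<bar> < K}"
        then obtain a b where W: "W = (a, b)" and sec: "in_sector (p, q, r, s) a b"
            and K: "\<bar>g a b\<bar> < K" by blast
        from sec obtain c d where cd: "0 \<le> c" "0 \<le> d" "coprime c d"
          "(a = c * p + d * r \<and> b = c * q + d * s) \<or> (a = - (c * p + d * r) \<and> b =
              - (c * q + d * s))"
          by (auto simp: in_sector_def)
        have "h c d = g a b"
          using cd(4) markov_minus[OF g, of "c * p + d * r"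
              "c * q + d * s"] by (auto simp: h_def rebase_def)
        then have F: "(c, d) \<in> ?F" using cd K by simp
        from cd(4) show "W \<in> (\<lambda>(c, d). (c * p + d * r, c * q + d * s)) ` ?F \<union>
            (\<lambda>(c, d). (- (c * p + d * r), - (c * q + d * s))) ` ?F"
        proof
          assume "a = c * p + d * r \<and> b = c * q + d * s"
          then have "W = (\<lambda>(c, d). (c * p + d * r, c * q + d * s)) (c, d)" using W by simp
          then show ?thesis using F by blast
        next
          assume "a = - (c * p + d * r) \<and> b = - (c * q + d * s)"
          then have "W = (\<lambda>(c, d). (- (c * p + d * r), - (c * q + d * s))) (c, d)" using W by simp
          then show ?thesis using F by blast
        qed
      qed
      then show ?thesis by (rule finite_subset) (use f in simp)
    qed
    obtain K where "infinite {(a, b). coprime a b \<and> \<bar>g a b\<bar> < K \<and> dist (pl_pt (a, b)) L < e'}"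
      using L I(2) by (auto simp: lim_set_def)
    moreover have "{(a, b). coprime a b \<and> \<bar>g a b\<bar> < K \<and> dist (pl_pt (a, b)) L < e'} \<subseteq>
      (\<Union>M\<in>I. {(a, b). in_sector M a b \<and> \<bar>g a b\<bar> < K})"
      using I(3) by blast
    moreover have "finite (\<Union>M\<in>I. {(a, b). in_sector M a b \<and> \<bar>g a b\<bar> < K})"
    proof (rule finite_UN_I[OF I(1)])
      fix M assume "M \<in> I"
      then show "finite {(a, b). in_sector M a b \<and> \<bar>g a b\<bar> < K}" using fin by (cases M) blast
    qed
    ultimately show False using finite_subset by blast
  qed
next
  fix L assume L: "L \<in> closure (pl_pt ` elliptic g)"
  have sub: "pl_pt ` elliptic g \<subseteq> PL" using pl_pt_in_PL by (auto simp: elliptic_def)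
  have "closed PL" unfolding PL_def by (rule closed_sphere)
  then have PL: "L \<in> PL" using closure_minimal[OF sub] L by blast
  show "L \<in> lim_set g"
  proof (cases "L \<in> pl_pt ` elliptic g")
    case True
    then show ?thesis using elliptic_in_lim_set[OF g] by auto
  next
    case False
    then have lp: "L islimpt (pl_pt ` elliptic g)" using L by (simp add: closure_def)
    have "infinite {(a, b). coprime a b \<and> \<bar>g a b\<bar> < 2 \<and> dist (pl_pt (a, b)) L < e}" if "0 < e" for e
    proof
      assume fin: "finite {(a, b). coprime a b \<and> \<bar>g a b\<bar> < 2 \<and> dist (pl_pt (a, b)) L < e}"
      have "pl_pt ` elliptic g \<inter> ball L e \<subseteq>
        pl_pt ` {(a, b). coprime a b \<and> \<bar>g a b\<bar> < 2 \<and> dist (pl_pt (a, b)) L < e}"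
        by (auto simp: elliptic_def dist_commute)
      then have "finite (pl_pt ` elliptic g \<inter> ball L e)" using fin finite_subset by blast
      moreover have "infinite (pl_pt ` elliptic g \<inter> ball L e)"
        using lp that unfolding islimpt_eq_infinite_ball by blast
      ultimately show False by blast
    qed
    then show ?thesis using PL by (auto simp: lim_set_def intro!: exI[of _ 2])
  qed
qed

section \<open>Perfectness, gaps and realizations\<close>

text \<open>The sum vertex carries the product of the two values minus \<open>h 1 0\<close>. The
  product is at least twice the larger factor in size, and an elliptic correction of size below 2
  cannot undo the increase.\<close>

lemma grows_of_elliptic_between:
  assumes h: "markov \<mu> h" and x: "\<bar>h 1 0\<bar> < 2" and y: "2 \<le> \<bar>h n 1\<bar>" "2 \<le> \<bar>h (n + 1) 1\<bar>"
  shows "grows (rebase h n 1 (n + 1) 1)"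
proof -
  have "\<bar>n * 1 - 1 * (n + 1)\<bar> = 1" by simp
  from markov_sum[OF h this] have "h (2 * n + 1) 2 = h n 1 * h (n + 1) 1 - h (-1) 0"
    by (simp add: algebra_simps)
  then have z: "h (2 * n + 1) 2 = h n 1 * h (n + 1) 1 - h 1 0" using markov_minus[OF h,
      of 1 0] by simp
  have "2 * \<bar>h n 1\<bar> \<le> \<bar>h n 1 * h (n + 1) 1\<bar>" "2 * \<bar>h (n + 1) 1\<bar> \<le> \<bar>h n 1 * h (n + 1) 1\<bar>"
    using y mult_mono[of "\<bar>h n 1\<bar>" "\<bar>h n 1\<bar>" 2 "\<bar>h (n + 1) 1\<bar>"]
      mult_mono[of 2 "\<bar>h n 1\<bar>" "\<bar>h (n + 1) 1\<bar>" "\<bar>h (n + 1) 1\<bar>"] by (simp_all add: abs_mult)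
  then have "\<bar>h n 1\<bar> < \<bar>h (2 * n + 1) 2\<bar>" "\<bar>h (n + 1) 1\<bar> < \<bar>h (2 * n + 1) 2\<bar>"
    using x y unfolding z by linarith+
  moreover have "rebase h n 1 (n + 1) 1 1 0 = h n 1" "rebase h n 1 (n + 1) 1 0 1 = h (n + 1) 1"
    "rebase h n 1 (n + 1) 1 1 1 = h (2 * n + 1) 2"
    by (simp_all add: rebase_def algebra_simps)
  ultimately show ?thesis using y by (simp add: grows_def)
qed

text \<open>If every neighbour were hyperbolic, all cones between consecutive neighbours would grow,
  and these contain every curve other than (1,0) itself.\<close>

lemma elliptic_neighbour:
  assumes h: "markov \<mu> h" and x: "\<bar>h 1 0\<bar> < 2" and cd: "coprime c d" "d \<noteq> 0" "\<bar>h c d\<bar> < 2"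
  shows "\<exists>n. \<bar>h n 1\<bar> < 2"
proof -
  have pos: "\<exists>n. \<bar>h n 1\<bar> < 2" if cop: "coprime c d" and d: "0 < d" and lt: "\<bar>h c d\<bar> < 2" for c d
  proof (rule ccontr)
    assume "\<not> ?thesis"
    then have ge: "2 \<le> \<bar>h n 1\<bar>" for n by (simp add: not_less)
    \<comment> \<open>Division locates the cone: \<open>(c, d)\<close> has coordinates
      \<open>d - c mod d\<close> and \<open>c mod d\<close> in the basis \<open>(n, 1)\<close>,
      \<open>(n + 1, 1)\<close>.\<close>
    define n where "n = c div d"
    have det: "\<bar>n * 1 - 1 * (n + 1)\<bar> = 1" by simp
    obtain c' d' where c'd': "coprime c' d'" "c = c' * n + d' * (n + 1)" "d = c' * 1 + d' * 1"
      using rebase_coordinates[OF det cop] by metis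
    have "d' = c - d * n" using c'd' by (simp add: algebra_simps)
    then have d': "d' = c mod d" by (simp add: n_def minus_mult_div_eq_mod)
    have "0 \<le> c mod d" "c mod d < d" using d by simp_all
    then have nn: "0 \<le> d'" "0 \<le> c'" using d' c'd'(3) by linarith+
    have gr: "grows (rebase h n 1 (n + 1) 1)" by (rule grows_of_elliptic_between[OF h x ge ge])
    have "2 \<le> \<bar>rebase h n 1 (n + 1) 1 c' d'\<bar>"
      by (rule grows_ge_2[OF markov_rebase[OF h det] gr nn(2,1) c'd'(1)])
    also have "rebase h n 1 (n + 1) 1 c' d' = h c d" using c'd' by (simp add: rebase_def)
    finally show False using lt by simp
  qed
  show ?thesis
  proof (cases "0 < d")
    case True
    then show ?thesis using pos cd by blast
  next
    case False
    then show ?thesis using pos[of "-c" "-d"] cd markov_minus[OF h, of c d] by simp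
  qed
qed

lemma elliptic_not_isolated:
  assumes g: "markov \<mu> g" and pq: "(p, q) \<in> elliptic g"
    and ab: "(a, b) \<in> elliptic g" "(a, b) \<noteq> (p, q)" "(a, b) \<noteq> (-p, -q)" and e: "0 < e"
  shows "\<exists>W\<in>elliptic g. pl_pt W \<noteq> pl_pt (p, q) \<and> dist (pl_pt W) (pl_pt (p, q)) < e"
proof -
  have cop: "coprime p q" and x: "\<bar>g p q\<bar> < 2" using pq by (auto simp: elliptic_def)
  have cab: "coprime a b" and xab: "\<bar>g a b\<bar> < 2" using ab by (auto simp: elliptic_def)
  obtain r s where det: "\<bar>p * s - q * r\<bar> = 1" using basis_extension[OF cop] .
  define h where "h = rebase g p q r s"
  have h: "markov \<mu> h" unfolding h_def by (rule markov_rebase[OF g det])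
  have h10: "\<bar>h 1 0\<bar> < 2" using x by (simp add: h_def rebase_def)
  obtain c d where cd: "coprime c d" "a = c * p + d * r" "b = c * q + d * s"
    using rebase_coordinates[OF det cab] by metis
  have "d \<noteq> 0"
  proof
    assume "d = 0"
    then have "c = 1 \<or> c = -1" using cd(1) by auto
    then show False using ab(2,3) cd \<open>d = 0\<close> by auto
  qed
  moreover have "\<bar>h c d\<bar> < 2" using xab cd by (simp add: h_def rebase_def)
  ultimately obtain k where k: "\<bar>h k 1\<bar> < 2" using elliptic_neighbour[OF h h10 cd(1)] by blast
  define f where "f = rebase h 1 0 k 1"
  have f: "markov \<mu> f" unfolding f_def by (rule markov_rebase[OF h]) simp
  have fval: "f n 1 = g ((n + k) * p + r) ((n + k) * q + s)" for n
    by (simp add: f_def h_def rebase_def)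
  have f10: "\<bar>f 1 0\<bar> < 2" using h10 by (simp add: f_def rebase_def)
  have f0: "\<bar>f 0 1\<bar> < 2" using k by (simp add: f_def rebase_def)
  have det': "\<bar>p * (k * q + s) - q * (k * p + r)\<bar> = 1" using det by (simp add: algebra_simps)
  obtain N0 where N0: "\<forall>N\<ge>N0. dist (pl_pt (int N * p + (k * p + r),
      int N * q + (k * q + s))) (pl_pt (p, q)) < e"
    using neighbours_converge[OF det' e] by blast
  \<comment> \<open>Recurrence within \<open>2 - \<bar>f 0 1\<bar>\<close> of the elliptic value
    \<open>f 0 1\<close> keeps the returning value elliptic, at indices as late as convergence
    requires.\<close>
  obtain m where m: "N0 \<le> m" "\<bar>f (int m) 1 - f (int 0) 1\<bar> < 2 - \<bar>f 0 1\<bar>"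
    using chain_recurrent[OF chain_markov(1)[OF f] f10, of "2 - \<bar>f 0 1\<bar>" N0] f0 by auto
  define W where "W = (int m * p + (k * p + r), int m * q + (k * q + s))"
  have "\<bar>f (int m) 1\<bar> < 2" using m(2) by simp
  then have "W \<in> elliptic g"
    using coprime_rebase[OF det', of "int m" 1] fval[of "int m"]
    by (simp add: elliptic_def W_def algebra_simps)
  moreover have "dist (pl_pt W) (pl_pt (p, q)) < e" using N0 m(1) by (simp add: W_def)
  moreover have "pl_pt W \<noteq> pl_pt (p, q)"
  proof -
    have "vec2 p q \<noteq> 0" "of_int (int m) * vec2 p q + of_int 1 * vec2 (k * p + r) (k * q + s) \<noteq> 0"
      using vec2_nonzero[OF cop] vec2_nonzero[OF coprime_rebase[OF det', of "int m" 1]]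
      by (simp_all only: vec2_combination coprime_1_right simp_thms)
    then have "0 < dist (pl_pt (int m * p + 1 * (k * p + r),
        int m * q + 1 * (k * q + s))) (pl_pt (p, q))"
      by (subst dist_rational[OF det']) simp_all
    then show ?thesis by (auto simp: W_def)
  qed
  ultimately show ?thesis by blast
qed

lemma grows_ge_2_beyond:
  assumes h: "markov \<mu> h" and gr: "grows (rebase h 1 0 (int n) 1)" and "n \<le> N"
    and cd: "0 \<le> c" "0 \<le> d" "coprime c d"
  shows "2 \<le> \<bar>h (c + d * int N) d\<bar>"
proof -
  have "coprime (c + d * (int N - int n)) d"
    using coprime_rebase[of 1 1 0 "int N - int n" c d] cd(3) by simp
  moreover have "0 \<le> c + d * (int N - int n)" using cd \<open>n \<le> N\<close> by simp
  moreover have "markov \<mu> (rebase h 1 0 (int n) 1)" by (rule markov_rebase[OF h]) simp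
  ultimately have "2 \<le> \<bar>rebase h 1 0 (int n) 1 (c + d * (int N - int n)) d\<bar>"
    using grows_ge_2[OF _ gr] cd(2) by blast
  then show ?thesis by (simp add: rebase_def algebra_simps)
qed

text \<open>Growing cones exist on both sides of the curve. For \<open>N\<close> beyond both
  starting indices the two thin cones that fill a neighbourhood of the point lie inside
  them.\<close>

lemma hyperbolic_not_in_closure:
  assumes g: "markov \<mu> g" and mu: "\<mu> > 4" and cop: "coprime p q" and x: "2 \<le> \<bar>g p q\<bar>"
      and ne: "(g p q)\<^sup>2 \<noteq> \<mu>"
  shows "pl_pt (p, q) \<notin> closure (pl_pt ` elliptic g)"
proof -
  obtain r s where det: "\<bar>p * s - q * r\<bar> = 1" using basis_extension[OF cop] .
  then have det': "\<bar>p * (-s) - q * (-r)\<bar> = 1" by (simp add: abs_minus_commute)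
  have grow: "\<exists>n. grows (rebase (rebase g p q r s) 1 0 (int n) 1)" if "\<bar>p * s - q * r\<bar> = 1" for r s
    by (rule hyperbolic_neighbours_grow[OF markov_rebase[OF g that] mu]) (use x ne in \<open>simp_all add:
        rebase_def\<close>)
  obtain n n' where n: "grows (rebase (rebase g p q r s) 1 0 (int n) 1)"
    "grows (rebase (rebase g p q (-r) (-s)) 1 0 (int n') 1)"
    using grow[OF det] grow[OF det'] by blast
  define N where "N = max n n'"
  obtain e where e: "0 < e" "\<forall>a b. coprime a b \<longrightarrow> dist (pl_pt (a, b)) (pl_pt (p, q)) < e \<longrightarrow>
    in_sector (p, q, r + int N * p, s + int N * q) a b \<or> in_sector (p, q, - r + int N * p,
        - s + int N * q) a b"
    using rational_nbhd[OF det] by blast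
  have sec: "2 \<le> \<bar>g a b\<bar>" if det: "\<bar>p * s - q * r\<bar> = 1"
      and gr: "grows (rebase (rebase g p q r s) 1 0 (int k) 1)"
    and "k \<le> N" and i: "in_sector (p, q, r + int N * p, s + int N * q) a b" for r s k a b
  proof -
    obtain c d where cd: "0 \<le> c" "0 \<le> d" "coprime c d"
      "(a = c * p + d * (r + int N * p) \<and> b = c * q + d * (s + int N * q)) \<or>
       (a = - (c * p + d * (r + int N * p)) \<and> b = - (c * q + d * (s + int N * q)))"
      using i by (auto simp: in_sector_def)
    have "2 \<le> \<bar>rebase g p q r s (c + d * int N) d\<bar>"
      by (rule grows_ge_2_beyond[OF markov_rebase[OF g det] gr \<open>k \<le> N\<close> cd(1-3)])
    moreover have "rebase g p q r s (c + d * int N) d =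
        g (c * p + d * (r + int N * p)) (c * q + d * (s + int N * q))"
      by (simp add: rebase_def algebra_simps)
    ultimately show ?thesis
      using cd(4) markov_minus[OF g, of "c * p + d * (r + int N * p)"
          "c * q + d * (s + int N * q)"] by auto
  qed
  have "e \<le> dist (pl_pt W) (pl_pt (p, q))" if W: "W \<in> elliptic g" for W
  proof (rule ccontr)
    assume near: "\<not> ?thesis"
    obtain a b where ab: "W = (a, b)" by (cases W)
    then have "coprime a b" "\<bar>g a b\<bar> < 2" using W by (auto simp: elliptic_def)
    moreover have "2 \<le> \<bar>g a b\<bar>"
      using e(2)[rule_format, OF \<open>coprime a b\<close>] near sec[OF det n(1), of a b] sec[OF det' n(2),
          of a b]
      unfolding ab N_def by (auto simp: not_le)
    ultimately show False by simp
  qed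
  then have "\<not> dist y (pl_pt (p, q)) < e" if "y \<in> pl_pt ` elliptic g"
      for y using that by (auto simp: not_less)
  then show ?thesis using e(1) unfolding closure_approachable by blast
qed

section \<open>Realizing real characters by real or unitary matrices\<close>

text \<open>A quadratic in \<open>b\<close> with discriminant 16 times
  \<open>x^2 + y^2 + z^2 - x y z - 4\<close>, hence positive. It is nonnegative at its vertex if
  \<open>x^2 < 4\<close>, at a suitable point of a nonconstant line if \<open>x^2 = 4\<close>, and
  for large \<open>b\<close> of the right sign otherwise.\<close>

lemma exists_real_root:
  fixes x y z :: real
  assumes "x\<^sup>2 + y\<^sup>2 + z\<^sup>2 - x * y * z > 4"
  shows "\<exists>b. 0 \<le> (x\<^sup>2 - 4) * b\<^sup>2 + (4 * z - 2 * x * y) * b + (y\<^sup>2 - 4)"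
proof -
  define L where "L = 4 * z - 2 * x * y"
  have disc: "(2 * z - x * y)\<^sup>2 = (x\<^sup>2 - 4) * (y\<^sup>2 - 4) + 4 * (x\<^sup>2 + y\<^sup>2 + z\<^sup>2 - x * y * z - 4)"
    by (rule trace_discriminant) simp
  have Lsq: "L\<^sup>2 = 4 * (2 * z - x * y)\<^sup>2" by (simp add: L_def power2_eq_square algebra_simps)
  have Lgt: "4 * ((x\<^sup>2 - 4) * (y\<^sup>2 - 4)) < L\<^sup>2" unfolding Lsq disc using assms by simp
  consider "x\<^sup>2 < 4" | "x\<^sup>2 = 4" | "4 < x\<^sup>2" by linarith
  then have "\<exists>b. 0 \<le> (x\<^sup>2 - 4) * b\<^sup>2 + L * b + (y\<^sup>2 - 4)"
  proof cases
    case 1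
    define P where "P = 4 - x\<^sup>2"
    have P: "0 < P" using 1 by (simp add: P_def)
    have xP: "x\<^sup>2 - 4 = - P" by (simp add: P_def)
    have "- P * (L / (2 * P))\<^sup>2 + L * (L / (2 * P)) = L\<^sup>2 / (4 * P)"
      using P by (simp add: field_simps power2_eq_square)
    moreover have "4 - y\<^sup>2 \<le> L\<^sup>2 / (4 * P)" using Lgt P unfolding xP by (simp add: le_divide_eq
        algebra_simps)
    ultimately have "0 \<le> - P * (L / (2 * P))\<^sup>2 + L * (L / (2 * P)) + (y\<^sup>2 - 4)" by linarith
    then show ?thesis unfolding xP by blast
  next
    case 2
    then have "L \<noteq> 0" using Lgt by auto
    then have "0 \<le> (x\<^sup>2 - 4) * (4 / L)\<^sup>2 + L * (4 / L) + (y\<^sup>2 - 4)" using 2 by simp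
    then show ?thesis by blast
  next
    case 3
    define t where "t = 2 / sqrt (x\<^sup>2 - 4)"
    define b where "b = (if 0 \<le> L then t else - t)"
    have "0 \<le> t" using 3 by (simp add: t_def)
    then have "0 \<le> L * b" by (auto simp: b_def mult_nonpos_nonneg)
    moreover have "(x\<^sup>2 - 4) * b\<^sup>2 = 4" using 3 by (simp add: b_def t_def power_divide divide_eq_eq)
    ultimately have "0 \<le> (x\<^sup>2 - 4) * b\<^sup>2 + L * b + (y\<^sup>2 - 4)" using zero_le_power2[of y] by linarith
    then show ?thesis by blast
  qed
  then show ?thesis by (simp add: L_def)
qed

text \<open>\<open>A'\<close> is the companion matrix of \<open>t^2 - x t + 1\<close>. For
  \<open>B'\<close> with entries a, b, c, d the traces determine \<open>a\<close> and
  \<open>c\<close>; determinant 1 is then a quadratic equation for \<open>d\<close>, whose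
  discriminant \<open>D\<close> is the polynomial in \<open>b\<close> treated above.\<close>

lemma SL2R_realization:
  fixes x y z :: real
  assumes "x\<^sup>2 + y\<^sup>2 + z\<^sup>2 - x * y * z > 4"
  shows "\<exists>A' B'. A' \<in> SL2R \<and> B' \<in> SL2R \<and> char_of A' B' = (of_real x, of_real y, of_real z)"
proof -
  obtain b where b: "0 \<le> (x\<^sup>2 - 4) * b\<^sup>2 + (4 * z - 2 * x * y) * b + (y\<^sup>2 - 4)"
    using exists_real_root[OF assms] by blast
  define D where "D = (x\<^sup>2 - 4) * b\<^sup>2 + (4 * z - 2 * x * y) * b + (y\<^sup>2 - 4)"
  define d where "d = (y - x * b + sqrt D) / 2"
  define a where "a = y - d"
  define c where "c = b + x * d - z"
  have "2 * d - (y - x * b) = sqrt D" by (simp add: d_def field_simps)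
  then have "(2 * d - (y - x * b))\<^sup>2 = D" using b by (simp add: D_def)
  then have "4 * (a * d - b * c) = 4"
    unfolding D_def a_def c_def by (simp add: power2_eq_square algebra_simps)
  then have det: "a * d - b * c = 1" by simp
  have "complex_of_real a * of_real d - of_real b * of_real c = of_real (a * d - b * c)" by simp
  then have "M2 (of_real a) (of_real b) (of_real c) (of_real d) \<in> SL2R"
    unfolding det by (simp add: SL2R_def)
  moreover have "M2 0 (-1) 1 (of_real x) \<in> SL2R" by (simp add: SL2R_def)
  moreover have "char_of (M2 0 (-1) 1 (of_real x)) (M2 (of_real a) (of_real b) (of_real c) (of_real
      d))
      = (of_real x, of_real y, of_real z)"
  proof -
    have "- c + (b + x * d) = z" by (simp add: c_def)
    then have "complex_of_real z = - of_real c + (of_real b + of_real x * of_real d)"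
      by (metis of_real_add of_real_minus of_real_mult)
    then show ?thesis by (simp add: char_of_def a_def)
  qed
  ultimately show ?thesis by blast
qed

text \<open>Unit quaternions: \<open>A'\<close> is diagonal with entry \<open>x/2 + \<i> w\<close>,
  the real part of the first entry of \<open>B'\<close> gives \<open>y\<close>, and its imaginary
  part \<open>v\<close> is solved from \<open>z\<close>. The trace discriminant leaves room for a
  real \<open>u\<close> completing the norm to 1.\<close>

lemma SU2_realization:
  fixes x y z :: real
  assumes x: "\<bar>x\<bar> < 2" and mu: "x\<^sup>2 + y\<^sup>2 + z\<^sup>2 - x * y * z < 4"
  shows "\<exists>A' B'. A' \<in> SU2 \<and> B' \<in> SU2 \<and> char_of A' B' = (of_real x, of_real y, of_real z)"
proof -
  define w where "w = sqrt (1 - (x / 2)\<^sup>2)"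
  have x2: "x\<^sup>2 < 4" using x by (simp add: abs_less_2_iff)
  then have w2: "w\<^sup>2 = 1 - (x / 2)\<^sup>2" "0 < w" by (simp_all add: w_def power_divide)
  define v where "v = (x * y / 2 - z) / (2 * w)"
  have wv: "2 * (w * v) = x * y / 2 - z" using w2(2) by (simp add: v_def)
  have "(2 * z - x * y)\<^sup>2 < (4 - x\<^sup>2) * (4 - y\<^sup>2)"
    using trace_discriminant[of x y z, OF refl] mu by (simp add: algebra_simps)
  moreover have "(2 * z - x * y)\<^sup>2 = (4 * w * v)\<^sup>2"
  proof -
    have "2 * z - x * y = - (4 * w * v)" using wv by simp
    then show ?thesis by simp
  qed
  moreover have "(4 * w * v)\<^sup>2 = 4 * ((4 - x\<^sup>2) * v\<^sup>2)"
  proof -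
    have "(4 * w * v)\<^sup>2 = 16 * w\<^sup>2 * v\<^sup>2" by (simp add: power_mult_distrib)
    then show ?thesis unfolding w2 by (simp add: power_divide algebra_simps)
  qed
  ultimately have "(4 - x\<^sup>2) * (4 * v\<^sup>2) < (4 - x\<^sup>2) * (4 - y\<^sup>2)" by simp
  then have "4 * v\<^sup>2 < 4 - y\<^sup>2" using x2 by simp
  then have pv: "(y / 2)\<^sup>2 + v\<^sup>2 < 1" by (simp add: power_divide)
  define u where "u = sqrt (1 - (y / 2)\<^sup>2 - v\<^sup>2)"
  have u2: "u * u = 1 - (y / 2)\<^sup>2 - v\<^sup>2" using pv by (simp add: u_def)
  define p where "p = Complex (y / 2) v"
  define \<alpha> where "\<alpha> = Complex (x / 2) w"
  have \<alpha>: "\<alpha> * cnj \<alpha> = 1" using w2 by (simp add: \<alpha>_def complex_eq_iff power2_eq_square)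
  have p: "p * cnj p + of_real u * of_real u = 1" using u2 by (simp add: p_def complex_eq_iff
      power2_eq_square)
  have 1: "M2 \<alpha> 0 0 (cnj \<alpha>) \<in> SU2" using \<alpha> by (simp add: SU2_def mid_def mult.commute)
  have 2: "M2 p (- of_real u) (of_real u) (cnj p) \<in> SU2"
      using p by (simp add: SU2_def mid_def mult.commute add.commute)
  have "char_of (M2 \<alpha> 0 0 (cnj \<alpha>)) (M2 p (- of_real u) (of_real u) (cnj p)) = (of_real x, of_real y,
      of_real z)"
    using wv by (simp add: char_of_def \<alpha>_def p_def complex_eq_iff algebra_simps)
  with 1 2 show ?thesis by blast
qed

text \<open>The second conclusion has two uses: its curve is the witness required in case (c), and
  its point shows that the end invariants do not fill the circle.\<close>

lemma lim_set_cantor: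
  assumes g: "markov \<mu> g" and mu: "\<mu> > 4"
    and W: "W1 \<in> elliptic g" "W2 \<in> elliptic g" "W1 \<in> ess_curves" "W2 \<in> ess_curves" "W1 \<noteq> W2"
    and nd: "\<not> dihedral_triple (g 1 0) (g 0 1) (g 1 1)"
  shows "cantor_set (lim_set g)"
    and "\<exists>a b. coprime a b \<and> 2 \<le> \<bar>g a b\<bar> \<and> (g a b)\<^sup>2 \<noteq> \<mu> \<and> pl_pt (a, b) \<notin> lim_set g"
proof -
  have ne: "elliptic g \<noteq> {}" and mu4: "\<mu> \<noteq> 4" using W(1) mu by auto
  note eq = lim_set_eq_closure[OF g mu4 ne]
  have gap: "\<exists>a b. 0 \<le> a \<and> 0 \<le> b \<and> coprime a b \<and> 2 \<le> \<bar>h a b\<bar> \<and> (h a b)\<^sup>2 \<noteq> \<mu>"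
    if det: "\<bar>p * s - q * r\<bar> = 1" and h: "h = rebase g p q r s" for p q r s h
  proof (rule ccontr)
    assume neg: "\<not> ?thesis"
    have S: "\<bar>h a b\<bar> < 2 \<or> (h a b)\<^sup>2 = \<mu>" if "0 \<le> a" "0 \<le> b" "coprime a b" for a b
      using neg that by (cases "\<bar>h a b\<bar> < 2") (simp_all add: not_less)
    have hm: "markov \<mu> h" unfolding h by (rule markov_rebase[OF g det])
    have val: "g a b = 0 \<or> (g a b)\<^sup>2 = \<mu>" if cop: "coprime a b" for a b
    proof -
      obtain c d where "coprime c d" "a = c * p + d * r" "b = c * q + d * s"
        using rebase_coordinates[OF det cop] by metis
      then show ?thesis using sector_dihedral[OF hm mu S, of c d] by (simp add: h rebase_def)
    qed
    have "dihedral_triple (g 1 0) (g 0 1) (g 1 1)"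
      using dihedral_triple_of_values[OF _ mu val val val] markov_vertex[OF g, of 1 1 0 0] by simp
    with nd show False by simp
  qed
  have sub: "pl_pt ` elliptic g \<subseteq> PL" using pl_pt_in_PL by (auto simp: elliptic_def)
  have "\<exists>a b. 0 \<le> a \<and> 0 \<le> b \<and> coprime a b \<and> 2 \<le> \<bar>g a b\<bar> \<and> (g a b)\<^sup>2 \<noteq> \<mu>"
  proof (rule gap)
    show "\<bar>1 * 1 - 0 * 0 :: int\<bar> = 1" by simp
    show "g = rebase g 1 0 0 1" by (intro ext) (simp add: rebase_def)
  qed
  then show "\<exists>a b. coprime a b \<and> 2 \<le> \<bar>g a b\<bar> \<and> (g a b)\<^sup>2 \<noteq> \<mu> \<and> pl_pt (a, b) \<notin> lim_set g"
    unfolding eq using hyperbolic_not_in_closure[OF g mu] by blast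
  have dense: "\<exists>W\<in>elliptic g. pl_pt W \<noteq> pl_pt V \<and> dist (pl_pt W) (pl_pt V) < e"
    if V: "V \<in> elliptic g" and e: "0 < e" for V e
  proof -
    obtain p q where pq: "V = (p, q)" by (cases V)
    \<comment> \<open>Only one of a vector and its negative is normalised, so at least one of
      \<open>W1\<close>, \<open>W2\<close> differs from \<open>V\<close> even up to sign.\<close>
    have "\<not> ((p, q) \<in> ess_curves \<and> (-p, -q) \<in> ess_curves)" using ess_curves_minus[of p q] by blast
    then have "(W1 \<noteq> (p, q) \<and> W1 \<noteq> (-p, -q)) \<or> (W2 \<noteq> (p, q) \<and> W2 \<noteq> (-p, -q))"
      using W(3-5) by blast
    then obtain W where "W \<in> elliptic g" "W \<noteq> (p, q)" "W \<noteq> (-p, -q)" using W(1,2) by blast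
    moreover obtain a b where "W = (a, b)" by (cases W)
    ultimately show ?thesis
      using elliptic_not_isolated[OF g V[unfolded pq] _ _ _ e, of a b] by (simp add: pq)
  qed
  show "cantor_set (lim_set g)"
    unfolding eq
  proof (rule cantor_set_in_circle)
    show "closed (closure (pl_pt ` elliptic g))" by simp
    show "closure (pl_pt ` elliptic g) \<subseteq> sphere 0 1"
      using closure_minimal[OF sub] by (simp add: PL_def)
    show "closure (pl_pt ` elliptic g) \<noteq> {}" using W(1) by auto
  next
    fix z e assume z: "z \<in> closure (pl_pt ` elliptic g)" and e: "(0::real) < e"
    show "\<exists>w\<in>closure (pl_pt ` elliptic g). w \<noteq> z \<and> dist w z < e"
    proof (cases "z \<in> pl_pt ` elliptic g")
      case True
      then obtain V where V: "V \<in> elliptic g" "z = pl_pt V" by blast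
      from dense[OF V(1) e] obtain W where W: "W \<in> elliptic g" "pl_pt W \<noteq> z" "dist (pl_pt W) z < e"
        unfolding V(2) by (elim bexE conjE)
      have "pl_pt W \<in> closure (pl_pt ` elliptic g)" using imageI[OF W(1)] closure_subset by (rule
          rev_subsetD)
      then show ?thesis using W(2,3) by (intro bexI[of _ "pl_pt W"]) auto
    next
      case False
      obtain w where w: "w \<in> pl_pt ` elliptic g" "dist w z < e"
        using z[unfolded closure_approachable] e by (elim allE[of _ e]) auto
      have "w \<in> closure (pl_pt ` elliptic g)" using w(1) closure_subset by (rule rev_subsetD)
      moreover have "w \<noteq> z" using False w(1) by metis
      ultimately show ?thesis using w(2) by (intro bexI[of _ w]) auto
    qed
  next
    fix z e assume z: "z \<in> sphere (0::complex) 1" and e: "(0::real) < e"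
    have "z \<in> PL" using z by (simp add: PL_def)
    from farey_sector_small[OF this e] obtain p q r s :: int where det: "\<bar>p * s - q * r\<bar> = 1"
        and small:
      "\<forall>a b. 0 \<le> a \<longrightarrow> 0 \<le> b \<longrightarrow> coprime a b \<longrightarrow> dist (pl_pt (a * p + b * r, a * q + b * s)) z < e"
      by blast
    obtain a b where ab: "0 \<le> a" "0 \<le> b" "coprime a b" "2 \<le> \<bar>rebase g p q r s a b\<bar>"
        "(rebase g p q r s a b)\<^sup>2 \<noteq> \<mu>"
      using gap[OF det refl] by blast
    have "pl_pt (a * p + b * r, a * q + b * s) \<notin> closure (pl_pt ` elliptic g)"
      by (rule hyperbolic_not_in_closure[OF g mu coprime_rebase[OF det ab(3)]]) (use ab in \<open>simp_all
          add: rebase_def\<close>)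
    moreover have "pl_pt (a * p + b * r, a * q + b * s) \<in> sphere 0 1"
      using pl_pt_in_PL[OF coprime_rebase[OF det ab(3)]] by (simp add: PL_def)
    moreover have "dist (pl_pt (a * p + b * r, a * q + b * s)) z < e" using small ab(1-3) by simp
    ultimately show "\<exists>w\<in>sphere 0 1. w \<notin> closure (pl_pt ` elliptic g) \<and> dist w z < e" by blast
  qed
qed

text \<open>Every neighbour of the lone elliptic curve is hyperbolic, so the invariant
  \<open>\<mu> - g(p, q)^2\<close> of its chain is at least 8.\<close>

lemma mu_ge_8_of_single_elliptic:
  assumes g: "markov \<mu> g" and pq: "(p, q) \<in> elliptic g"
    and single: "\<And>a b. (a, b) \<in> elliptic g \<Longrightarrow> (a, b) = (p, q) \<or> (a, b) = (-p, -q)"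
  shows "8 \<le> \<mu>"
proof -
  have cop: "coprime p q" and x: "\<bar>g p q\<bar> < 2" using pq by (auto simp: elliptic_def)
  obtain r s where det: "\<bar>p * s - q * r\<bar> = 1" using basis_extension[OF cop] .
  define h where "h = rebase g p q r s"
  have h: "markov \<mu> h" unfolding h_def by (rule markov_rebase[OF g det])
  have h10: "\<bar>h 1 0\<bar> < 2" using x by (simp add: h_def rebase_def)
  have ge: "2 \<le> \<bar>h (int n) 1\<bar>" for n
  proof (rule ccontr)
    assume "\<not> ?thesis"
    then have "(int n * p + r, int n * q + s) \<in> elliptic g"
      using coprime_rebase[OF det, of "int n" 1] by (simp add: elliptic_def h_def rebase_def)
    from single[OF this] have "p * (int n * q + s) = q * (int n * p + r)" by auto
    then have "p * s - q * r = 0" by (simp add: algebra_simps)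
    then show False using det by simp
  qed
  have "8 \<le> (h (int 0) 1)\<^sup>2 + (h (int 1) 1)\<^sup>2 - h 1 0 * h (int 0) 1 * h (int 1) 1"
    by (rule chain_invariant_ge_8[OF chain_markov(1)[OF h] h10 ge])
  also have "\<dots> = \<mu> - (h 1 0)\<^sup>2" using chain_markov(2)[OF h, of 0] by simp
  finally show ?thesis using zero_le_power2[of "h 1 0"] by linarith
qed

theorem theorem1p4:
  fixes A B :: m2 and \<kappa> :: real
  assumes "A \<in> SL2C" and "B \<in> SL2C"
    and "real_char A B"
    and "comm_tr A B = complex_of_real \<kappa>"
    and "\<kappa> \<noteq> 2"
  shows "exactly_one [case_a A B, case_b A B, case_c A B \<kappa>, case_d A B]
    \<and> (case_a A B \<longrightarrow> \<kappa> < 2 \<or> \<kappa> \<ge> 18)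
    \<and> (case_b A B \<longrightarrow> \<kappa> \<ge> 6)
    \<and> (case_c A B \<kappa> \<longrightarrow> \<kappa> > 2)
    \<and> (case_d A B \<longrightarrow> (-2 \<le> \<kappa> \<and> \<kappa> < 2) \<or> \<kappa> > 2)"
proof -
  define g where "g = trace_fn A B"
  define \<mu> where "\<mu> = \<kappa> + 2"
  have g: "markov \<mu> g" unfolding g_def \<mu>_def by (rule markov_trace_fn[OF assms(1-4)])
  have mu: "\<mu> \<noteq> 4" using assms(5) by (simp add: \<mu>_def)
  have ends: "ends A B = lim_set g" unfolding g_def by (rule ends_eq_lim_set[OF assms(1-3)])
  have trc: "trc A B (a, b) = of_real (g a b)" if "(a, b) \<in> ess_curves" for a b
    unfolding g_def by (rule trc_eq_trace_fn[OF assms(1-3) that])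
  have in2: "in_m2_2 (of_real t) \<longleftrightarrow> \<bar>t\<bar> < 2" for t :: real
    by (auto simp: in_m2_2_def abs_less_iff)
  have ell: "in_m2_2 (trc A B W) \<longleftrightarrow> W \<in> elliptic g" if "W \<in> ess_curves" for W
    using that ess_curves_coprime by (cases W) (auto simp: trc in2 elliptic_def)
  have sym: "(-a, -b) \<in> elliptic g \<longleftrightarrow> (a, b) \<in> elliptic g" for a b
    by (simp add: elliptic_def markov_minus[OF g])
  have e12: "(1, 0) \<in> ess_curves" "(0, 1) \<in> ess_curves" by (simp_all add: ess_curves_def)
  define x y z where "x = g 1 0" and "y = g 0 1" and "z = g 1 1"
  have v: "x\<^sup>2 + y\<^sup>2 + z\<^sup>2 - x * y * z = \<mu>"
    using markov_vertex[OF g, of 1 1 0 0] by (simp add: x_def y_def z_def)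
  have xyz: "mtr A = of_real x" "mtr B = of_real y" "mtr (mmul A B) = of_real z"
    using assms(3) trace_fn_basis[OF assms(1-3)] by (auto simp: x_def y_def z_def g_def
        real_char_def)
  have dih: "dihedral A B \<longleftrightarrow> dihedral_triple x y z"
    by (simp add: dihedral_def dihedral_triple_def xyz)
  have char: "char_of A B = (of_real x, of_real y, of_real z)" by (simp add: char_of_def xyz)
  have PLne: "PL \<noteq> {}" "PL \<noteq> {w}" for w
  proof -
    have "1 \<in> PL" "-1 \<in> PL" by (simp_all add: PL_def)
    moreover have "(1 :: complex) \<noteq> -1" by simp
    ultimately show "PL \<noteq> {}" "PL \<noteq> {w}" by (blast, metis singletonD)
  qed
  have a_none: "elliptic g = {}" if "case_a A B"
  proof -
    have "(a, b) \<notin> elliptic g" if "(a, b) \<in> ess_curves" for a b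
      using \<open>case_a A B\<close> ell[OF that] that by (auto simp: case_a_def ext_BQ_def)
    then have "(a, b) \<notin> elliptic g" for a b
      using ess_curves_cases[of a b] sym[of a b] by (auto simp: elliptic_def)
    then show ?thesis by auto
  qed
  \<comment> \<open>The number of elliptic curves decides the case: none gives (a), all (for
    \<open>\<mu> < 4\<close>) gives (d). For \<open>\<mu> > 4\<close> a single one gives (b), and
    several give (d) or (c) according to whether the character is dihedral.\<close>
  consider (none) "elliptic g = {}" | (small) "elliptic g \<noteq> {}" "\<mu> < 4" | (large) "elliptic g \<noteq> {}"
      "4 < \<mu>"
    using mu by linarith
  then show ?thesis
  proof cases
    case none
    have ge: "2 \<le> \<bar>g a b\<bar>" if "coprime a b" for a b
      using none that by (force simp: elliptic_def)
    have tame: "tame g" by (rule tame_of_no_elliptic[OF g mu ge])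
    have E: "ends A B = {}" unfolding ends by (rule lim_set_tame[OF tame])
    have "finite {W \<in> ess_curves. cmod (trc A B W) \<le> 2}"
    proof (rule finite_subset)
      show "{W \<in> ess_curves. cmod (trc A B W) \<le> 2} \<subseteq> {(a, b). coprime a b \<and> \<bar>g a b\<bar> < 3}"
        using trc ess_curves_coprime by auto
      show "finite {(a, b). coprime a b \<and> \<bar>g a b\<bar> < 3}" using tame by (simp add: tame_def)
    qed
    then have "case_a A B" using E none ell by (simp add: case_a_def ext_BQ_def)
    moreover have "\<not> case_b A B" "\<not> case_c A B \<kappa>" "\<not> case_d A B"
      using none ell E PLne by (auto simp: case_b_def case_c_def case_d_def)
    moreover have "\<kappa> < 2 \<or> \<kappa> \<ge> 18"
      using mu_ge_20_of_no_elliptic[OF g _ ge] mu by (fastforce simp: \<mu>_def)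
    ultimately show ?thesis by (simp add: exactly_one_def)
  next
    case small
    obtain a0 b0 where "coprime a0 b0" "\<bar>g a0 b0\<bar> < 2" using small(1) by (auto simp: elliptic_def)
    then have "\<not> 2 < \<bar>g a0 b0\<bar>" "coprime a0 b0" by simp_all
    then have all: "\<bar>g a b\<bar> < 2" if "coprime a b" for a b
      using small_mu_dichotomy[OF g small(2)] that by blast
    have E: "ends A B = PL" unfolding ends by (rule lim_set_bounded[OF all])
    have ell_all: "W \<in> elliptic g" if "W \<in> ess_curves" for W
    proof -
      obtain a b where ab: "W = (a, b)" by (cases W)
      then have "coprime a b" using that ess_curves_coprime by simp
      then show ?thesis using all unfolding ab elliptic_def by simp
    qed
    have in_all: "in_m2_2 (trc A B W)" if "W \<in> ess_curves" for W
      using ell[OF that] ell_all[OF that] by simp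
    have abs: "\<bar>x\<bar> < 2" using all by (simp add: x_def)
    have "SU2_char A B" unfolding SU2_char_def char
      by (rule SU2_realization[OF abs]) (use v small(2) in linarith)
    then have "case_d A B" using E by (simp add: case_d_def)
    moreover have "\<not> case_a A B" using a_none small(1) by blast
    moreover have "\<not> case_b A B"
    proof
      assume "case_b A B"
      then obtain Xh where Xh: "\<forall>W\<in>ess_curves - {Xh}. \<not> in_m2_2 (trc A B W)"
          unfolding case_b_def by (elim bexE conjE)
      have "W = Xh" if "W \<in> ess_curves" for W using Xh in_all[OF that] that by blast
      from trans[OF this[OF e12(1)] this[OF e12(2), symmetric]] show False by simp
    qed
    moreover have "\<not> case_c A B \<kappa>"
    proof
      assume "case_c A B \<kappa>"
      then obtain Y where "Y \<in> ess_curves" "\<not> in_m2_2 (trc A B Y)"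
          unfolding case_c_def by (elim conjE bexE)
      then show False using in_all by simp
    qed
    moreover have "-2 \<le> \<kappa> \<and> \<kappa> < 2"
    proof -
      \<comment> \<open>With \<open>\<bar>x\<bar> < 2\<close> the product \<open>x y z\<close> is at
        most \<open>2 \<bar>y z\<bar> \<le> y^2 + z^2\<close>, whence
        \<open>\<mu> \<ge> x^2 \<ge> 0\<close>, that is \<open>\<kappa> \<ge> -2\<close>.\<close>
      have "2 * \<bar>y * z\<bar> \<le> y\<^sup>2 + z\<^sup>2"
        using sum_squares_bound[of "\<bar>y\<bar>" "\<bar>z\<bar>"] by (simp add: abs_mult mult.assoc)
      moreover have "\<bar>x\<bar> * \<bar>y * z\<bar> \<le> 2 * \<bar>y * z\<bar>" using abs by (intro mult_right_mono) auto
      moreover have "x * y * z \<le> \<bar>x\<bar> * \<bar>y * z\<bar>"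
        using abs_ge_self[of "x * (y * z)"] by (simp add: abs_mult mult.assoc)
      ultimately have "x * y * z \<le> y\<^sup>2 + z\<^sup>2" by linarith
      then have "0 \<le> \<mu>" using v zero_le_power2[of x] by linarith
      then show ?thesis using small(2) by (simp add: \<mu>_def)
    qed
    ultimately show ?thesis by (simp add: exactly_one_def)
  next
    case large
    have k2: "2 < \<kappa>" using large(2) by (simp add: \<mu>_def)
    have na: "\<not> case_a A B" using a_none large(1) by blast
    have SL: "SL2R_char A B" unfolding SL2R_char_def char
      by (rule SL2R_realization) (use v large in simp)
    have E: "ends A B = closure (pl_pt ` elliptic g)" unfolding ends by (rule lim_set_eq_closure[OF
        g mu large(1)])
    obtain W1 where W1: "W1 \<in> ess_curves" "W1 \<in> elliptic g"
    proof -
      obtain a b where ab: "(a, b) \<in> elliptic g" using large(1) by (metis ex_in_conv surj_pair)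
      then have "coprime a b" by (simp add: elliptic_def)
      from ess_curves_cases[OF this] show ?thesis using that ab sym[of a b] by blast
    qed
    show ?thesis
    proof (cases "\<exists>W2\<in>ess_curves. W2 \<in> elliptic g \<and> W2 \<noteq> W1")
      case False
      obtain p q where pq: "W1 = (p, q)" by (cases W1)
      have single: "(a, b) = (p, q) \<or> (a, b) = (-p, -q)" if ab: "(a, b) \<in> elliptic g" for a b
      proof -
        have "coprime a b" using ab by (simp add: elliptic_def)
        from ess_curves_cases[OF this] show ?thesis
        proof
          assume "(a, b) \<in> ess_curves"
          then show ?thesis using False ab pq by blast
        next
          assume "(-a, -b) \<in> ess_curves"
          moreover have "(-a, -b) \<in> elliptic g" using ab sym by blast
          ultimately have "(-a, -b) = (p, q)" using False pq by blast
          then show ?thesis by auto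
        qed
      qed
      have "pl_pt ` elliptic g = {pl_pt W1}"
        using single W1 pl_pt_minus[of p q] unfolding pq by force
      then have Eb: "ends A B = {pl_pt W1}" using E by simp
      have others: "\<forall>W\<in>ess_curves - {W1}. \<not> in_m2_2 (trc A B W)" using False ell by blast
      have "case_b A B" unfolding case_b_def using W1 Eb SL ell others by blast
      moreover have "\<not> case_c A B \<kappa>" unfolding case_c_def using False ell by blast
      moreover have "\<not> case_d A B" using Eb PLne by (auto simp: case_d_def)
      moreover have "6 \<le> \<kappa>"
        using mu_ge_8_of_single_elliptic[OF g W1(2)[unfolded pq] single] by (simp add: \<mu>_def)
      ultimately show ?thesis using na by (simp add: exactly_one_def)
    next
      case True
      then obtain W2 where W2: "W2 \<in> ess_curves" "W2 \<in> elliptic g" "W2 \<noteq> W1" by blast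
      have nb: "\<not> case_b A B" unfolding case_b_def using W1 W2 ell by blast
      show ?thesis
      proof (cases "dihedral A B")
        case True
        have val: "g a b = 0 \<or> (g a b)\<^sup>2 = \<mu>" if "coprime a b" for a b
          using dihedral_values[OF g _ that] True dih by (simp add: x_def y_def z_def)
        \<comment> \<open>Dihedral values have square at most \<open>\<mu>\<close>, so all traces
          share one bound; \<open>2 \<bar>t\<bar> \<le> t^2 + 1\<close> avoids square roots.\<close>
        have "\<bar>g a b\<bar> < \<mu> + 1" if "coprime a b" for a b
        proof -
          have "(g a b)\<^sup>2 \<le> \<mu>" using val[OF that] large(2) by auto
          moreover have "0 \<le> (\<bar>g a b\<bar> - 1)\<^sup>2" by simp
          then have "2 * \<bar>g a b\<bar> \<le> (g a b)\<^sup>2 + 1" by (simp add: power2_eq_square algebra_simps)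
          ultimately show ?thesis using large(2) by linarith
        qed
        then have "ends A B = PL" unfolding ends by (rule lim_set_bounded)
        then have "case_d A B" using True by (simp add: case_d_def)
        moreover have "\<not> case_c A B \<kappa>"
        proof
          assume "case_c A B \<kappa>"
          then obtain Y where Y: "Y \<in> ess_curves" "\<not> in_m2_2 (trc A B Y)"
              "(trc A B Y)\<^sup>2 \<noteq> of_real (\<kappa> + 2)"
            unfolding case_c_def by blast
          obtain a b where ab: "Y = (a, b)" by (cases Y)
          have Yab: "trc A B Y = of_real (g a b)" using trc Y(1) unfolding ab by blast
          have "g a b \<noteq> 0" using Y(2) in2[of "g a b"] unfolding Yab by auto
          then have "(g a b)\<^sup>2 = \<kappa> + 2" using val[of a b] Y(1) ess_curves_coprime unfolding ab \<mu>_def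
              by blast
          then have "(trc A B Y)\<^sup>2 = of_real (\<kappa> + 2)" unfolding Yab by (metis of_real_power)
          with Y(3) show False by simp
        qed
        ultimately show ?thesis using na nb k2 by (simp add: exactly_one_def)
      next
        case False
        then have nd: "\<not> dihedral_triple (g 1 0) (g 0 1) (g 1 1)"
            using dih by (simp add: x_def y_def z_def)
        note C = lim_set_cantor[OF g large(2) W1(2) W2(2) W1(1) W2(1) W2(3)[symmetric] nd]
        obtain a b where ab: "coprime a b" "2 \<le> \<bar>g a b\<bar>" "(g a b)\<^sup>2 \<noteq> \<mu>" "pl_pt (a, b) \<notin> lim_set g"
          using C(2) by blast
        \<comment> \<open>Case (d) is refuted through its set of end invariants, so no statement
          about unitary representations is required here.\<close>
        have "ends A B \<noteq> PL" unfolding ends using ab(4) pl_pt_in_PL[OF ab(1)] by blast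
        then have nd: "\<not> case_d A B" by (simp add: case_d_def)
        have yes: "\<exists>Y\<in>ess_curves. \<not> in_m2_2 (trc A B Y) \<and> (trc A B Y)\<^sup>2 \<noteq> complex_of_real (\<kappa> + 2)"
        proof -
          have *: ?thesis if i: "(c, d) \<in> ess_curves" and eq: "g c d = g a b" for c d
          proof (rule bexI[OF _ i])
            have t: "trc A B (c, d) = of_real (g a b)" using trc[OF i] eq by simp
            have "(of_real (g a b) :: complex)\<^sup>2 = of_real ((g a b)\<^sup>2)" by simp
            then have "(of_real (g a b) :: complex)\<^sup>2 \<noteq> of_real (\<kappa> + 2)"
              using ab(3) unfolding \<mu>_def by (metis of_real_eq_iff)
            then show "\<not> in_m2_2 (trc A B (c, d)) \<and> (trc A B (c, d))\<^sup>2 \<noteq> complex_of_real (\<kappa> + 2)"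
              using ab(2) unfolding t in2 by simp
          qed
          show ?thesis
            using ess_curves_cases[OF ab(1)] *[of a b] *[of "-a" "-b"] markov_minus[OF g,
                of a b] by blast
        qed
        have two: "\<exists>X1\<in>ess_curves. \<exists>X2\<in>ess_curves. X1 \<noteq> X2 \<and> in_m2_2 (trc A B X1) \<and>
            in_m2_2 (trc A B X2)"
          using W1 W2 ell by blast
        have "case_c A B \<kappa>" unfolding case_c_def ends using C(1) SL two yes by blast
        then show ?thesis using na nb nd k2 by (simp add: exactly_one_def)
      qed
    qed
  qed
qed

end
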